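(* Let $n\ge1$ and $f\in\mathcal{V}_n^{(1)}$, and write $U^{(1)}(f)=\sum_{r\ge1}\tilde s(r)\frac{y^r}{(1+5y)^{5n-4}}$ with $\tilde s(r)\in\mathbb{Z}$. Then \[ \frac15\left(U^{(1)}(f)-\tilde s(1)\frac{y}{(1+5y)^{5n-4}}\right)\in\mathcal{V}^{(0)}_{5n-4}. \]
   Context: $q=e^{2\pi i\tau}$, $E_2(\tau)=1-24\sum_{n\ge1}\frac{nq^n}{1-q^n}$, $F(\tau)=\frac1{24}(50E_2(10\tau)-25E_2(5\tau)-2E_2(2\tau)+E_2(\tau))$, $y=y(\tau)=q\prod_{m\ge1}\frac{(1-q^{2m})(1-q^{10m})^3}{(1-q^m)^3(1-q^{5m})}$. For $f=\sum_{m\ge M}a(m)q^m$, $U_5(f)=\sum_{5m\ge M}a(5m)q^m$; $U^{(1)}(f)=U_5(Ff)/F$. A function $s:\mathbb{Z}\to\mathbb{Z}$ is discrete if $s(m)=0$ for all sufficiently large $m$. Let $\theta(m)=\lfloor\frac{5m-5}{6}\rfloor$ for $m=1,2$ and $\theta(m)=\lfloor\frac{5m-5}{6}\rfloor-1$ for $m\ge3$; $\phi(m)=\lfloor\frac{5m-5}{6}\rfloor$ for $1\le m\le3$ and $\phi(m)=\lfloor\frac{5m-5}{6}\rfloor-1$ for $m\ge4$. For $n\ge1$ define $\mathcal{V}^{(0)}_n=\{(1+5y)^{-n}\sum_{m\ge1}s(m)5^{\phi(m)}y^m : s\text{ discrete}\}$ and $\mathcal{V}^{(1)}_n=\{(1+5y)^{-n}\sum_{m\ge1}s(m)5^{\theta(m)}y^m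 : s\text{ discrete}\}$. *)

theory Defs
  imports
    "HOL-Analysis.Analysis"
    "HOL-Computational_Algebra.Formal_Laurent_Series"
begin

text \<open>
  Functions of \<open>\<tau>\<close> are represented by their expansions in \<open>q = exp (2 \<pi> i \<tau>)\<close>, the indeterminate
  being \<open>q\<close>. Infinite sums and products are taken in the topology of formal power series over the
  complex numbers; they converge by \<open>E2_summable\<close> and \<open>y_convergent_prod\<close> below.
\<close>

definition E2_term :: "nat \<Rightarrow> complex fps" where
  "E2_term n = of_nat n * fps_X ^ n / (1 - fps_X ^ n)"

definition E2 :: "complex fps" where
  "E2 = 1 - 24 * (\<Sum>n. E2_term (Suc n))"

text \<open>Replacing \<open>\<tau>\<close> by \<open>k * \<tau>\<close> amounts to replacing \<open>q\<close> by \<open>q ^ k\<close>.\<close>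

definition F_fps :: "complex fps" where
  "F_fps = fps_const (1 / 24) *
     (50 * (E2 oo fps_X ^ 10) - 25 * (E2 oo fps_X ^ 5) - 2 * (E2 oo fps_X ^ 2) + E2)"

definition y_factor :: "nat \<Rightarrow> complex fps" where
  "y_factor m = (1 - fps_X ^ (2 * m)) * (1 - fps_X ^ (10 * m)) ^ 3 /
                ((1 - fps_X ^ m) ^ 3 * (1 - fps_X ^ (5 * m)))"

definition y_fps :: "complex fps" where
  "y_fps = fps_X * (\<Prod>m. y_factor (Suc m))"

abbreviation F :: "complex fls" where "F \<equiv> fps_to_fls F_fps"
abbreviation y :: "complex fls" where "y \<equiv> fps_to_fls y_fps"

definition U5 :: "complex fls \<Rightarrow> complex fls" where
  "U5 f = Abs_fls (\<lambda>m. fls_nth f (5 * m))"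

definition U1 :: "complex fls \<Rightarrow> complex fls" where
  "U1 f = U5 (F * f) / F"

definition discrete_fun :: "(int \<Rightarrow> int) \<Rightarrow> bool" where
  "discrete_fun s \<longleftrightarrow> (\<exists>N. \<forall>m\<ge>N. s m = 0)"

text \<open>\<open>ysum c\<close> is the sum of \<open>c m * y ^ m\<close> over \<open>m \<ge> 1\<close>. The index set is finite
  whenever \<open>c\<close> satisfies \<open>discrete_fun\<close>, which is the only case in which \<open>ysum\<close> is used.\<close>

definition ysum :: "(int \<Rightarrow> int) \<Rightarrow> complex fls" where
  "ysum c = (\<Sum>m | m \<ge> 1 \<and> c m \<noteq> 0. of_int (c m) * y powi m)"

definition theta :: "int \<Rightarrow> int" where
  "theta m = (if m \<le> 2 then (5 * m - 5) div 6 else (5 * m - 5) div 6 - 1)"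

definition phi :: "int \<Rightarrow> int" where
  "phi m = (if m \<le> 3 then (5 * m - 5) div 6 else (5 * m - 5) div 6 - 1)"

text \<open>The exponents \<open>theta m\<close> and \<open>phi m\<close> are nonnegative for \<open>m \<ge> 1\<close>, so applying \<open>nat\<close> to them
  loses nothing.\<close>

definition V0 :: "nat \<Rightarrow> complex fls set" where
  "V0 n = {ysum (\<lambda>m. s m * 5 ^ nat (phi m)) / (1 + 5 * y) ^ n | s. discrete_fun s}"

definition V1 :: "nat \<Rightarrow> complex fls set" where
  "V1 n = {ysum (\<lambda>m. s m * 5 ^ nat (theta m)) / (1 + 5 * y) ^ n | s. discrete_fun s}"

lemma U5_nth: "fls_nth (U5 f) m = fls_nth f (5 * m)"
proof -
  have "\<forall>m < min 0 (fls_subdegree f). fls_nth f (5 * m) = 0"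
    by (auto intro!: fls_eq0_below_subdegree)
  then show ?thesis
    unfolding U5_def by (subst nth_Abs_fls_lower_bound[of "min 0 (fls_subdegree f)"]) auto
qed

lemma finite_ysum_support:
  assumes "discrete_fun s"
  shows "finite {m. m \<ge> 1 \<and> s m * k m \<noteq> 0}"
proof -
  obtain N where "\<forall>m\<ge>N. s m = 0" using assms by (auto simp: discrete_fun_def)
  then have "m \<le> N" if "s m * k m \<noteq> 0" for m
    using that by (metis linear mult_zero_left)
  then have "{m. m \<ge> 1 \<and> s m * k m \<noteq> 0} \<subseteq> {1..N}" by auto
  then show ?thesis using finite_subset by blast
qed

lemma theta_nonneg: "m \<ge> 1 \<Longrightarrow> theta m \<ge> 0"
  and phi_nonneg: "m \<ge> 1 \<Longrightarrow> phi m \<ge> 0"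
  by (auto simp: theta_def phi_def)

lemma E2_summable: "summable (\<lambda>n. E2_term (Suc n))"
proof -
  have z: "fps_nth (E2_term (Suc n)) k = 0" if "k \<le> n" for n k
  proof -
    have "E2_term (Suc n) =
        fps_X ^ Suc n * (of_nat (Suc n) * inverse (1 - fps_X ^ Suc n))"
      unfolding E2_term_def by (subst fps_divide_unit) (simp_all add: mult_ac del: power_Suc)
    then show ?thesis
      using that by (simp add: fps_X_power_mult_nth del: power_Suc)
  qed
  define L where "L = Abs_fps (\<lambda>k. \<Sum>n<k. fps_nth (E2_term (Suc n)) k)"
  have "(\<lambda>N. \<Sum>n<N. E2_term (Suc n)) \<longlonglongrightarrow> L"
  proof (rule tendsto_fpsI)
    fix k
    show "\<forall>\<^sub>F N in sequentially. fps_nth (\<Sum>n<N. E2_term (Suc n)) k = fps_nth L k"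
      using eventually_ge_at_top[of k]
    proof eventually_elim
      case (elim N)
      then show ?case
        unfolding L_def fps_sum_nth fps_nth_Abs_fps
        by (intro sum.mono_neutral_right) (auto simp: z)
    qed
  qed
  then show ?thesis by (auto simp: summable_def sums_def)
qed

lemma y_convergent_prod: "convergent_prod (\<lambda>m. y_factor (Suc m))"
proof -
  have z: "\<exists>h. y_factor (Suc n) = 1 + fps_X ^ Suc n * h" for n
  proof -
    define x :: "complex fps" where "x = fps_X ^ Suc n"
    define d where "d = (1 - x) ^ 3 * (1 - x ^ 5)"
    have x0: "fps_nth x 0 = 0" by (simp add: x_def)
    have d0: "fps_nth d 0 \<noteq> 0" by (simp add: d_def x0 fps_power_zeroth)
    have p: "fps_X ^ (k * Suc n) = x ^ k" for k
      by (simp add: x_def power_mult [symmetric] mult.commute del: power_Suc)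
    have mult: "x dvd a * b - 1" if "x dvd a - 1" "x dvd b - 1" for a b :: "complex fps"
    proof -
      have "a * b - 1 = (a - 1) * b + (b - 1)" by (simp add: algebra_simps)
      then show ?thesis using that by (metis dvd_add dvd_mult2)
    qed
    have pow: "x dvd a ^ 3 - 1" if "x dvd a - 1" for a :: "complex fps"
      using that by (simp add: power3_eq_cube mult)
    have base: "x dvd (1 - x ^ k) - 1" if "k > 0" for k
      using that by (simp add: dvd_power)
    have "x dvd (1 - x ^ 2) * (1 - x ^ 10) ^ 3 - 1" by (intro mult pow base) simp_all
    moreover have "x dvd d - 1" unfolding d_def
      using base[of 1] by (intro mult pow base) simp_all
    ultimately have "x dvd ((1 - x ^ 2) * (1 - x ^ 10) ^ 3 - 1) - (d - 1)"
      by (rule dvd_diff)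
    then have "x dvd (1 - x ^ 2) * (1 - x ^ 10) ^ 3 - d"
      by (simp only: diff_diff_eq2 diff_add_cancel)
    then obtain g where "(1 - x ^ 2) * (1 - x ^ 10) ^ 3 - d = x * g"
      by (elim dvdE)
    then have g: "(1 - x ^ 2) * (1 - x ^ 10) ^ 3 = d + x * g"
      by (metis add.commute diff_add_cancel)
    have "y_factor (Suc n) = (1 - x ^ 2) * (1 - x ^ 10) ^ 3 / d"
      unfolding y_factor_def d_def by (simp only: p) (simp only: x_def)
    also have "\<dots> = (d + x * g) * inverse d"
      using d0 by (simp add: g fps_divide_unit)
    also have "\<dots> = 1 + x * (g * inverse d)"
      using inverse_mult_eq_1'[OF d0] by (simp add: algebra_simps)
    finally show ?thesis unfolding x_def by blast
  qed
  define P where "P n = (\<Prod>i\<le>n. y_factor (Suc i))" for n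
  have step: "fps_nth (P (Suc n)) k = fps_nth (P n) k" if "k \<le> n" for n k
  proof -
    obtain h where h: "y_factor (Suc (Suc n)) = 1 + fps_X ^ Suc (Suc n) * h" using z by blast
    have "P (Suc n) = P n + fps_X ^ Suc (Suc n) * (P n * h)"
      unfolding P_def by (simp add: h algebra_simps del: power_Suc)
    then show ?thesis using that by (simp add: fps_X_power_mult_nth del: power_Suc)
  qed
  have stab: "fps_nth (P n) k = fps_nth (P k) k" if "k \<le> n" for n k
    using that by (induction n rule: dec_induct) (auto simp: step)
  define L where "L = Abs_fps (\<lambda>k. fps_nth (P k) k)"
  have "P \<longlonglongrightarrow> L"
  proof (rule tendsto_fpsI)
    fix k
    show "\<forall>\<^sub>F n in sequentially. fps_nth (P n) k = fps_nth L k"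
      using eventually_ge_at_top[of k] by eventually_elim (unfold L_def fps_nth_Abs_fps, rule stab)
  qed
  moreover have "L \<noteq> 0"
  proof -
    obtain h where "y_factor (Suc 0) = 1 + fps_X ^ Suc 0 * h" using z by blast
    then have "fps_nth L 0 = 1" by (simp add: L_def P_def)
    then show ?thesis by auto
  qed
  ultimately have "raw_has_prod (\<lambda>m. y_factor (Suc m)) 0 L"
    by (simp add: raw_has_prod_def P_def[abs_def])
  then show ?thesis by (auto simp: convergent_prod_def)
qed

end

theory Submission
  imports Defs
begin

text \<open>
  Write \<open>\<Theta> = q d/dq\<close>. Since \<open>F\<close> is the logarithmic derivative of \<open>y / (1 + 4 y)\<close>, the function
  \<open>U1 f\<close> is the trace of the differential \<open>f dlog (y / (1 + 4 y))\<close> from level 50 to level 10, divided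
  by \<open>dlog (y / (1 + 4 y))\<close>. Everything therefore follows from the equation of degree five satisfied by
  \<open>y(q)\<close> over the series in \<open>y(q\<^sup>5)\<close>.

  That equation comes from \<open>1 + 4 y = \<phi>(-q\<^sup>5)\<^sup>2 / \<phi>(-q)\<^sup>2\<close>, where \<open>\<phi>(-q) = \<Sum> (-1)\<^sup>j q\<^bsup>j\<^sup>2\<^esup>\<close>: in the
  5-dissection \<open>\<phi>(-q) = t + a + b\<close> with \<open>t = \<phi>(-q\<^bsup>25\<^esup>)\<close>, the product \<open>a b\<close> is
  \<open>\<phi>(-q\<^sup>5)\<^sup>2 - t\<^sup>2\<close>, because the lattice \<open>j \<equiv> 2 i (mod 5)\<close> is similar to \<open>\<int>\<^sup>2\<close>, and the norm of \<open>\<phi>(-q)\<close> is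
  \<open>\<phi>(-q\<^sup>5)\<^sup>6 / t\<close>. The product formulas are instances of the Jacobi triple product.

  The equation gives a recurrence of order five for \<open>U1 (y\<^sup>m)\<close>, whose coefficients
  have enough factors 5 to show by induction that the coefficient of \<open>y\<^sup>r\<close> in \<open>U1 (y\<^sup>m)\<close> is divisible by
  \<open>5\<close> to the power \<open>\<lfloor>(5 r - m) / 6\<rfloor>\<close>. Powers of \<open>1 + 5 y\<close>, of either sign, preserve such
  divisibility conditions, so the denominators only matter for the orders of the poles.
\<close>

text \<open>Two things are needed of the numerator of \<open>U1 f\<close>: it is a polynomial in y,
  and its coefficients are divisible by powers of 5. They are proved separately. For divisibility
  the factor (1 + 5 y)^(-n) is expanded as a power series in y, where its pole is invisible; so the
  operator has to act on all power series in y, and this is the role of \<open>UF\<close>.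
  Polynomiality comes from the modular equation rewritten in 1 + 5 y, whose constant term is a pure
  fifth power: a simple pole stays simple and each further order adds five, hence 5 n - 4.

  The factor F keeps U1 (y^m) from being a plain trace of y^m. The starting values of the recurrence
  come from the traces of y^m by differentiation, since U5 Theta = 5 Theta U5 and Theta (y^m) = m F
  (y^m + 4 y^(m+1)). Only U1 y = y needs an argument of its own, the norm of 1 + 4 y. This value is
  also why the coefficient of y is subtracted in the theorem: it is 1, which 5^(phi 1 + 1) = 5 does
  not divide.\<close>

lemma fps_X_power_dvd_iff: "fps_X ^ k dvd (f :: complex fps) \<longleftrightarrow> (\<forall>i<k. fps_nth f i = 0)"
proof
  assume "fps_X ^ k dvd f"
  then show "\<forall>i<k. fps_nth f i = 0"
    by (auto simp: fps_X_power_mult_nth elim!: dvdE)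
next
  assume a: "\<forall>i<k. fps_nth f i = 0"
  have "f = fps_X ^ k * fps_shift k f"
    using a by (intro fps_ext) (auto simp: fps_X_power_mult_nth)
  then show "fps_X ^ k dvd f" by (metis dvd_triv_left)
qed

section \<open>Limits of formal power series: convergence means that each coefficient is eventually
  constant\<close>

lemma tendsto_mult_fps:
  fixes a b :: "complex fps"
  assumes f: "(f \<longlongrightarrow> a) G" and g: "(g \<longlongrightarrow> b) G"
  shows "((\<lambda>x. f x * g x) \<longlongrightarrow> a * b) G"
proof (rule tendsto_fpsI)
  fix n
  have "\<forall>\<^sub>F x in G. \<forall>i\<in>{..n}. fps_nth (f x) i = fps_nth a i"
    using f by (simp add: tendsto_fps_iff eventually_ball_finite_distrib)
  moreover have "\<forall>\<^sub>F x in G. \<forall>i\<in>{..n}. fps_nth (g x) i = fps_nth b i"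
    using g by (simp add: tendsto_fps_iff eventually_ball_finite_distrib)
  ultimately show "\<forall>\<^sub>F x in G. fps_nth (f x * g x) n = fps_nth (a * b) n"
    by eventually_elim (auto simp: fps_mult_nth)
qed

lemma tendsto_power_fps:
  fixes a :: "complex fps"
  assumes "(f \<longlongrightarrow> a) G"
  shows "((\<lambda>x. f x ^ n) \<longlongrightarrow> a ^ n) G"
  by (induction n) (auto intro: tendsto_mult_fps assms)

lemma tendsto_prod_fps:
  fixes a :: "'i \<Rightarrow> complex fps"
  assumes "\<And>i. i \<in> I \<Longrightarrow> ((\<lambda>x. f x i) \<longlongrightarrow> a i) G"
  shows "((\<lambda>x. \<Prod>i\<in>I. f x i) \<longlongrightarrow> (\<Prod>i\<in>I. a i)) G"
  using assms by (induction I rule: infinite_finite_induct) (auto intro!: tendsto_mult_fps)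

lemma tendsto_compose_fps:
  fixes a :: "complex fps"
  assumes "(f \<longlongrightarrow> a) G"
  shows "((\<lambda>x. f x oo g) \<longlongrightarrow> a oo g) G"
proof (rule tendsto_fpsI)
  fix n
  have "\<forall>\<^sub>F x in G. \<forall>i\<in>{..n}. fps_nth (f x) i = fps_nth a i"
    using assms by (simp add: tendsto_fps_iff eventually_ball_finite_distrib)
  then show "\<forall>\<^sub>F x in G. fps_nth (f x oo g) n = fps_nth (a oo g) n"
    by eventually_elim (auto simp: fps_compose_nth)
qed

lemma fps_tendsto_unique:
  fixes a b :: "complex fps"
  assumes "f \<longlonglongrightarrow> a" "f \<longlonglongrightarrow> b"
  shows "a = b"
  using assms by (rule LIMSEQ_unique)

section \<open>Infinite products and the Jacobi triple product\<close>

text \<open>The infinite product (q^a; q^b), so that \<open>qpoch k k\<close> is Euler's function at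
  q^k. For a, b > 0 every factor of index k >= n is 1 modulo q^(n+1), so the coefficient of q^n can
  be read off the first n factors.\<close>

definition qpoch :: "nat \<Rightarrow> nat \<Rightarrow> complex fps" where
  "qpoch a b = Abs_fps (\<lambda>n. fps_nth (\<Prod>k<n. 1 - fps_X ^ (a + b * k)) n)"

lemma qpoch_LIMSEQ:
  assumes "a > 0" "b > 0"
  shows "(\<lambda>n. \<Prod>k<n. 1 - fps_X ^ (a + b * k)) \<longlonglongrightarrow> qpoch a b"
proof (rule tendsto_fpsI)
  fix m
  define P where "P n = (\<Prod>k<n. 1 - fps_X ^ (a + b * k) :: complex fps)" for n
  have "fps_nth (P n) m = fps_nth (P m) m" if "m \<le> n" for n
    using that
  proof (induction n rule: dec_induct)
    case (step n)
    have "m < a + n" using step(1) assms by simp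
    also have "a + n \<le> a + b * n" using assms by simp
    finally have "m < a + b * n" .
    then show ?case using step
      by (simp add: P_def right_diff_distrib fps_X_power_mult_right_nth)
  qed simp
  then show "\<forall>\<^sub>F n in sequentially. fps_nth (P n) m = fps_nth (qpoch a b) m"
    unfolding qpoch_def fps_nth_Abs_fps P_def[symmetric]
    by (intro eventually_sequentiallyI[of m])
qed

lemma qpoch_nth_0 [simp]: "fps_nth (qpoch a b) 0 = 1"
  by (simp add: qpoch_def)

lemma qpoch_nonzero [simp]: "qpoch a b \<noteq> 0"
  using qpoch_nth_0[of a b] by (metis fps_zero_nth zero_neq_one)

text \<open>The factors are sorted by the residue of their index modulo d; partial products of
  length n d contain n factors of each class.\<close>

lemma qpoch_dissect:
  assumes "a > 0" "b > 0" "d > 0"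
  shows "qpoch a b = (\<Prod>i<d. qpoch (a + b * i) (b * d))"
proof -
  let ?f = "\<lambda>k. 1 - fps_X ^ (a + b * k) :: complex fps"
  have "(\<lambda>n. \<Prod>k<n * d. ?f k) \<longlonglongrightarrow> qpoch a b"
    using LIMSEQ_subseq_LIMSEQ[OF qpoch_LIMSEQ[OF assms(1,2)], of "\<lambda>n. n * d"] assms(3)
    by (simp add: strict_mono_def o_def)
  moreover have "(\<Prod>k<n * d. ?f k) = (\<Prod>i<d. \<Prod>k<n. 1 - fps_X ^ ((a + b * i) + (b * d) * k))" for n
  proof -
    have "(\<Prod>k<n * d. ?f k) = (\<Prod>k<n. \<Prod>i\<in>{k*d..<k*d+d}. ?f i)"
      by (rule prod.nat_group[symmetric])
    also have "\<dots> = (\<Prod>k<n. \<Prod>i<d. ?f (k * d + i))"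
    proof (rule prod.cong[OF refl])
      fix k
      show "(\<Prod>i\<in>{k*d..<k*d+d}. ?f i) = (\<Prod>i<d. ?f (k * d + i))"
        by (rule prod.reindex_bij_witness[of _ "\<lambda>i. k * d + i" "\<lambda>i. i - k * d"]) auto
    qed
    also have "\<dots> = (\<Prod>i<d. \<Prod>k<n. ?f (k * d + i))" by (rule prod.swap)
    finally show ?thesis by (simp add: algebra_simps)
  qed
  moreover have "(\<lambda>n. \<Prod>i<d. \<Prod>k<n. 1 - fps_X ^ ((a + b * i) + (b * d) * k))
      \<longlonglongrightarrow> (\<Prod>i<d. qpoch (a + b * i) (b * d))"
    using assms by (intro tendsto_prod_fps qpoch_LIMSEQ) auto
  ultimately show ?thesis by (auto intro: fps_tendsto_unique)
qed

lemma fps_X_power_compose: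
  fixes g :: "complex fps"
  assumes "fps_nth g 0 = 0"
  shows "fps_X ^ n oo g = g ^ n"
  by (metis assms fps_X_fps_compose_startby0 fps_compose_power)

lemma fps_compose_diff_one: "(1 - f) oo g = 1 - (f oo g :: complex fps)"
  by (simp add: fps_compose_sub_distrib)

lemma qpoch_compose:
  assumes "a > 0" "b > 0" "k > 0"
  shows "qpoch a b oo fps_X ^ k = qpoch (k * a) (k * b)"
proof (rule fps_tendsto_unique)
  have k0: "fps_nth (fps_X ^ k :: complex fps) 0 = 0" using assms by (simp add: fps_X_power_nth)
  have "(\<lambda>n. (\<Prod>i<n. 1 - fps_X ^ (a + b * i)) oo fps_X ^ k) \<longlonglongrightarrow> (qpoch a b oo fps_X ^ k)"
    by (intro tendsto_compose_fps qpoch_LIMSEQ assms)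
  moreover have "((\<Prod>i<n. 1 - fps_X ^ (a + b * i)) oo fps_X ^ k)
      = (\<Prod>i<n. 1 - fps_X ^ (k * a + k * b * i) :: complex fps)" for n
    by (simp add: fps_compose_prod_distrib[OF k0] fps_compose_diff_one
        fps_X_power_compose[OF k0] flip: power_mult) (simp add: algebra_simps)
  ultimately show "(\<lambda>n. (\<Prod>i<n. 1 - fps_X ^ (k * a + k * b * i))) \<longlonglongrightarrow> (qpoch a b oo fps_X ^ k)"
    by simp
qed (use assms in \<open>auto intro: qpoch_LIMSEQ\<close>)

section \<open>Generating series over arbitrary index sets\<close>

definition isum :: "'i set \<Rightarrow> ('i \<Rightarrow> nat) \<Rightarrow> ('i \<Rightarrow> complex) \<Rightarrow> complex fps" where
  "isum I e c = Abs_fps (\<lambda>n. \<Sum>i | i \<in> I \<and> e i = n. c i)"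

text \<open>A sum over an infinite set has the value 0, so \<open>isum\<close> is the intended
  generating series only if every exponent is attained finitely often.\<close>

definition finite_fibres :: "'i set \<Rightarrow> ('i \<Rightarrow> nat) \<Rightarrow> bool" where
  "finite_fibres I e \<longleftrightarrow> (\<forall>n. finite {i \<in> I. e i = n})"

lemma isum_cong:
  assumes "I = J" "\<And>i. i \<in> J \<Longrightarrow> e i = f i" "\<And>i. i \<in> J \<Longrightarrow> c i = d i"
  shows "isum I e c = isum J f d"
  unfolding isum_def using assms by (intro fps_ext) (auto intro!: sum.cong)

lemma isum_reindex:
  assumes "bij_betw h J I"
  shows "isum I e c = isum J (e \<circ> h) (c \<circ> h)"
proof (rule fps_ext)
  fix n
  have "bij_betw h {j \<in> J. (e \<circ> h) j = n} {i \<in> I. e i = n}"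
    using assms by (auto simp: bij_betw_def inj_on_def)
  then show "fps_nth (isum I e c) n = fps_nth (isum J (e \<circ> h) (c \<circ> h)) n"
    by (simp add: isum_def sum.reindex_bij_betw[symmetric])
qed

lemma isum_mult:
  assumes "finite_fibres I e" "finite_fibres J f"
  shows "isum I e c * isum J f d = isum (I \<times> J) (\<lambda>(i, j). e i + f j) (\<lambda>(i, j). c i * d j)"
proof (rule fps_ext)
  fix n
  let ?A = "\<lambda>k. {i \<in> I. e i = k}" and ?B = "\<lambda>k. {j \<in> J. f j = k}"
  have fin: "finite (?A k)" "finite (?B k)" for k
    using assms by (auto simp: finite_fibres_def)
  have "fps_nth (isum I e c * isum J f d) n
      = (\<Sum>k=0..n. \<Sum>(i, j)\<in>?A k \<times> ?B (n - k). c i * d j)"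
    by (simp add: fps_mult_nth isum_def sum_product sum.cartesian_product)
  also have "\<dots> = (\<Sum>(i, j)\<in>(\<Union>k\<in>{0..n}. ?A k \<times> ?B (n - k)). c i * d j)"
    by (rule sum.UNION_disjoint[symmetric]) (auto simp: fin)
  also have "(\<Union>k\<in>{0..n}. ?A k \<times> ?B (n - k)) = {p \<in> I \<times> J. (case p of (i, j) \<Rightarrow> e i + f j) = n}"
    by auto
  finally show "fps_nth (isum I e c * isum J f d) n
      = fps_nth (isum (I \<times> J) (\<lambda>(i, j). e i + f j) (\<lambda>(i, j). c i * d j)) n"
    by (simp add: isum_def)
qed

lemma isum_UN:
  assumes "finite S" "finite_fibres (\<Union>s\<in>S. I s) e" "disjoint_family_on I S"
  shows "isum (\<Union>s\<in>S. I s) e c = (\<Sum>s\<in>S. isum (I s) e c)"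
proof (rule fps_ext)
  fix n
  have "{i. i \<in> (\<Union>s\<in>S. I s) \<and> e i = n} = (\<Union>s\<in>S. {i. i \<in> I s \<and> e i = n})" by auto
  moreover have "finite {i. i \<in> I s \<and> e i = n}" if "s \<in> S" for s
    using assms(2) that unfolding finite_fibres_def
    by (rule_tac finite_subset[of _ "{i \<in> (\<Union>s\<in>S. I s). e i = n}"]) auto
  moreover have "\<forall>i\<in>S. \<forall>j\<in>S. i \<noteq> j \<longrightarrow> {x. x \<in> I i \<and> e x = n} \<inter> {x. x \<in> I j \<and> e x = n} = {}"
    using assms(3) by (auto simp: disjoint_family_on_def)
  ultimately show "fps_nth (isum (\<Union>s\<in>S. I s) e c) n = fps_nth (\<Sum>s\<in>S. isum (I s) e c) n"
    using assms(1) by (simp add: isum_def fps_sum_nth sum.UNION_disjoint)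
qed

lemma isum_shift: "isum I (\<lambda>i. k + e i) (\<lambda>i. a * c i) = fps_const a * fps_X ^ k * isum I e c"
proof (rule fps_ext)
  fix n
  have "{i. i \<in> I \<and> k + e i = n} = (if n < k then {} else {i. i \<in> I \<and> e i = n - k})" by auto
  then show "fps_nth (isum I (\<lambda>i. k + e i) (\<lambda>i. a * c i)) n
      = fps_nth (fps_const a * fps_X ^ k * isum I e c) n"
    by (simp add: isum_def mult.assoc fps_X_power_mult_nth sum_distrib_left)
qed

lemma isum_compose:
  assumes "k > 0"
  shows "isum I e c oo fps_X ^ k = isum I (\<lambda>i. k * e i) c"
proof (rule fps_ext)
  fix n
  have "{i. i \<in> I \<and> k * e i = n} = (if k dvd n then {i. i \<in> I \<and> e i = n div k} else {})"
    using assms by auto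
  then show "fps_nth (isum I e c oo fps_X ^ k) n = fps_nth (isum I (\<lambda>i. k * e i) c) n"
    using assms by (simp add: isum_def fps_nth_compose_X_power)
qed

section \<open>The triple product, first in a finite form\<close>

definition alt :: "int \<Rightarrow> complex" where
  "alt j = (if even j then 1 else -1)"

text \<open>Exponents of Ramanujan's theta function f(A, B), the sum of A^(j(j+1)/2) B^(j(j-1)/2),
  at A = -q^a and B = -q^b. The sign of the term is (-1)^(j^2), which is
  \<open>alt j\<close>.\<close>

definition jexp :: "nat \<Rightarrow> nat \<Rightarrow> int \<Rightarrow> nat" where
  "jexp a b j = nat (int a * (j * (j + 1) div 2) + int b * (j * (j - 1) div 2))"

lemma tri_nonneg: "(j::int) * (j + 1) div 2 \<ge> 0" "(j::int) * (j - 1) div 2 \<ge> 0"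
proof -
  have "j * (j + 1) \<ge> 0" "j * (j - 1) \<ge> 0"
    by (auto simp: zero_le_mult_iff)
  then show "(j::int) * (j + 1) div 2 \<ge> 0" "(j::int) * (j - 1) div 2 \<ge> 0" by auto
qed

text \<open>Doubling clears the two divisions; identities between exponents are proved in this
  form.\<close>

lemma int_jexp: "2 * int (jexp a b j) = int a * (j * (j + 1)) + int b * (j * (j - 1))"
proof -
  have "int (jexp a b j) = int a * (j * (j + 1) div 2) + int b * (j * (j - 1) div 2)"
    unfolding jexp_def using tri_nonneg[of j] by simp
  moreover have "2 * (j * (j + 1) div 2) = j * (j + 1)" "2 * (j * (j - 1) div 2) = j * (j - 1)"
    by (simp_all add: dvd_mult_div_cancel)
  ultimately show ?thesis by (simp add: algebra_simps)
qed

lemma jexp_ge: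
  assumes "a > 0" "b > 0"
  shows "\<bar>j\<bar> \<le> int (jexp a b j)"
proof -
  have "j * (j + 1) \<ge> 0" "j * (j - 1) \<ge> 0"
    by (auto simp: zero_le_mult_iff)
  then have "int 1 * (j * (j + 1)) + int 1 * (j * (j - 1)) \<le> int a * (j * (j + 1)) + int b * (j * (j - 1))"
    using assms by (intro add_mono mult_right_mono) auto
  then have "2 * (j * j) \<le> 2 * int (jexp a b j)" unfolding int_jexp by (simp add: algebra_simps)
  moreover have "\<bar>j\<bar> \<le> j * j"
    using mult_left_mono[of 1 "\<bar>j\<bar>" "\<bar>j\<bar>"] by (cases "j = 0") auto
  ultimately show ?thesis by linarith
qed

lemma finite_fibres_jexp: "a > 0 \<Longrightarrow> b > 0 \<Longrightarrow> finite_fibres UNIV (jexp a b)"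
  unfolding finite_fibres_def
proof
  fix n assume "a > 0" "b > 0"
  then have "{i \<in> UNIV. jexp a b i = n} \<subseteq> {- int n..int n}"
    using jexp_ge[of a b] by (auto simp: abs_le_iff) (smt (verit))+
  then show "finite {i \<in> UNIV. jexp a b i = n}" using finite_subset by blast
qed

lemma jexp_sym: "jexp b a (- j) = jexp a b j"
proof -
  have "2 * int (jexp b a (- j)) = 2 * int (jexp a b j)"
    unfolding int_jexp by (simp add: algebra_simps)
  then show ?thesis by simp
qed

text \<open>With the value 0 at negative \<open>n\<close>, the terms of the finite triple product vanish outside their
  natural range, so all sums can run over a common interval.\<close>

definition rec_qfact :: "nat \<Rightarrow> int \<Rightarrow> complex fps" where
  "rec_qfact c n = (if n < 0 then 0 else inverse (\<Prod>k<nat n. 1 - fps_X ^ (c + c * k)))"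

lemma rec_qfact_step:
  assumes "c > 0" "n \<ge> 0"
  shows "(1 - fps_X ^ (c * nat n)) * rec_qfact c n = rec_qfact c (n - 1)"
proof (cases "n = 0")
  case False
  define m where "m = nat (n - 1)"
  have n: "n = int (Suc m)" using False assms(2) by (auto simp: m_def)
  define D where "D = (1 - fps_X ^ (c + c * m) :: complex fps)"
  have "fps_nth D 0 \<noteq> 0" using assms by (simp add: D_def fps_X_power_nth)
  then have inv: "inverse D * D = 1" by (rule inverse_mult_eq_1)
  have "nat n = Suc m" "nat (n - 1) = m" "\<not> n < 0" "\<not> n - 1 < 0" using n by auto
  then have "rec_qfact c n = rec_qfact c (n - 1) * inverse D" and e: "1 - fps_X ^ (c * nat n) = D"
    by (simp_all add: rec_qfact_def fps_inverse_mult D_def)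
  then have "(1 - fps_X ^ (c * nat n)) * rec_qfact c n = rec_qfact c (n - 1) * (inverse D * D)"
    by (simp only: mult_ac)
  then show ?thesis by (simp only: inv mult_1_right)
qed (simp add: rec_qfact_def)

text \<open>With Q = q^(a+b), the two reciprocals are the Gaussian binomial coefficient of M+N over
  M+j divided by (1 - Q) ... (1 - Q^(M+N)). In this normalisation each term has a limit when M and N
  grow.\<close>

definition jterm :: "nat \<Rightarrow> nat \<Rightarrow> nat \<Rightarrow> nat \<Rightarrow> int \<Rightarrow> complex fps" where
  "jterm a b M N j = fps_const (alt j) * rec_qfact (a + b) (int M + j) *
     rec_qfact (a + b) (int N - j) * fps_X ^ jexp a b j"

text \<open>The sum runs over any symmetric interval that is large enough, rather than over -M..N,
  so that a shift of j by one in the induction changes nothing.\<close>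

definition finite_jtp :: "nat \<Rightarrow> nat \<Rightarrow> nat \<Rightarrow> nat \<Rightarrow> bool" where
  "finite_jtp a b M N \<longleftrightarrow> (\<forall>L \<ge> int M + int N.
     rec_qfact (a + b) (int M + int N) * (\<Prod>k<M. 1 - fps_X ^ (b + (a + b) * k)) *
       (\<Prod>k<N. 1 - fps_X ^ (a + (a + b) * k)) = (\<Sum>j=-L..L. jterm a b M N j))"

text \<open>The substitution j -> -j exchanges the two products, so that a step in N alone is enough
  for the induction.\<close>

lemma finite_jtp_sym:
  assumes "finite_jtp a b M N"
  shows "finite_jtp b a N M"
  unfolding finite_jtp_def
proof (intro allI impI)
  fix L assume L: "int N + int M \<le> L"
  have "(\<Sum>j=-L..L. jterm b a N M j) = (\<Sum>j=-L..L. jterm b a N M (- j))"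
    by (rule sum.reindex_bij_witness[of _ uminus uminus]) auto
  also have "\<dots> = (\<Sum>j=-L..L. jterm a b M N j)"
    by (intro sum.cong) (auto simp: jterm_def jexp_sym alt_def add.commute mult_ac)
  finally show "rec_qfact (b + a) (int N + int M) * (\<Prod>k<N. 1 - fps_X ^ (a + (b + a) * k)) *
       (\<Prod>k<M. 1 - fps_X ^ (b + (b + a) * k)) = (\<Sum>j=-L..L. jterm b a N M j)"
    using assms L by (auto simp: finite_jtp_def add_ac mult_ac)
qed

lemma finite_jtp_0:
  assumes "a > 0" "b > 0"
  shows "finite_jtp a b 0 0"
  unfolding finite_jtp_def
proof (intro allI impI)
  fix L assume "int 0 + int 0 \<le> L"
  then have "(\<Sum>j=-L..L. jterm a b 0 0 j) = (\<Sum>j\<in>{0}. jterm a b 0 0 j)"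
    by (intro sum.mono_neutral_right) (auto simp: jterm_def rec_qfact_def)
  then show "rec_qfact (a + b) (int 0 + int 0) * (\<Prod>k<0. 1 - fps_X ^ (b + (a + b) * k)) *
       (\<Prod>k<0. 1 - fps_X ^ (a + (a + b) * k)) = (\<Sum>j=-L..L. jterm a b 0 0 j)"
    by (simp add: jterm_def rec_qfact_def alt_def jexp_def)
qed

text \<open>The summand of index \<open>j\<close> splits as \<open>1 - Q^(M+N+1) = (1 - Q^(N+1-j)) + Q^(N+1-j) (1 - Q^(M+j))\<close>,
  which is the Pascal rule for Gaussian binomial coefficients.\<close>

lemma finite_jtp_Suc:
  assumes a: "a > 0" and b: "b > 0" and IH: "finite_jtp a b M N"
  shows "finite_jtp a b M (Suc N)"
  unfolding finite_jtp_def
proof (intro allI impI)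
  define c where "c = a + b"
  have c: "c > 0" using a by (simp add: c_def)
  fix L assume L: "int M + int (Suc N) \<le> L"
  define Q where "Q n = (fps_X ^ (c * nat n) :: complex fps)" for n
  let ?\<Pi> = "(\<Prod>k<M. 1 - fps_X ^ (b + c * k)) * (\<Prod>k<N. 1 - fps_X ^ (a + c * k)) :: complex fps"
  let ?S = "\<Sum>j=-L..L. jterm a b M N j"
  have split: "(1 - Q (int M + int (Suc N))) * jterm a b M (Suc N) j
      = jterm a b M N j - fps_X ^ (a + c * N) * jterm a b M N (j - 1)" for j
  proof -
    consider "int M + j < 0" | "j > int (Suc N)" | "int M + j \<ge> 0" "j \<le> int (Suc N)" by linarith
    then show ?thesis
    proof cases
      case 3
      have Qadd: "Q (int M + int (Suc N)) = Q (int (Suc N) - j) * Q (int M + j)"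
      proof -
        have "nat (int M + int (Suc N)) = nat (int (Suc N) - j) + nat (int M + j)" using 3 by arith
        then show ?thesis by (simp only: Q_def power_add distrib_left)
      qed
      have s1: "(1 - Q (int (Suc N) - j)) * rec_qfact c (int (Suc N) - j) = rec_qfact c (int N - j)"
        using rec_qfact_step[OF c, of "int (Suc N) - j"] 3 by (simp add: Q_def algebra_simps)
      have s2: "(1 - Q (int M + j)) * rec_qfact c (int M + j) = rec_qfact c (int M + (j - 1))"
        using rec_qfact_step[OF c, of "int M + j"] 3 by (simp add: Q_def algebra_simps)
      \<comment> \<open>From j - 1 to j the exponent \<open>jexp\<close> grows by a j + b (j - 1).
        Added to c (N + 1 - j) this gives a + c N, which is free of j and can be taken out of the
        sum.\<close>
      have "2 * (int c * (int (Suc N) - j) + int (jexp a b j))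
          = 2 * (int a + int c * int N + int (jexp a b (j - 1)))"
        unfolding distrib_left[of 2] int_jexp c_def by (simp add: algebra_simps)
      then have "int (c * nat (int (Suc N) - j) + jexp a b j) = int (a + c * N + jexp a b (j - 1))"
        using 3 by simp
      then have ex: "Q (int (Suc N) - j) * fps_X ^ jexp a b j = fps_X ^ (a + c * N) * fps_X ^ jexp a b (j - 1)"
        unfolding Q_def power_add[symmetric] of_nat_eq_iff by simp
      have al: "fps_const (alt (j - 1)) = - fps_const (alt j)" by (simp add: alt_def)
      have "(1 - Q (int M + int (Suc N))) * jterm a b M (Suc N) j
        = fps_const (alt j) * rec_qfact c (int M + j) * ((1 - Q (int (Suc N) - j)) * rec_qfact c (int (Suc N) - j)) * fps_X ^ jexp a b j
        + fps_const (alt j) * ((1 - Q (int M + j)) * rec_qfact c (int M + j)) * rec_qfact c (int (Suc N) - j) * (Q (int (Suc N) - j) * fps_X ^ jexp a b j)"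
        unfolding Qadd jterm_def c_def[symmetric] by (simp add: algebra_simps)
      also have "\<dots> = jterm a b M N j - fps_X ^ (a + c * N) * jterm a b M N (j - 1)"
        unfolding s1 s2 ex jterm_def c_def[symmetric] al
          by (simp add: algebra_simps del: fps_const_neg)
      finally show ?thesis .
    qed (auto simp: jterm_def rec_qfact_def)
  qed
  have zero: "jterm a b M N j = 0" if "j < - L \<or> j \<ge> L" for j
    using L that by (auto simp: jterm_def rec_qfact_def)
  have "(\<Sum>j=-L..L. jterm a b M N (j - 1)) = (\<Sum>j=-L-1..L-1. jterm a b M N j)"
    by (rule sum.reindex_bij_witness[of _ "\<lambda>j. j + 1" "\<lambda>j. j - 1"]) auto
  also have "\<dots> = (\<Sum>j=-L-1..L. jterm a b M N j)"
    by (rule sum.mono_neutral_left) (auto intro: zero)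
  also have "\<dots> = ?S"
    by (rule sum.mono_neutral_right) (auto intro: zero)
  finally have shift: "(\<Sum>j=-L..L. jterm a b M N (j - 1)) = ?S" .
  have "(1 - Q (int M + int (Suc N))) * (\<Sum>j=-L..L. jterm a b M (Suc N) j)
      = ?S - fps_X ^ (a + c * N) * (\<Sum>j=-L..L. jterm a b M N (j - 1))"
    by (simp only: sum_distrib_left split sum_subtractf)
  also have "\<dots> = (1 - fps_X ^ (a + c * N)) * ?S" unfolding shift by (simp add: algebra_simps)
  also have "?S = rec_qfact c (int M + int N) * ?\<Pi>"
    using IH[unfolded finite_jtp_def, rule_format, of L] L by (simp add: c_def mult.assoc)
  also have "rec_qfact c (int M + int N)
      = (1 - Q (int M + int (Suc N))) * rec_qfact c (int M + int (Suc N))"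
    using rec_qfact_step[OF c, of "int M + int (Suc N)"] by (simp add: Q_def)
  finally have "(1 - Q (int M + int (Suc N))) * (\<Sum>j=-L..L. jterm a b M (Suc N) j)
      = (1 - Q (int M + int (Suc N))) * (rec_qfact c (int M + int (Suc N)) *
        ((1 - fps_X ^ (a + c * N)) * ?\<Pi>))" by (simp add: mult_ac)
  moreover have "1 - Q (int M + int (Suc N)) \<noteq> 0"
  proof
    assume "1 - Q (int M + int (Suc N)) = 0"
    then have "fps_nth (1 - Q (int M + int (Suc N))) 0 = 0" by simp
    then show False using c by (simp add: Q_def fps_X_power_nth split: if_splits)
  qed
  ultimately have "(\<Sum>j=-L..L. jterm a b M (Suc N) j)
      = rec_qfact c (int M + int (Suc N)) * ((1 - fps_X ^ (a + c * N)) * ?\<Pi>)"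
    by simp
  then show "rec_qfact (a + b) (int M + int (Suc N)) * (\<Prod>k<M. 1 - fps_X ^ (b + (a + b) * k)) *
       (\<Prod>k<Suc N. 1 - fps_X ^ (a + (a + b) * k)) = (\<Sum>j=-L..L. jterm a b M (Suc N) j)"
    by (simp add: c_def mult_ac)
qed

lemma finite_jtp:
  assumes "a > 0" "b > 0"
  shows "finite_jtp a b M N"
proof -
  have "finite_jtp b a 0 M"
    using assms by (induction M) (auto intro: finite_jtp_0 finite_jtp_Suc)
  then have "finite_jtp a b M 0" by (rule finite_jtp_sym)
  then show ?thesis using assms by (induction N) (auto intro: finite_jtp_Suc)
qed

lemma rec_qfact_LIMSEQ:
  assumes "c > 0"
  shows "(\<lambda>n. rec_qfact c (int n + j)) \<longlonglongrightarrow> inverse (qpoch c c)"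
proof -
  let ?f = "\<lambda>n. inverse (\<Prod>k<n. 1 - fps_X ^ (c + c * k)) :: complex fps"
  have "?f \<longlonglongrightarrow> inverse (qpoch c c)"
    using assms by (intro tendsto_inverse_fps qpoch_LIMSEQ) auto
  moreover have "filterlim (\<lambda>n. nat (int n + j)) at_top sequentially"
    unfolding filterlim_at_top
  proof
    fix Z
    show "\<forall>\<^sub>F n in sequentially. Z \<le> nat (int n + j)"
      by (rule eventually_sequentiallyI[of "Z + nat \<bar>j\<bar>"]) linarith
  qed
  ultimately have "(\<lambda>n. ?f (nat (int n + j))) \<longlonglongrightarrow> inverse (qpoch c c)"
    by (rule filterlim_compose)
  moreover have "\<forall>\<^sub>F n in sequentially. ?f (nat (int n + j)) = rec_qfact c (int n + j)"
    by (rule eventually_sequentiallyI[of "nat \<bar>j\<bar>"]) (auto simp: rec_qfact_def)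
  ultimately show ?thesis by (rule Lim_transform_eventually)
qed

text \<open>The limit of \<open>finite_jtp\<close> with M = N = n. As \<open>jexp\<close> is at
  least |j|, only the terms with |j| <= m reach the coefficient of q^m, so the limit can be taken
  term by term.\<close>

theorem jacobi_triple_product:
  assumes a: "a > 0" and b: "b > 0"
  shows "qpoch a (a + b) * qpoch b (a + b) * qpoch (a + b) (a + b) = isum UNIV (jexp a b) alt"
proof -
  define c where "c = a + b"
  have c: "c > 0" using a by (simp add: c_def)
  define \<rho> where "\<rho> = inverse (qpoch c c)"
  have \<rho>: "qpoch c c * \<rho> = 1" unfolding \<rho>_def by (rule inverse_mult_eq_1') simp
  let ?T = "isum UNIV (jexp a b) alt"
  let ?L = "\<lambda>n. rec_qfact c (int n + int n) * (\<Prod>k<n. 1 - fps_X ^ (b + c * k)) *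
       (\<Prod>k<n. 1 - fps_X ^ (a + c * k))"
  have "(\<lambda>n. rec_qfact c (int n + int n)) \<longlonglongrightarrow> \<rho>"
    using LIMSEQ_subseq_LIMSEQ[OF rec_qfact_LIMSEQ[OF c, of 0], of "\<lambda>n. n + n"]
    by (simp add: \<rho>_def strict_mono_def o_def)
  then have "?L \<longlonglongrightarrow> \<rho> * qpoch b c * qpoch a c"
    using a b c by (intro tendsto_mult_fps qpoch_LIMSEQ) auto
  moreover have "?L \<longlonglongrightarrow> \<rho> * \<rho> * ?T"
  proof (rule tendsto_fpsI)
    fix m
    define J where "J = {- int m..int m}"
    have out: "jexp a b j > m" if "j \<notin> J" for j
      using jexp_ge[OF a b, of j] that by (auto simp: J_def)
    have T: "fps_nth (g * ?T) m = (\<Sum>j\<in>J. fps_nth (fps_const (alt j) * g * fps_X ^ jexp a b j) m)"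
      for g
    proof -
      have "fps_nth (g * ?T) m = (\<Sum>i=0..m. \<Sum>j | jexp a b j = i. fps_nth g (m - i) * alt j)"
        by (subst mult.commute[of g])
          (simp only: fps_mult_nth isum_def fps_nth_Abs_fps sum_distrib_right, simp add: mult.commute)
      also have "\<dots> = (\<Sum>i=0..m. \<Sum>j | j \<in> J \<and> jexp a b j = i. fps_nth g (m - jexp a b j) * alt j)"
        by (intro sum.cong refl) (use out in \<open>force+\<close>)
      also have "\<dots> = (\<Sum>i=0..m. \<Sum>j\<in>J. if jexp a b j = i then fps_nth g (m - jexp a b j) * alt j else 0)"
        by (rule sum.cong[OF refl], rule sum.inter_filter) (simp add: J_def)
      also have "\<dots> = (\<Sum>j\<in>J. \<Sum>i=0..m. if jexp a b j = i then fps_nth g (m - jexp a b j) * alt j else 0)"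
        by (rule sum.swap)
      also have "\<dots> = (\<Sum>j\<in>J. fps_nth (fps_const (alt j) * g * fps_X ^ jexp a b j) m)"
        by (intro sum.cong refl) (auto simp: fps_X_power_mult_right_nth mult.assoc)
      finally show ?thesis .
    qed
    have "\<forall>\<^sub>F n in sequentially. fps_nth (jterm a b n n j) m
        = fps_nth (fps_const (alt j) * (\<rho> * \<rho>) * fps_X ^ jexp a b j) m" for j
    proof -
      have "(\<lambda>n. fps_const (alt j) * (rec_qfact c (int n + j) * rec_qfact c (int n + - j)) * fps_X ^ jexp a b j)
          \<longlonglongrightarrow> fps_const (alt j) * (\<rho> * \<rho>) * fps_X ^ jexp a b j"
        unfolding \<rho>_def using c by (intro tendsto_mult_fps rec_qfact_LIMSEQ tendsto_const)
      then have "\<forall>\<^sub>F n in sequentially.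
          fps_nth (fps_const (alt j) * (rec_qfact c (int n + j) * rec_qfact c (int n + - j)) * fps_X ^ jexp a b j) m
          = fps_nth (fps_const (alt j) * (\<rho> * \<rho>) * fps_X ^ jexp a b j) m"
        unfolding tendsto_fps_iff by blast
      then show ?thesis by (simp add: jterm_def c_def mult.assoc)
    qed
    then have "\<forall>\<^sub>F n in sequentially. \<forall>j\<in>J. fps_nth (jterm a b n n j) m
        = fps_nth (fps_const (alt j) * (\<rho> * \<rho>) * fps_X ^ jexp a b j) m"
      by (simp add: eventually_ball_finite_distrib J_def)
    then show "\<forall>\<^sub>F n in sequentially. fps_nth (?L n) m = fps_nth (\<rho> * \<rho> * ?T) m"
      using eventually_ge_at_top[of m]
    proof eventually_elim
      case (elim n)
      have "?L n = (\<Sum>j=- int (n + n)..int (n + n). jterm a b n n j)"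
        using finite_jtp[OF a b, of n n] unfolding finite_jtp_def c_def by simp
      then have "fps_nth (?L n) m = (\<Sum>j=- int (n + n)..int (n + n). fps_nth (jterm a b n n j) m)"
        by (simp add: fps_sum_nth)
      also have "\<dots> = (\<Sum>j\<in>J. fps_nth (jterm a b n n j) m)"
      proof (rule sum.mono_neutral_right)
        show "\<forall>j\<in>{- int (n + n)..int (n + n)} - J. fps_nth (jterm a b n n j) m = 0"
          using out by (auto simp: jterm_def fps_X_power_mult_right_nth)
      qed (use elim(2) in \<open>auto simp: J_def\<close>)
      also have "\<dots> = fps_nth (\<rho> * \<rho> * ?T) m" unfolding T using elim(1) by simp
      finally show ?case .
    qed
  qed
  ultimately have eq: "\<rho> * qpoch b c * qpoch a c = \<rho> * \<rho> * ?T" by (rule fps_tendsto_unique)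
  have "qpoch a c * qpoch b c * qpoch c c
      = (qpoch c c * qpoch c c) * (\<rho> * qpoch b c * qpoch a c)"
    using \<rho> by (simp add: algebra_simps)
  also have "\<dots> = (qpoch c c * \<rho>) * (qpoch c c * \<rho>) * ?T" unfolding eq by (simp add: mult_ac)
  finally show ?thesis unfolding \<rho> by (simp add: c_def)
qed

section \<open>Logarithmic derivatives and E2\<close>

definition theta_op :: "complex fps \<Rightarrow> complex fps" where
  "theta_op f = fps_X * fps_deriv f"

lemma theta_op_nth [simp]: "fps_nth (theta_op f) n = of_nat n * fps_nth f n"
  by (cases n) (simp_all add: theta_op_def)

lemma theta_op_mult: "theta_op (f * g) = theta_op f * g + f * theta_op g"
  by (simp add: theta_op_def algebra_simps)

lemma theta_op_add: "theta_op (f + g) = theta_op f + theta_op g"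
  and theta_op_const: "theta_op (fps_const c * f) = fps_const c * theta_op f"
  and theta_op_1 [simp]: "theta_op 1 = 0"
  by (auto simp: fps_eq_iff algebra_simps)

lemma theta_op_compose_power:
  assumes "k > 0"
  shows "theta_op (f oo fps_X ^ k) = of_nat k * (theta_op f oo fps_X ^ k)"
proof (rule fps_ext)
  fix n
  show "fps_nth (theta_op (f oo fps_X ^ k)) n = fps_nth (of_nat k * (theta_op f oo fps_X ^ k)) n"
    using assms by (auto simp: fps_nth_compose_X_power fps_of_nat[symmetric] simp del: fps_of_nat elim!: dvdE)
qed

text \<open>A relation instead of a quotient, so that it also applies to q, which is not a
  unit.\<close>

definition logder :: "complex fps \<Rightarrow> complex fps \<Rightarrow> bool" where
  "logder f g \<longleftrightarrow> theta_op f = f * g"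

lemma logder_mult: "logder f g \<Longrightarrow> logder f' g' \<Longrightarrow> logder (f * f') (g + g')"
  by (simp add: logder_def theta_op_mult algebra_simps)

lemma logder_power: "logder f g \<Longrightarrow> logder (f ^ n) (of_nat n * g)"
proof (induction n)
  case 0
  show ?case by (simp add: logder_def)
next
  case (Suc n)
  show ?case using logder_mult[OF Suc.prems Suc.IH[OF Suc.prems]] by (simp add: algebra_simps)
qed

lemma logder_cancel:
  assumes "logder a g" "logder b h" "f * a = b" "a \<noteq> 0"
  shows "logder f (h - g)"
proof -
  have "theta_op f * a + f * (a * g) = f * a * h"
    using assms by (metis logder_def theta_op_mult)
  then have "a * theta_op f = a * (f * (h - g))" by (simp add: algebra_simps)
  then show ?thesis using assms(4) by (simp add: logder_def)
qed

lemma fps_nth_X_power_0: "k > 0 \<Longrightarrow> fps_nth (fps_X ^ k :: complex fps) 0 = 0"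
  by (simp add: fps_X_power_nth)

lemma E2_term_mult: "(1 - fps_X ^ Suc n) * E2_term (Suc n) = of_nat (Suc n) * fps_X ^ Suc n"
proof -
  have "fps_nth (1 - fps_X ^ Suc n :: complex fps) 0 \<noteq> 0" by (simp del: power_Suc add: fps_X_power_nth)
  then show ?thesis
    unfolding E2_term_def by (simp add: fps_divide_unit inverse_mult_eq_1' mult_ac del: power_Suc)
qed

lemma theta_op_tendsto: "(f \<longlongrightarrow> a) G \<Longrightarrow> ((\<lambda>x. theta_op (f x)) \<longlongrightarrow> theta_op a) G"
  unfolding tendsto_fps_iff theta_op_nth by (auto elim: eventually_mono)

text \<open>The factor 1 - q^k contributes -k q^k / (1 - q^k), a term of E2. Dedekind's eta function
  would give E2 / 24; its extra power q^(1/24) accounts for the difference to E2 - 1.\<close>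

lemma logder_qpoch_1: "logder (qpoch 1 1) (fps_const (1 / 24) * (E2 - 1))"
proof -
  let ?P = "\<lambda>n. \<Prod>k<n. 1 - fps_X ^ Suc k :: complex fps"
  let ?S = "\<lambda>n. \<Sum>k<n. E2_term (Suc k)"
  have "theta_op (?P n) = ?P n * (- ?S n)" for n
  proof (induction n)
    case (Suc n)
    have d: "theta_op (1 - fps_X ^ Suc n) = - (of_nat (Suc n) * fps_X ^ Suc n)"
      by (intro fps_ext) (auto simp: fps_X_power_nth fps_of_nat[symmetric] simp del: fps_of_nat power_Suc of_nat_Suc)
    have "theta_op (?P (Suc n)) = ?P n * (- ?S n) * (1 - fps_X ^ Suc n)
        - ?P n * ((1 - fps_X ^ Suc n) * E2_term (Suc n))"
      unfolding E2_term_mult using Suc by (simp add: theta_op_mult d del: power_Suc)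
    also have "\<dots> = ?P (Suc n) * (- ?S (Suc n))" by (simp add: algebra_simps del: power_Suc)
    finally show ?case .
  qed simp
  moreover have P: "?P \<longlonglongrightarrow> qpoch 1 1" using qpoch_LIMSEQ[of 1 1] by simp
  moreover have "(\<lambda>n. - ?S n) \<longlonglongrightarrow> - (\<Sum>n. E2_term (Suc n))"
    using summable_LIMSEQ[OF E2_summable] unfolding tendsto_fps_iff by (auto elim: eventually_mono)
  ultimately have "(\<lambda>n. theta_op (?P n)) \<longlonglongrightarrow> qpoch 1 1 * (- (\<Sum>n. E2_term (Suc n)))"
    by (simp only: tendsto_mult_fps)
  then have "theta_op (qpoch 1 1) = qpoch 1 1 * (- (\<Sum>n. E2_term (Suc n)))"
    using theta_op_tendsto[OF P] fps_tendsto_unique by blast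
  moreover have "fps_const (1 / 24) * (E2 - 1) = - (\<Sum>n. E2_term (Suc n))"
    unfolding E2_def by (intro fps_ext) (simp add: numeral_fps_const)
  ultimately show ?thesis by (simp add: logder_def)
qed

lemma logder_qpoch:
  assumes "k > 0"
  shows "logder (qpoch k k) (fps_const (of_nat k / 24) * ((E2 oo fps_X ^ k) - 1))"
proof -
  have k0: "fps_nth (fps_X ^ k :: complex fps) 0 = 0" using assms by (rule fps_nth_X_power_0)
  have "theta_op (qpoch k k) = theta_op (qpoch 1 1 oo fps_X ^ k)"
    using qpoch_compose[of 1 1 k] assms by simp
  also have "\<dots> = of_nat k * ((qpoch 1 1 * (fps_const (1 / 24) * (E2 - 1))) oo fps_X ^ k)"
    using logder_qpoch_1 by (simp add: theta_op_compose_power assms logder_def)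
  also have "\<dots> = qpoch k k * (fps_const (of_nat k / 24) * ((E2 oo fps_X ^ k) - 1))"
    using qpoch_compose[of 1 1 k] assms
    by (simp add: fps_compose_mult_distrib[OF k0] fps_compose_sub_distrib fps_of_nat[symmetric]
        mult.left_commute[of "qpoch k k"] del: fps_of_nat flip: mult.assoc)
  finally show ?thesis by (simp add: logder_def)
qed

text \<open>The denominators are multiplied out, so that later identities reduce to cancelling Euler
  functions \<open>qpoch k k\<close>.\<close>

lemma y_eq: "y_fps * (qpoch 1 1 ^ 3 * qpoch 5 5) = fps_X * qpoch 2 2 * qpoch 10 10 ^ 3"
proof -
  let ?P = "\<lambda>k n. \<Prod>m<n. 1 - fps_X ^ (k + k * m) :: complex fps"
  let ?L = "qpoch 2 2 * qpoch 10 10 ^ 3 * inverse (qpoch 1 1 ^ 3 * qpoch 5 5)"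
  have y: "y_factor (Suc m) = (1 - fps_X ^ (2 + 2 * m)) * (1 - fps_X ^ (10 + 10 * m)) ^ 3 *
     inverse ((1 - fps_X ^ (1 + 1 * m)) ^ 3 * (1 - fps_X ^ (5 + 5 * m)))" for m
    unfolding y_factor_def by (subst fps_divide_unit) (simp_all add: fps_power_zeroth power_0_left)
  have "(\<Prod>m<n. y_factor (Suc m)) = ?P 2 n * ?P 10 n ^ 3 * inverse (?P 1 n ^ 3 * ?P 5 n)" for n
    unfolding y by (simp add: prod.distrib prod_power_distrib fps_inverse_mult fps_inverse_power inverse_prod_fps)
  moreover have "(\<lambda>n. ?P 2 n * ?P 10 n ^ 3 * inverse (?P 1 n ^ 3 * ?P 5 n)) \<longlonglongrightarrow> ?L"
    by (intro tendsto_mult_fps tendsto_power_fps tendsto_inverse_fps qpoch_LIMSEQ)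
      (simp_all add: fps_power_zeroth)
  ultimately have "(\<lambda>n. \<Prod>m<n. y_factor (Suc m)) \<longlonglongrightarrow> ?L" by simp
  then have "(\<lambda>n. \<Prod>m\<le>n. y_factor (Suc m)) \<longlonglongrightarrow> ?L"
    by (drule_tac LIMSEQ_Suc) (simp only: lessThan_Suc_atMost)
  moreover have "?L \<noteq> 0"
    by (metis (no_types, lifting) fps_inverse_nth_0 fps_mult_nth_0 fps_power_zeroth inverse_1 mult_1 power_one
        qpoch_nth_0 fps_zero_nth zero_neq_one)
  ultimately have "(\<lambda>m. y_factor (Suc m)) has_prod ?L"
    by (simp add: has_prod_def raw_has_prod_def)
  then have y: "y_fps = fps_X * ?L" unfolding y_fps_def by (metis has_prod_unique)
  have inv: "inverse (qpoch 1 1 ^ 3 * qpoch 5 5) * (qpoch 1 1 ^ 3 * qpoch 5 5) = 1"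
    by (rule inverse_mult_eq_1) (simp add: fps_power_zeroth)
  show ?thesis unfolding y mult.assoc inv[unfolded mult.assoc] by simp
qed

section \<open>The theta series \<open>\<phi>(-q)\<close>\<close>

definition sq :: "int \<Rightarrow> nat" where
  "sq j = nat (j\<^sup>2)"

definition phi_fps :: "complex fps" where
  "phi_fps = isum UNIV (sq) alt"

lemma int_sq: "int (sq j) = j * j"
  by (simp add: sq_def power2_eq_square)

lemma sq_eq_jexp: "sq = jexp 1 1"
proof
  fix j
  have "2 * int (sq j) = 2 * int (jexp 1 1 j)"
    unfolding int_jexp int_sq by (simp add: algebra_simps)
  then show "sq j = jexp 1 1 j" by simp
qed

lemma finite_fibres_sq: "finite_fibres I sq"
  using finite_fibres_jexp[of 1 1] unfolding finite_fibres_def sq_eq_jexp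
  by (auto elim: rev_finite_subset)

lemma sq_ge: "\<bar>j\<bar> \<le> int (sq j)"
  unfolding sq_eq_jexp by (rule jexp_ge) auto

lemma lessThan_expand: "{..<2::nat} = {0, 1}" "{..<5::nat} = {0, 1, 2, 3, 4}"
  by auto

text \<open>Gauss's product for the theta series: the triple product at a = b = 1 is (q; q^2)^2
  (q^2; q^2), and (q; q^2) is a quotient of two Euler functions.\<close>

lemma phi_fps_eq: "phi_fps * qpoch 2 2 = qpoch 1 1 ^ 2"
proof -
  have "phi_fps = qpoch 1 2 * qpoch 1 2 * qpoch 2 2"
    using jacobi_triple_product[of 1 1] unfolding phi_fps_def sq_eq_jexp one_add_one by simp
  moreover have "qpoch 1 1 = qpoch 1 2 * qpoch 2 2"
    using qpoch_dissect[of 1 1 2] by (simp add: lessThan_expand flip: numeral_2_eq_2)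
  ultimately show ?thesis by (simp add: power2_eq_square mult_ac)
qed

definition phi_part :: "int \<Rightarrow> complex fps" where
  "phi_part c = isum {j. j mod 5 = c} (sq) alt"

lemma phi_fps_split: "phi_fps = (\<Sum>c\<in>{0..4}. phi_part c)"
proof -
  have "(\<Union>c\<in>{0..4}. {j::int. j mod 5 = c}) = UNIV" by auto
  then show ?thesis
    unfolding phi_fps_def phi_part_def
    by (subst isum_UN[symmetric]) (auto simp: finite_fibres_sq disjoint_family_on_def)
qed

lemma phi_part_reflect: "c \<in> {1..4} \<Longrightarrow> phi_part (5 - c) = phi_part c"
proof -
  assume c: "c \<in> {1..4}"
  have "bij_betw uminus {j::int. j mod 5 = c} {j. j mod 5 = 5 - c}"
    by (rule bij_betwI[of _ _ _ uminus]) (use c in \<open>auto; presburger\<close>)+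
  then have "phi_part (5 - c) = isum {j. j mod 5 = c} (sq \<circ> uminus) (alt \<circ> uminus)"
    unfolding phi_part_def by (rule isum_reindex)
  also have "\<dots> = phi_part c"
    unfolding phi_part_def by (rule isum_cong) (auto simp: sq_def alt_def)
  finally show ?thesis .
qed

lemma phi_part_reindex:
  assumes "c \<in> {0..4}"
  shows "phi_part c = isum UNIV (\<lambda>n. sq (5 * n + c)) (\<lambda>n. alt (5 * n + c))"
proof -
  have "bij_betw (\<lambda>n. 5 * n + c) UNIV {j::int. j mod 5 = c}"
    by (rule bij_betwI[of _ _ _ "\<lambda>j. j div 5"]) (use assms in auto)
  then have "phi_part c = isum UNIV (sq \<circ> (\<lambda>n. 5 * n + c)) (alt \<circ> (\<lambda>n. 5 * n + c))"
    unfolding phi_part_def by (rule isum_reindex)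
  then show ?thesis by (simp add: o_def)
qed

lemma phi_part_0: "phi_part 0 = phi_fps oo fps_X ^ 25"
  unfolding phi_fps_def isum_compose[of 25, simplified] phi_part_reindex[of 0, simplified]
  by (rule isum_cong) (auto simp: sq_def alt_def power_mult_distrib nat_mult_distrib)

text \<open>As (5n+1)^2 - 1 = 25 n^2 + 10 n, the parameters of \<open>jexp\<close> have sum 50 and
  difference 20; for \<open>phi_part 2\<close> the difference is 40.\<close>

lemma phi_part_1: "phi_part 1 = - (fps_X * isum UNIV (jexp 35 15) alt)"
proof -
  have e: "sq (5 * n + 1) = 1 + jexp 35 15 n" for n
  proof -
    have "2 * int (sq (5 * n + 1)) = 2 * int (1 + jexp 35 15 n)"
      using int_jexp[of 35 15 n] by (simp add: algebra_simps int_sq)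
    then show ?thesis unfolding mult_cancel_left of_nat_eq_iff by simp
  qed
  have "phi_part 1 = isum UNIV (\<lambda>n. 1 + jexp 35 15 n) (\<lambda>n. (-1) * alt n)"
    unfolding phi_part_reindex[of 1, simplified] by (rule isum_cong) (auto simp: e alt_def)
  then show ?thesis unfolding isum_shift by (simp flip: fps_const_neg)
qed

lemma phi_part_2: "phi_part 2 = fps_X ^ 4 * isum UNIV (jexp 45 5) alt"
proof -
  have e: "sq (5 * n + 2) = 4 + jexp 45 5 n" for n
  proof -
    have "2 * int (sq (5 * n + 2)) = 2 * int (4 + jexp 45 5 n)"
      using int_jexp[of 45 5 n] by (simp add: algebra_simps int_sq)
    then show ?thesis unfolding mult_cancel_left of_nat_eq_iff by simp
  qed
  have "phi_part 2 = isum UNIV (\<lambda>n. 4 + jexp 45 5 n) (\<lambda>n. 1 * alt n)"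
    unfolding phi_part_reindex[of 2, simplified] by (rule isum_cong) (auto simp: e alt_def)
  then show ?thesis unfolding isum_shift by simp
qed

text \<open>The lattice \<open>j \<equiv> 2 i (mod 5)\<close> is the ideal \<open>(1 + 2 \<i>)\<close> of the Gaussian integers, hence similar to
  \<open>\<int>\<^sup>2\<close> with ratio \<open>sqrt 5\<close>.\<close>

lemma phi_lattice: "(phi_fps oo fps_X ^ 5) ^ 2 = phi_part 0 ^ 2 + 4 * (phi_part 1 * phi_part 2)"
proof -
  let ?e = "\<lambda>(i, j). sq i + sq j" and ?c = "\<lambda>(i, j). alt i * alt j"
  let ?I = "\<lambda>c. {j::int. j mod 5 = c}"
  have fin2: "finite_fibres K ?e" for K :: "(int \<times> int) set"
    unfolding finite_fibres_def
  proof
    fix n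
    have "p \<in> {- int n..int n} \<times> {- int n..int n}" if "?e p = n" for p
    proof -
      obtain i j where p: "p = (i, j)" by force
      have "int (sq i) \<le> int n" "int (sq j) \<le> int n" using that by (auto simp: p)
      then show ?thesis using sq_ge[of i] sq_ge[of j] by (auto simp: p)
    qed
    then have "{p \<in> K. ?e p = n} \<subseteq> {- int n..int n} \<times> {- int n..int n}" by blast
    then show "finite {p \<in> K. ?e p = n}" by (rule finite_subset) auto
  qed
  have pp: "phi_part a * phi_part b = isum (?I a \<times> ?I b) ?e ?c" for a b
    unfolding phi_part_def by (rule isum_mult) (rule finite_fibres_sq)+
  \<comment> \<open>For each nonzero class c one of c, 2 c is 1 or -1 modulo 5 and the other is 2 or
    -2, so by reflection all four give the same product.\<close>
  have "phi_part 0 ^ 2 + 4 * (phi_part 1 * phi_part 2)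
      = (\<Sum>c\<in>{0..4}. phi_part c * phi_part (2 * c mod 5))"
  proof -
    have "{0..4::int} = {0, 1, 2, 3, 4}" by auto
    moreover have "phi_part 4 = phi_part 1" "phi_part 3 = phi_part 2"
      using phi_part_reflect[of 1] phi_part_reflect[of 2] by auto
    ultimately show ?thesis by (simp add: power2_eq_square)
  qed
  also have "\<dots> = isum (\<Union>c\<in>{0..4}. ?I c \<times> ?I (2 * c mod 5)) ?e ?c"
    unfolding pp by (rule isum_UN[symmetric]) (auto simp: fin2 disjoint_family_on_def)
  also have "(\<Union>c\<in>{0..4}. ?I c \<times> ?I (2 * c mod 5)) = {(i, j). j mod 5 = 2 * i mod 5}"
    by (auto simp: mod_mult_right_eq)
  \<comment> \<open>The map is multiplication of a + b i by 1 + 2 i. Its norm 5 multiplies the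
    exponents, and the sign is kept because (a - 2b) + (2a + b) has the parity of a + b.\<close>
  also have "isum \<dots> ?e ?c = isum (UNIV \<times> UNIV)
      (?e \<circ> (\<lambda>(a, b). (a - 2 * b, 2 * a + b))) (?c \<circ> (\<lambda>(a, b). (a - 2 * b, 2 * a + b)))"
  proof (rule isum_reindex, rule bij_betwI[of _ _ _ "\<lambda>(i, j). (i + 2 * ((j - 2 * i) div 5), (j - 2 * i) div 5)"])
    show "(\<lambda>(a, b). (a - 2 * b, 2 * a + b)) \<in> UNIV \<times> UNIV \<rightarrow> {(i, j). j mod 5 = 2 * (i::int) mod 5}"
      by (auto simp: mod_eq_dvd_iff)
  next
    fix p :: "int \<times> int" assume "p \<in> {(i, j). j mod 5 = 2 * i mod 5}"
    then obtain i j where p: "p = (i, j)" "j mod 5 = 2 * i mod 5" by auto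
    then have "5 dvd j - 2 * i" by (simp add: mod_eq_dvd_iff)
    then obtain k where "j - 2 * i = 5 * k" by blast
    then have "j = 2 * i + 5 * k" by simp
    then show "(\<lambda>(a, b). (a - 2 * b, 2 * a + b)) ((\<lambda>(i, j). (i + 2 * ((j - 2 * i) div 5), (j - 2 * i) div 5)) p) = p"
      by (simp add: p)
  qed auto
  also have "\<dots> = isum (UNIV \<times> UNIV) (\<lambda>(a, b). 5 * sq a + 5 * sq b) (\<lambda>(a, b). alt a * alt b)"
  proof (rule isum_cong)
    fix p :: "int \<times> int"
    obtain a b where p: "p = (a, b)" by force
    have "int (sq (a - 2 * b) + sq (2 * a + b)) = int (5 * sq a + 5 * sq b)"
      by (simp add: int_sq algebra_simps)
    then show "(?e \<circ> (\<lambda>(a, b). (a - 2 * b, 2 * a + b))) p = (\<lambda>(a, b). 5 * sq a + 5 * sq b) p"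
      unfolding of_nat_eq_iff by (simp add: p)
    show "(?c \<circ> (\<lambda>(a, b). (a - 2 * b, 2 * a + b))) p = (\<lambda>(a, b). alt a * alt b) p"
      by (simp add: p alt_def)
  qed auto
  also have "\<dots> = isum UNIV (\<lambda>j. 5 * sq j) alt * isum UNIV (\<lambda>j. 5 * sq j) alt"
  proof (rule isum_mult[symmetric])
    show "finite_fibres UNIV (\<lambda>j. 5 * sq j)" "finite_fibres UNIV (\<lambda>j. 5 * sq j)"
      unfolding finite_fibres_def
    proof (safe)
      fix n
      have "{i \<in> UNIV. 5 * sq i = n} \<subseteq> {i \<in> UNIV. sq i = n div 5}" by auto
      then show "finite {i \<in> UNIV. 5 * sq i = n}" "finite {i \<in> UNIV. 5 * sq i = n}"
        using finite_fibres_sq[of UNIV] unfolding finite_fibres_def by (meson finite_subset)+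
    qed
  qed
  finally show ?thesis by (simp add: phi_fps_def isum_compose power2_eq_square)
qed

lemma y_fps_compose:
  assumes "k > 0"
  shows "(y_fps oo fps_X ^ k) * (qpoch k k ^ 3 * qpoch (5 * k) (5 * k))
    = fps_X ^ k * qpoch (2 * k) (2 * k) * qpoch (10 * k) (10 * k) ^ 3"
proof -
  have k0: "fps_nth (fps_X ^ k :: complex fps) 0 = 0" using assms by (rule fps_nth_X_power_0)
  have "(y_fps * (qpoch 1 1 ^ 3 * qpoch 5 5)) oo fps_X ^ k = (fps_X * qpoch 2 2 * qpoch 10 10 ^ 3) oo fps_X ^ k"
    by (simp only: y_eq)
  then show ?thesis using assms
    by (simp add: fps_compose_mult_distrib[OF k0] fps_compose_power[OF k0, symmetric] qpoch_compose
        fps_X_fps_compose_startby0[OF k0] mult.commute)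
qed

lemma phi_fps_compose:
  assumes "k > 0"
  shows "(phi_fps oo fps_X ^ k) * qpoch (2 * k) (2 * k) = qpoch k k ^ 2"
proof -
  have k0: "fps_nth (fps_X ^ k :: complex fps) 0 = 0" using assms by (rule fps_nth_X_power_0)
  have "(phi_fps * qpoch 2 2) oo fps_X ^ k = qpoch 1 1 ^ 2 oo fps_X ^ k"
    by (simp only: phi_fps_eq)
  then show ?thesis using assms
    by (simp add: fps_compose_mult_distrib[OF k0] fps_compose_power[OF k0, symmetric] qpoch_compose mult.commute)
qed

text \<open>The classes 5, 15, 35, 45 modulo 50 in the two triple products are the odd multiples of
  5 other than 25. So the product is -q^5 (q^5; q^10) (q^50; q^50)^2 / (q^25; q^50), which is then
  compared with the eta quotient for y and Gauss's product, both at q^5.\<close>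

lemma phi_part_prod:
  "phi_part 1 * phi_part 2 = - ((y_fps oo fps_X ^ 5) * (phi_fps oo fps_X ^ 5) ^ 2)"
proof -
  define Y v where "Y = y_fps oo fps_X ^ 5" and "v = phi_fps oo fps_X ^ 5"
  have d5: "qpoch 5 5 = qpoch 5 10 * qpoch 10 10"
    using qpoch_dissect[of 5 5 2] by (simp add: lessThan_expand)
  have d25: "qpoch 25 25 = qpoch 25 50 * qpoch 50 50"
    using qpoch_dissect[of 25 25 2] by (simp add: lessThan_expand)
  have d10: "qpoch 5 10 = qpoch 5 50 * (qpoch 15 50 * (qpoch 25 50 * (qpoch 35 50 * qpoch 45 50)))"
    using qpoch_dissect[of 5 10 5] by (simp add: lessThan_expand)
  have p1: "phi_part 1 = - (fps_X * (qpoch 35 50 * qpoch 15 50 * qpoch 50 50))"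
    using jacobi_triple_product[of 35 15] by (simp add: phi_part_1)
  have p2: "phi_part 2 = fps_X ^ 4 * (qpoch 45 50 * qpoch 5 50 * qpoch 50 50)"
    using jacobi_triple_product[of 45 5] by (simp add: phi_part_2)
  have Y: "Y * (qpoch 5 5 ^ 3 * qpoch 25 25) = fps_X ^ 5 * qpoch 10 10 * qpoch 50 50 ^ 3"
    using y_fps_compose[of 5] by (simp add: Y_def)
  have v: "v * qpoch 10 10 = qpoch 5 5 ^ 2"
    using phi_fps_compose[of 5] by (simp add: v_def)
  have "phi_part 1 * phi_part 2 * (qpoch 10 10 * qpoch 25 25) = - (fps_X ^ 5 * qpoch 5 5 * qpoch 50 50 ^ 3)"
    unfolding p1 p2 d5 d25 d10 by (simp add: power_numeral_reduce mult_ac)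
  then have "phi_part 1 * phi_part 2 * (qpoch 10 10 * qpoch 25 25) * (qpoch 5 5 ^ 3 * qpoch 10 10)
     = - (fps_X ^ 5 * qpoch 10 10 * qpoch 50 50 ^ 3) * (qpoch 5 5 ^ 2) ^ 2"
    by (simp add: power_numeral_reduce mult_ac)
  also have "\<dots> = - (Y * v ^ 2) * (qpoch 10 10 * qpoch 25 25) * (qpoch 5 5 ^ 3 * qpoch 10 10)"
    unfolding Y[symmetric] v[symmetric] by (simp add: power_numeral_reduce mult_ac)
  finally have "(phi_part 1 * phi_part 2 + Y * v ^ 2) * (qpoch 10 10 * qpoch 25 25 * (qpoch 5 5 ^ 3 * qpoch 10 10)) = 0"
    by (simp add: distrib_right mult.assoc)
  then have "phi_part 1 * phi_part 2 = - (Y * v ^ 2)" by (simp add: eq_neg_iff_add_eq_0)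
  then show ?thesis by (simp add: Y_def v_def)
qed

lemma phi_part_0_sq: "phi_part 0 ^ 2 = (1 + 4 * (y_fps oo fps_X ^ 5)) * (phi_fps oo fps_X ^ 5) ^ 2"
  using phi_lattice phi_part_prod by (simp add: algebra_simps)

lemma compose_X_power_inj:
  assumes "k > 0" "f oo fps_X ^ k = g oo fps_X ^ k"
  shows "f = (g :: complex fps)"
proof (rule fps_ext)
  fix n
  have "fps_nth (f oo fps_X ^ k) (k * n) = fps_nth (g oo fps_X ^ k) (k * n)" by (simp only: assms(2))
  then show "fps_nth f n = fps_nth g n" using assms(1) by (simp add: fps_nth_compose_X_power)
qed

lemma compose_X_power_twice:
  assumes "k > 0" "l > 0"
  shows "f oo fps_X ^ k oo fps_X ^ l = (f oo fps_X ^ (k * l) :: complex fps)"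
proof (rule fps_ext)
  fix n
  show "fps_nth (f oo fps_X ^ k oo fps_X ^ l) n = fps_nth (f oo fps_X ^ (k * l)) n"
    using assms by (auto simp: fps_nth_compose_X_power div_mult2_eq mult.commute elim!: dvdE)
qed

text \<open>\<open>phi_part_0_sq\<close> is this identity at q^5, and the substitution of q^5 for q
  is injective.\<close>

lemma phi_5_sq: "(phi_fps oo fps_X ^ 5) ^ 2 = (1 + 4 * y_fps) * phi_fps ^ 2"
proof (rule compose_X_power_inj)
  have 0: "fps_nth (fps_X ^ 5 :: complex fps) 0 = 0" by (simp add: fps_X_power_nth)
  have "((phi_fps oo fps_X ^ 5) ^ 2 oo fps_X ^ 5) = phi_part 0 ^ 2"
    by (simp add: fps_compose_power[OF 0, symmetric] compose_X_power_twice phi_part_0)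
  also have "\<dots> = ((1 + 4 * y_fps) * phi_fps ^ 2) oo fps_X ^ 5"
    unfolding phi_part_0_sq
    by (simp add: fps_compose_power[OF 0, symmetric] fps_compose_mult_distrib[OF 0] fps_compose_add_distrib numeral_fps_const)
  finally show "((phi_fps oo fps_X ^ 5) ^ 2 oo fps_X ^ 5) = ((1 + 4 * y_fps) * phi_fps ^ 2) oo fps_X ^ 5" .
qed simp

lemma phi_fps_nonzero [simp]: "phi_fps \<noteq> 0"
  using phi_fps_eq qpoch_nonzero[of 1 1] by (metis mult_zero_left power_not_zero)

lemma theta_op_fps_const: "theta_op (fps_const c) = 0"
  by (simp add: theta_op_def)

text \<open>The auxiliary w is y / (1 + 4 y), which rests on \<open>phi_5_sq\<close>, and F is its
  logarithmic derivative because w is an eta quotient. Differentiating (1 + 4 y) w = y then yields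
  the derivative of y.\<close>

lemma theta_op_y: "theta_op y_fps = F_fps * y_fps * (1 + 4 * y_fps)"
proof -
  define E where "E k = qpoch k k" for k
  have nz: "E k \<noteq> 0" for k by (simp add: E_def)
  define w where "w = fps_X * E 1 * E 10 ^ 5 * inverse (E 2 * E 5 ^ 5)"
  have "inverse (E 2 * E 5 ^ 5) * (E 2 * E 5 ^ 5) = 1"
    by (rule inverse_mult_eq_1) (simp add: E_def fps_power_zeroth)
  then have w: "w * (E 2 * E 5 ^ 5) = fps_X * E 1 * E 10 ^ 5"
    unfolding w_def by (simp only: mult.assoc mult_1_right)
  define e where "e k = fps_const (of_nat k / 24) * ((E2 oo fps_X ^ k) - 1 :: complex fps)" for k
  have E: "logder (E k) (e k)" if "k > 0" for k
    unfolding E_def e_def using that by (rule logder_qpoch)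
  have X: "logder fps_X 1" by (simp add: logder_def theta_op_def)
  have "logder (E 2 * E 5 ^ 5) (e 2 + of_nat 5 * e 5)"
    by (intro logder_mult logder_power E) simp_all
  moreover have "logder (fps_X * E 1 * E 10 ^ 5) (1 + e 1 + of_nat 5 * e 10)"
    by (intro logder_mult logder_power E X) simp_all
  ultimately have "logder w ((1 + e 1 + of_nat 5 * e 10) - (e 2 + of_nat 5 * e 5))"
    using w by (rule logder_cancel) (simp add: nz)
  \<comment> \<open>The constants cancel because 1 + 50 - 2 - 25 = 24.\<close>
  also have "(1 + e 1 + of_nat 5 * e 10) - (e 2 + of_nat 5 * e 5) = F_fps"
    unfolding F_fps_def e_def by (rule fps_ext) (simp add: numeral_fps_const field_simps)
  finally have F: "theta_op w = w * F_fps" by (simp add: logder_def)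
  define V where "V = phi_fps oo fps_X ^ 5"
  have y: "y_fps * (E 1 ^ 3 * E 5) = fps_X * E 2 * E 10 ^ 3" using y_eq by (simp add: E_def)
  have u: "phi_fps * E 2 = E 1 ^ 2" using phi_fps_eq by (simp add: E_def)
  have V: "V * E 10 = E 5 ^ 2" using phi_fps_compose[of 5] by (simp add: E_def V_def)
  have "(1 + 4 * y_fps) * w * (phi_fps ^ 2 * E 2 ^ 3 * E 10 ^ 2 * E 5 ^ 5)
      = (V * E 10) ^ 2 * (w * (E 2 * E 5 ^ 5)) * E 2 ^ 2"
    using phi_5_sq by (simp add: V_def power_mult_distrib power_numeral_reduce mult_ac)
  also have "\<dots> = (fps_X * E 2 * E 10 ^ 3) * (E 1 * E 10 ^ 2 * E 2 * E 5 ^ 4)"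
    unfolding V w by (simp add: power_numeral_reduce mult_ac)
  also have "\<dots> = y_fps * (E 1 ^ 2) ^ 2 * (E 10 ^ 2 * E 2 * E 5 ^ 5)"
    unfolding y[symmetric] by (simp add: power_numeral_reduce mult_ac)
  also have "\<dots> = y_fps * (phi_fps ^ 2 * E 2 ^ 3 * E 10 ^ 2 * E 5 ^ 5)"
    unfolding u[symmetric] by (simp add: power_mult_distrib power_numeral_reduce mult_ac)
  finally have w_y: "(1 + 4 * y_fps) * w = y_fps" using nz by simp
  have "theta_op y_fps = theta_op ((1 + 4 * y_fps) * w)" by (simp only: w_y)
  also have "\<dots> = 4 * theta_op y_fps * w + F_fps * ((1 + 4 * y_fps) * w)"
    by (simp add: theta_op_mult theta_op_add theta_op_const theta_op_fps_const numeral_fps_const F algebra_simps)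
  also have "\<dots> = 4 * theta_op y_fps * w + F_fps * y_fps" by (simp only: w_y)
  finally have "theta_op y_fps * (1 - 4 * w) = F_fps * y_fps" by (simp add: algebra_simps)
  moreover have "(1 - 4 * w) * (1 + 4 * y_fps) = (1 + 4 * y_fps) - 4 * ((1 + 4 * y_fps) * w)"
    by (simp add: algebra_simps)
  then have "(1 - 4 * w) * (1 + 4 * y_fps) = 1" unfolding w_y by simp
  ultimately show ?thesis by (metis (no_types, lifting) mult.assoc mult.right_neutral)
qed

section \<open>Fifth roots of unity\<close>

definition zeta :: complex where
  "zeta = cis (2 * pi / 5)"

lemma zeta_power_5: "zeta ^ 5 = 1"
proof -
  have "zeta ^ 5 = cis (real 5 * (2 * pi / 5))" unfolding zeta_def by (rule Complex.DeMoivre)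
  then show ?thesis by simp
qed

lemma zeta_neq: "zeta \<noteq> 1"
proof
  assume "zeta = 1"
  then have "Re zeta = 1" by simp
  then have "cos (2 * pi / 5) = cos 0" by (simp add: zeta_def)
  then have "2 * pi / 5 = 0" using cos_inj_pi[of "2 * pi / 5" 0] by simp
  then show False by simp
qed

lemma zeta_power_mod: "zeta ^ (n mod 5) = zeta ^ n"
proof -
  have "zeta ^ n = zeta ^ (5 * (n div 5) + n mod 5)" by simp
  also have "\<dots> = (zeta ^ 5) ^ (n div 5) * zeta ^ (n mod 5)" by (simp only: power_add power_mult)
  finally show ?thesis by (simp add: zeta_power_5)
qed

lemma sum_powers_root_5:
  fixes w :: complex
  assumes "w ^ 5 = 1" "w \<noteq> 1"
  shows "1 + w + w ^ 2 + w ^ 3 + w ^ 4 = 0"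
proof -
  have "(w - 1) * (1 + w + w ^ 2 + w ^ 3 + w ^ 4) = w ^ 5 - 1"
    by (simp add: algebra_simps power_numeral_reduce)
  then show ?thesis using assms by simp
qed

lemma zeta_power_neq_1:
  assumes "\<not> 5 dvd a"
  shows "zeta ^ a \<noteq> 1"
proof
  assume "zeta ^ a = 1"
  then have *: "zeta ^ (a mod 5) = 1" by (simp add: zeta_power_mod)
  have "a mod 5 < 5" by simp
  then have "a mod 5 = 1 \<or> a mod 5 = 2 \<or> a mod 5 = 3 \<or> a mod 5 = 4"
    using assms unfolding dvd_eq_mod_eq_0 by linarith
  then consider "zeta = 1" | "zeta ^ 2 = 1" | "zeta ^ 3 = 1" | "zeta ^ 4 = 1"
    using * by auto
  then show False
  proof cases
    case 2
    then have "zeta ^ 5 = zeta" by (simp add: power_numeral_reduce)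
    then show ?thesis using zeta_power_5 zeta_neq by simp
  next
    case 3
    moreover have "zeta ^ 5 * zeta = (zeta ^ 3) ^ 2" by (simp add: power_numeral_reduce mult_ac)
    ultimately have "zeta ^ 5 * zeta = 1" by simp
    then show ?thesis using zeta_power_5 zeta_neq by simp
  next
    case 4
    then have "zeta ^ 5 = zeta" by (simp add: power_numeral_reduce)
    then show ?thesis using zeta_power_5 zeta_neq by simp
  qed (use zeta_neq in simp)
qed

lemma zeta_power_sum:
  assumes "\<not> 5 dvd a"
  shows "1 + zeta ^ a + (zeta ^ a) ^ 2 + (zeta ^ a) ^ 3 + (zeta ^ a) ^ 4 = 0"
proof (rule sum_powers_root_5)
  show "(zeta ^ a) ^ 5 = 1" by (metis power_mult mult.commute power_one zeta_power_5)
qed (rule zeta_power_neq_1[OF assms])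

text \<open>Galois conjugation of series in q over the series in q^5; the latter are fixed by
  \<open>rot_compose_5\<close>.\<close>

definition rot :: "nat \<Rightarrow> complex fps \<Rightarrow> complex fps" where
  "rot i f = f oo (fps_const (zeta ^ i) * fps_X)"

lemma rot_nth [simp]: "fps_nth (rot i f) n = zeta ^ (i * n) * fps_nth f n"
  by (simp add: rot_def fps_nth_compose_linear power_mult)

lemma rot_mult: "rot i (f * g) = rot i f * rot i g"
  and rot_add: "rot i (f + g) = rot i f + rot i g"
  and rot_power: "rot i (f ^ n) = rot i f ^ n"
  and rot_const [simp]: "rot i (fps_const c) = fps_const c"
  by (simp_all add: rot_def fps_compose_mult_distrib fps_compose_add_distrib fps_compose_sub_distrib
      fps_compose_power fps_compose_uminus)

lemma rot_prod: "rot i (prod f A) = (\<Prod>a\<in>A. rot i (f a))"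
  by (simp add: rot_def fps_compose_prod_distrib)

lemma rot_compose_5 [simp]: "rot i (f oo fps_X ^ 5) = f oo fps_X ^ 5"
proof (rule fps_ext)
  fix n
  have "zeta ^ (i * (5 * k)) = 1" for k
    by (metis mult.left_commute power_mult power_one zeta_power_5)
  then show "fps_nth (rot i (f oo fps_X ^ 5)) n = fps_nth (f oo fps_X ^ 5) n"
    by (auto simp: fps_nth_compose_X_power elim!: dvdE)
qed

lemma rot_tendsto: "(f \<longlongrightarrow> a) G \<Longrightarrow> ((\<lambda>x. rot i (f x)) \<longlongrightarrow> rot i a) G"
  unfolding rot_def by (rule tendsto_compose_fps)

definition norm5 :: "complex fps \<Rightarrow> complex fps" where
  "norm5 f = (\<Prod>i<5. rot i f)"

lemma norm5_mult: "norm5 (f * g) = norm5 f * norm5 g"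
  and norm5_power: "norm5 (f ^ n) = norm5 f ^ n"
  by (simp_all add: norm5_def rot_mult rot_power prod.distrib prod_power_distrib)

lemma norm5_compose_5: "norm5 (f oo fps_X ^ 5) = (f oo fps_X ^ 5) ^ 5"
  by (simp add: norm5_def)

lemma norm5_prod: "norm5 (prod f A) = (\<Prod>a\<in>A. norm5 (f a))"
  unfolding norm5_def rot_prod by (rule prod.swap)

lemma prod_one_minus_roots:
  fixes w Z :: "'a::comm_ring_1"
  assumes "1 + w + w ^ 2 + w ^ 3 + w ^ 4 = 0"
  shows "(1 - Z) * (1 - w * Z) * (1 - w ^ 2 * Z) * (1 - w ^ 3 * Z) * (1 - w ^ 4 * Z) = 1 - Z ^ 5"
proof -
  have w5: "w ^ 5 = 1"
  proof -
    have "w ^ 5 - 1 = (w - 1) * (1 + w + w ^ 2 + w ^ 3 + w ^ 4)"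
      by (simp add: algebra_simps power_numeral_reduce)
    then show ?thesis using assms by simp
  qed
  \<comment> \<open>The two quadratic Gaussian periods. Their sum and their product are both -1, so
    pairing the factors of w with w^4 and of w^2 with w^3 removes w from the result.\<close>
  define s t where "s = w + w ^ 4" and "t = w ^ 2 + w ^ 3"
  have st: "s + t = - 1" using assms by (simp add: s_def t_def eq_neg_iff_add_eq_0 add_ac)
  have "s * t = w ^ 3 + w ^ 4 + w ^ 5 * w + w ^ 5 * w ^ 2"
    by (simp add: s_def t_def algebra_simps power_numeral_reduce)
  also have "\<dots> = s + t" unfolding w5 by (simp add: s_def t_def)
  finally have st': "s * t = - 1" unfolding st .
  have 1: "(1 - w * Z) * (1 - w ^ 4 * Z) = 1 - s * Z + w ^ 5 * Z ^ 2"
    and 2: "(1 - w ^ 2 * Z) * (1 - w ^ 3 * Z) = 1 - t * Z + w ^ 5 * Z ^ 2"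
    by (simp_all add: s_def t_def algebra_simps power_numeral_reduce)
  have "(1 - Z) * (1 - w * Z) * (1 - w ^ 2 * Z) * (1 - w ^ 3 * Z) * (1 - w ^ 4 * Z)
      = (1 - Z) * (((1 - w * Z) * (1 - w ^ 4 * Z)) * ((1 - w ^ 2 * Z) * (1 - w ^ 3 * Z)))"
    by (simp only: mult_ac)
  also have "\<dots> = (1 - Z) * ((1 + Z ^ 2) ^ 2 - (s + t) * (Z * (1 + Z ^ 2)) + (s * t) * Z ^ 2)"
    unfolding 1 2 w5 by (simp add: algebra_simps power_numeral_reduce)
  also have "\<dots> = 1 - Z ^ 5"
    unfolding st st' by (simp add: algebra_simps power_numeral_reduce)
  finally show ?thesis .
qed

lemma norm5_one_minus_X_power:
  assumes "\<not> 5 dvd n"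
  shows "norm5 (1 - fps_X ^ n) = 1 - fps_X ^ (5 * n)"
proof -
  define w where "w = (fps_const (zeta ^ n) :: complex fps)"
  have "rot i (1 - fps_X ^ n) = 1 - w ^ i * fps_X ^ n" for i
    by (rule fps_ext) (simp add: w_def fps_const_power power_mult[symmetric] fps_X_power_nth mult.commute)
  then have "norm5 (1 - fps_X ^ n) = (1 - fps_X ^ n) * (1 - w * fps_X ^ n) * (1 - w ^ 2 * fps_X ^ n)
      * (1 - w ^ 3 * fps_X ^ n) * (1 - w ^ 4 * fps_X ^ n)"
    by (simp add: norm5_def lessThan_expand mult.assoc)
  also have "1 + w + w ^ 2 + w ^ 3 + w ^ 4 = fps_const (1 + zeta ^ n + (zeta ^ n) ^ 2 + (zeta ^ n) ^ 3 + (zeta ^ n) ^ 4)"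
    by (rule fps_ext) (simp add: w_def fps_const_power)
  then have "1 + w + w ^ 2 + w ^ 3 + w ^ 4 = 0" using zeta_power_sum[OF assms] by simp
  then have "(1 - fps_X ^ n) * (1 - w * fps_X ^ n) * (1 - w ^ 2 * fps_X ^ n)
      * (1 - w ^ 3 * fps_X ^ n) * (1 - w ^ 4 * fps_X ^ n) = 1 - (fps_X ^ n) ^ 5" by (rule prod_one_minus_roots)
  finally show ?thesis by (simp add: power_mult[symmetric] mult.commute)
qed

lemma norm5_qpoch:
  assumes "\<not> 5 dvd a" "b > 0" "5 dvd b"
  shows "norm5 (qpoch a b) = qpoch (5 * a) (5 * b)"
proof (rule fps_tendsto_unique)
  have a: "a > 0" using assms(1) by (cases a) auto
  have "(\<lambda>n. norm5 (\<Prod>k<n. 1 - fps_X ^ (a + b * k))) \<longlonglongrightarrow> norm5 (qpoch a b)"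
    unfolding norm5_def using a assms by (intro tendsto_prod_fps rot_tendsto qpoch_LIMSEQ)
  moreover have "norm5 (1 - fps_X ^ (a + b * k)) = 1 - fps_X ^ (5 * a + 5 * b * k)" for k
    using assms by (subst norm5_one_minus_X_power) (auto simp: dvd_add_left_iff algebra_simps)
  ultimately show "(\<lambda>n. \<Prod>k<n. 1 - fps_X ^ (5 * a + 5 * b * k)) \<longlonglongrightarrow> norm5 (qpoch a b)"
    unfolding norm5_prod by simp
  show "(\<lambda>n. \<Prod>k<n. 1 - fps_X ^ (5 * a + 5 * b * k)) \<longlonglongrightarrow> qpoch (5 * a) (5 * b)"
    using a assms by (intro qpoch_LIMSEQ) auto
qed

text \<open>Factors 1 - q^(k m) with m prime to 5 have norm 1 - q^(5 k m), and these norms multiply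
  to the quotient of the Euler functions at q^(5k) and q^(25k). The other factors form the Euler
  function at q^(5k), whose norm is its fifth power.\<close>

lemma norm5_euler:
  assumes "\<not> 5 dvd k"
  shows "norm5 (qpoch k k) * qpoch (25 * k) (25 * k) = qpoch (5 * k) (5 * k) ^ 6"
proof -
  have k: "k > 0" using assms by (cases k) auto
  have i: "\<not> 5 dvd k * 2" "\<not> 5 dvd k * 3" "\<not> 5 dvd k * 4"
    using assms by presburger+
  have "qpoch k k = qpoch k (5 * k) * (qpoch (k * 2) (5 * k) * (qpoch (k * 3) (5 * k) * (qpoch (k * 4) (5 * k) * qpoch (5 * k) (5 * k))))"
    using qpoch_dissect[OF k k, of 5] by (simp add: lessThan_expand algebra_simps flip: mult_2_right)
  moreover have "norm5 (qpoch (5 * k) (5 * k)) = qpoch (5 * k) (5 * k) ^ 5"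
    using norm5_compose_5[of "qpoch k k"] qpoch_compose[of k k 5] k by simp
  ultimately have "norm5 (qpoch k k) = qpoch (5 * k) (25 * k) * (qpoch (10 * k) (25 * k) *
      (qpoch (15 * k) (25 * k) * (qpoch (20 * k) (25 * k) * qpoch (5 * k) (5 * k) ^ 5)))"
    using assms i k by (simp add: norm5_mult norm5_qpoch mult.commute)
  moreover have "qpoch (5 * k) (5 * k) = qpoch (5 * k) (25 * k) * (qpoch (10 * k) (25 * k) *
      (qpoch (15 * k) (25 * k) * (qpoch (20 * k) (25 * k) * qpoch (25 * k) (25 * k))))"
    using qpoch_dissect[of "5 * k" "5 * k" 5] k by (simp add: lessThan_expand algebra_simps)
  ultimately show ?thesis by (simp add: power_numeral_reduce mult_ac)
qed

lemma norm5_phi: "norm5 phi_fps * (phi_fps oo fps_X ^ 25) = (phi_fps oo fps_X ^ 5) ^ 6"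
proof -
  define E where "E k = qpoch k k" for k
  define v t where "v = phi_fps oo fps_X ^ 5" and "t = phi_fps oo fps_X ^ 25"
  have nz: "E k \<noteq> 0" for k by (simp add: E_def)
  have 1: "norm5 phi_fps * norm5 (E 2) = norm5 (E 1) ^ 2"
    using phi_fps_eq unfolding E_def by (metis norm5_mult norm5_power)
  have 2: "norm5 (E 1) * E 25 = E 5 ^ 6" "norm5 (E 2) * E 50 = E 10 ^ 6"
    using norm5_euler[of 1] norm5_euler[of 2] by (simp_all add: E_def)
  have 3: "v * E 10 = E 5 ^ 2" "t * E 50 = E 25 ^ 2"
    using phi_fps_compose[of 5] phi_fps_compose[of 25] by (simp_all add: E_def v_def t_def)
  have "norm5 phi_fps * t * (E 10 ^ 6 * E 50) = (norm5 phi_fps * norm5 (E 2)) * (t * E 50) * E 50"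
    unfolding 2[symmetric] by (simp add: mult_ac)
  also have "\<dots> = (norm5 (E 1) * E 25) ^ 2 * E 50"
    unfolding 1 3 by (simp add: power_mult_distrib mult_ac)
  also have "\<dots> = (v * E 10) ^ 6 * E 50"
    unfolding 2 3 by (simp flip: power_mult)
  finally have "(norm5 phi_fps * t) * (E 10 ^ 6 * E 50) = v ^ 6 * (E 10 ^ 6 * E 50)"
    by (simp add: power_mult_distrib mult_ac)
  then show ?thesis using nz by (simp add: v_def t_def)
qed

section \<open>The modular equation of degree five\<close>

text \<open>The factors are the conjugates of \<open>\<phi>(-q)\<close> under \<open>q \<mapsto> w\<^sup>i q\<close>, with \<open>t + a + b\<close> its 5-dissection.\<close>

lemma prod_conjugates:
  fixes w t a b :: "'a::comm_ring_1"
  assumes "w ^ 5 = 1" "1 + w + w ^ 2 + w ^ 3 + w ^ 4 = 0"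
  shows "(t + a + b) * (t + w * a + w ^ 4 * b) * (t + w ^ 2 * a + w ^ 3 * b)
      * (t + w ^ 3 * a + w ^ 2 * b) * (t + w ^ 4 * a + w * b)
    = t ^ 5 + a ^ 5 + b ^ 5 - 5 * t ^ 3 * (a * b) + 5 * t * (a * b) ^ 2"
proof -
  \<comment> \<open>The pairing of \<open>prod_one_minus_roots\<close> again: only symmetric
    functions of the two Gaussian periods survive.\<close>
  define s s' where "s = w + w ^ 4" and "s' = w ^ 2 + w ^ 3"
  define A c d where "A = t ^ 2 + a ^ 2 + b ^ 2" and "c = t * (a + b)" and "d = a * b"
  have add: "s + s' = - 1" using assms(2) by (simp add: s_def s'_def eq_neg_iff_add_eq_0 add_ac)
  have "s * s' = w ^ 3 + w ^ 4 + w ^ 5 * w + w ^ 5 * w ^ 2"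
    by (simp add: s_def s'_def algebra_simps power_numeral_reduce)
  also have "\<dots> = s + s'" unfolding assms(1) by (simp add: s_def s'_def)
  finally have mult: "s * s' = - 1" unfolding add .
  have "(t + w * a + w ^ 4 * b) * (t + w ^ 4 * a + w * b)
      = t ^ 2 + w ^ 5 * (a ^ 2 + b ^ 2) + (w + w ^ 4) * c + (w ^ 2 + w ^ 5 * w ^ 3) * d"
    by (simp add: c_def d_def algebra_simps power_numeral_reduce)
  then have 1: "(t + w * a + w ^ 4 * b) * (t + w ^ 4 * a + w * b) = A + s * c + s' * d"
    unfolding assms(1) by (simp add: A_def s_def s'_def algebra_simps)
  have "(t + w ^ 2 * a + w ^ 3 * b) * (t + w ^ 3 * a + w ^ 2 * b)
      = t ^ 2 + w ^ 5 * (a ^ 2 + b ^ 2) + (w ^ 2 + w ^ 3) * c + (w ^ 4 + w ^ 5 * w) * d"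
    by (simp add: c_def d_def algebra_simps power_numeral_reduce)
  then have 2: "(t + w ^ 2 * a + w ^ 3 * b) * (t + w ^ 3 * a + w ^ 2 * b) = A + s' * c + s * d"
    unfolding assms(1) by (simp add: A_def s_def s'_def algebra_simps)
  have "(t + a + b) * (t + w * a + w ^ 4 * b) * (t + w ^ 2 * a + w ^ 3 * b)
      * (t + w ^ 3 * a + w ^ 2 * b) * (t + w ^ 4 * a + w * b)
    = (t + a + b) * (((t + w * a + w ^ 4 * b) * (t + w ^ 4 * a + w * b))
      * ((t + w ^ 2 * a + w ^ 3 * b) * (t + w ^ 3 * a + w ^ 2 * b)))"
    by (simp only: mult_ac)
  also have "\<dots> = (t + a + b) * (A ^ 2 + (s + s') * (A * (c + d)) + s * s' * (c ^ 2 + d ^ 2)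
      + ((s + s') ^ 2 - 2 * (s * s')) * (c * d))"
    unfolding 1 2 by (simp add: algebra_simps power2_eq_square)
  also have "\<dots> = t ^ 5 + a ^ 5 + b ^ 5 - 5 * t ^ 3 * (a * b) + 5 * t * (a * b) ^ 2"
    unfolding add mult A_def c_def d_def by (simp add: algebra_simps power_numeral_reduce)
  finally show ?thesis .
qed

text \<open>The coefficients are read off from \<open>modpoly_norm_form\<close> below, where \<open>1 + 4 z = \<phi>(-q\<^sup>5)\<^sup>2 / \<phi>(-q)\<^sup>2\<close>.\<close>

definition mc0 :: "'a::comm_ring_1 \<Rightarrow> 'a" where
  "mc0 x = - x - 20 * x ^ 2 - 150 * x ^ 3 - 500 * x ^ 4 - 625 * x ^ 5"

definition mc1 :: "'a::comm_ring_1 \<Rightarrow> 'a" where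
  "mc1 x = - 15 * x - 305 * x ^ 2 - 2325 * x ^ 3 - 7875 * x ^ 4 - 10000 * x ^ 5"

definition mc2 :: "'a::comm_ring_1 \<Rightarrow> 'a" where
  "mc2 x = - 85 * x - 1750 * x ^ 2 - 13525 * x ^ 3 - 46500 * x ^ 4 - 60000 * x ^ 5"

definition mc3 :: "'a::comm_ring_1 \<Rightarrow> 'a" where
  "mc3 x = - 215 * x - 4475 * x ^ 2 - 35000 * x ^ 3 - 122000 * x ^ 4 - 160000 * x ^ 5"

definition mc4 :: "'a::comm_ring_1 \<Rightarrow> 'a" where
  "mc4 x = - 205 * x - 4300 * x ^ 2 - 34000 * x ^ 3 - 120000 * x ^ 4 - 160000 * x ^ 5"

definition modpoly :: "'a::comm_ring_1 \<Rightarrow> 'a \<Rightarrow> 'a" where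
  "modpoly Y z = mc0 Y + mc1 Y * z + mc2 Y * z ^ 2 + mc3 Y * z ^ 3 + mc4 Y * z ^ 4 + z ^ 5"

text \<open>The left side is the squared theta relation of \<open>modular_equation\<close>, where q
  and K are the ratios v^2 / u^2 and t^2 / v^2. It has degree five in z with leading coefficient 4^5
  = 1024.\<close>

lemma modpoly_norm_form:
  fixes z Y :: "'a::comm_ring_1"
  defines "q \<equiv> 1 + 4 * z" and "K \<equiv> 1 + 4 * Y"
  shows "q * (q ^ 2 + 25 * K ^ 2 * q - 15 * K * q + 5 * K) ^ 2
      - K * (1 + 15 * K * q + 25 * K ^ 2 * q ^ 2 - 5 * q - 25 * K * q ^ 2 + 5 * q ^ 2) ^ 2
    = 1024 * modpoly Y z"
  unfolding q_def K_def modpoly_def mc0_def mc1_def mc2_def mc3_def mc4_def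
  by (simp add: algebra_simps power_numeral_reduce)

text \<open>All exponents of \<open>phi_part c\<close> are congruent to c^2 modulo 5, so classes 1
  and 2 acquire zeta^i and zeta^(4 i).\<close>

lemma phi_part_rot:
  assumes "c \<in> {0..4}"
  shows "rot i (phi_part c) = fps_const (zeta ^ i) ^ nat (c ^ 2) * phi_part c"
proof (rule fps_ext)
  fix n
  have nz: "zeta ^ (i * n) = (zeta ^ i) ^ nat (c ^ 2)" if "fps_nth (phi_part c) n \<noteq> 0"
  proof -
    have "{j. j \<in> {j. j mod 5 = c} \<and> sq j = n} \<noteq> {}"
      using that unfolding phi_part_def isum_def fps_nth_Abs_fps by (metis sum.empty)
    then obtain j where j: "j mod 5 = c" "sq j = n" by auto
    have "int (n mod 5) = (j * j) mod 5" using j(2) int_sq[of j] by (simp add: zmod_int)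
    also have "\<dots> = (c * c) mod 5" using j(1) by (metis mod_mult_eq)
    also have "\<dots> = int (nat (c ^ 2) mod 5)" by (simp add: zmod_int power2_eq_square)
    finally have "n mod 5 = nat (c ^ 2) mod 5" by simp
    then have "zeta ^ n = zeta ^ nat (c ^ 2)" by (metis zeta_power_mod)
    then show ?thesis by (metis mult.commute power_mult)
  qed
  show "fps_nth (rot i (phi_part c)) n = fps_nth (fps_const (zeta ^ i) ^ nat (c ^ 2) * phi_part c) n"
    using nz by (cases "fps_nth (phi_part c) n = 0") (simp_all add: fps_const_power)
qed

text \<open>The first equation is the norm formula with a and b eliminated through a + b = u - t and
  a b = v^2 - t^2. The second one sorts it by parity: everything is a polynomial in squares except
  for one factor u t.\<close>

lemma phi_relation_form:
  fixes u v t :: "'a::comm_ring_1"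
  shows "(t ^ 5 + ((u - t) ^ 5 - 5 * (v ^ 2 - t ^ 2) * (u - t) ^ 3 + 5 * (v ^ 2 - t ^ 2) ^ 2 * (u - t))
      - 5 * t ^ 3 * (v ^ 2 - t ^ 2) + 5 * t * (v ^ 2 - t ^ 2) ^ 2) * t = v ^ 6 \<longleftrightarrow>
    (v ^ 2) ^ 3 + 5 * (u ^ 2) ^ 2 * t ^ 2 + 25 * u ^ 2 * (t ^ 2) ^ 2 - 15 * u ^ 2 * v ^ 2 * t ^ 2
      = u * t * ((u ^ 2) ^ 2 + 15 * u ^ 2 * t ^ 2 + 25 * (t ^ 2) ^ 2 - 5 * u ^ 2 * v ^ 2
        - 25 * v ^ 2 * t ^ 2 + 5 * (v ^ 2) ^ 2)" (is "?A = ?B \<longleftrightarrow> ?C = ?D")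
proof -
  have "?A - ?B = ?D - ?C" by (simp add: algebra_simps power_numeral_reduce)
  then show ?thesis by (metis eq_iff_diff_eq_0)
qed

lemma modular_equation: "modpoly (y_fps oo fps_X ^ 5) y_fps = 0"
proof -
  define Y where "Y = y_fps oo fps_X ^ 5"
  define u v t where "u = phi_fps" and "v = phi_fps oo fps_X ^ 5" and "t = phi_part 0"
  define a b where "a = 2 * phi_part 1" and "b = 2 * phi_part 2"
  define q K where "q = 1 + 4 * y_fps" and "K = 1 + 4 * Y"
  define w where "w = fps_const zeta"
  define L where "L = (v ^ 2) ^ 3 + 5 * (u ^ 2) ^ 2 * t ^ 2 + 25 * u ^ 2 * (t ^ 2) ^ 2 - 15 * u ^ 2 * v ^ 2 * t ^ 2"
  define R where "R = (u ^ 2) ^ 2 + 15 * u ^ 2 * t ^ 2 + 25 * (t ^ 2) ^ 2 - 5 * u ^ 2 * v ^ 2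
        - 25 * v ^ 2 * t ^ 2 + 5 * (v ^ 2) ^ 2"
  define S where "S = q ^ 2 + 25 * K ^ 2 * q - 15 * K * q + 5 * K"
  define T where "T = 1 + 15 * K * q + 25 * K ^ 2 * q ^ 2 - 5 * q - 25 * K * q ^ 2 + 5 * q ^ 2"
  have u: "u = t + a + b"
  proof -
    have "{0..4::int} = {0, 1, 2, 3, 4}" by auto
    moreover have "phi_part 4 = phi_part 1" "phi_part 3 = phi_part 2"
      using phi_part_reflect[of 1] phi_part_reflect[of 2] by auto
    ultimately show ?thesis by (simp add: phi_fps_split u_def t_def a_def b_def)
  qed
  have v: "v ^ 2 = q * u ^ 2" using phi_5_sq by (simp add: v_def q_def u_def)
  have t: "t ^ 2 = K * v ^ 2" using phi_part_0_sq by (simp add: t_def K_def Y_def v_def)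
  have "4 * (phi_part 1 * phi_part 2) = - (4 * Y * v ^ 2)"
    using phi_part_prod by (simp add: Y_def v_def)
  then have ab: "a * b = v ^ 2 - t ^ 2"
    unfolding t by (simp add: a_def b_def K_def algebra_simps)
  have w5: "w ^ 5 = 1" by (simp add: w_def fps_const_power zeta_power_5)
  have wsum: "1 + w + w ^ 2 + w ^ 3 + w ^ 4 = 0"
    using zeta_power_sum[of 1] by (simp add: w_def fps_const_power flip: fps_const_1_eq_1)
  have rot: "rot i u = t + w ^ i * a + w ^ (4 * i) * b" for i
    using phi_part_rot[of 0 i] phi_part_rot[of 1 i] phi_part_rot[of 2 i]
    by (simp add: u t_def a_def b_def w_def rot_add rot_mult fps_const_power power_mult mult_ac
        numeral_fps_const flip: power_mult)
  have w8: "w ^ 8 = w ^ 3" "w ^ 12 = w ^ 2" "w ^ 16 = w"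
  proof -
    have "w ^ 8 = w ^ 5 * w ^ 3" "w ^ 12 = (w ^ 5) ^ 2 * w ^ 2" "w ^ 16 = (w ^ 5) ^ 3 * w"
      by (simp_all only: power_mult[symmetric] power_add[symmetric] power_Suc2[symmetric], simp_all)
    then show "w ^ 8 = w ^ 3" "w ^ 12 = w ^ 2" "w ^ 16 = w" by (simp_all add: w5)
  qed
  have "norm5 u = (t + a + b) * (t + w * a + w ^ 4 * b) * (t + w ^ 2 * a + w ^ 3 * b)
      * (t + w ^ 3 * a + w ^ 2 * b) * (t + w ^ 4 * a + w * b)"
    by (simp add: norm5_def lessThan_expand rot w8 mult.assoc)
  also have "\<dots> = t ^ 5 + a ^ 5 + b ^ 5 - 5 * t ^ 3 * (a * b) + 5 * t * (a * b) ^ 2"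
    by (rule prod_conjugates[OF w5 wsum])
  finally have N: "(t ^ 5 + a ^ 5 + b ^ 5 - 5 * t ^ 3 * (a * b) + 5 * t * (a * b) ^ 2) * t = v ^ 6"
    using norm5_phi by (simp add: u_def v_def t_def phi_part_0)
  have "a ^ 5 + b ^ 5 = (a + b) ^ 5 - 5 * (a * b) * (a + b) ^ 3 + 5 * (a * b) ^ 2 * (a + b)"
    by (simp add: algebra_simps power_numeral_reduce)
  then have "a ^ 5 + b ^ 5 = (u - t) ^ 5 - 5 * (a * b) * (u - t) ^ 3 + 5 * (a * b) ^ 2 * (u - t)"
    by (simp add: u)
  then have "(t ^ 5 + ((u - t) ^ 5 - 5 * (v ^ 2 - t ^ 2) * (u - t) ^ 3 + 5 * (v ^ 2 - t ^ 2) ^ 2 * (u - t))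
      - 5 * t ^ 3 * (v ^ 2 - t ^ 2) + 5 * t * (v ^ 2 - t ^ 2) ^ 2) * t = v ^ 6"
    using N unfolding ab by (simp add: add.assoc)
  then have "L = u * t * R" unfolding phi_relation_form L_def R_def by simp
  \<comment> \<open>Only the squares u^2, v^2, t^2 have ratios expressed by y and Y, so the factor u
    t has to be squared away.\<close>
  then have "L ^ 2 = u ^ 2 * t ^ 2 * R ^ 2" by (simp only: power_mult_distrib)
  moreover have "L = u ^ 6 * (q * S)"
    unfolding L_def S_def t v by (simp add: algebra_simps power_numeral_reduce)
  moreover have "R = u ^ 4 * T"
    unfolding R_def T_def t v by (simp add: algebra_simps power_numeral_reduce)
  ultimately have "(u ^ 6 * (q * S)) ^ 2 = u ^ 2 * (K * (q * u ^ 2)) * (u ^ 4 * T) ^ 2"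
    using t v by (simp only:)
  then have "u ^ 12 * q * (q * S ^ 2 - K * T ^ 2) = 0"
    unfolding right_diff_distrib by (simp add: power_mult_distrib power2_eq_square power_numeral_reduce mult_ac)
  moreover have "u \<noteq> 0" by (simp add: u_def)
  moreover have "q \<noteq> 0"
  proof
    assume "q = 0"
    then have "fps_nth q 0 = 0" by simp
    then show False by (simp add: q_def y_fps_def numeral_fps_const)
  qed
  ultimately have "1024 * modpoly Y y_fps = 0"
    unfolding modpoly_norm_form[symmetric] q_def[symmetric] K_def[symmetric] S_def[symmetric] T_def[symmetric]
    by simp
  then show ?thesis by (simp add: Y_def)
qed

section \<open>Traces\<close>

definition U5_fps :: "complex fps \<Rightarrow> complex fps" where
  "U5_fps f = Abs_fps (\<lambda>n. fps_nth f (5 * n))"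

lemma U5_fps_nth [simp]: "fps_nth (U5_fps f) n = fps_nth f (5 * n)"
  by (simp add: U5_fps_def)

lemma U5_fps_add: "U5_fps (f + g) = U5_fps f + U5_fps g"
  and U5_fps_const_mult: "U5_fps (fps_const c * f) = fps_const c * U5_fps f"
  by (simp_all add: fps_eq_iff)

lemma U5_fps_theta_op: "U5_fps (theta_op f) = 5 * theta_op (U5_fps f)"
  by (rule fps_ext) (simp add: numeral_fps_const)

text \<open>Orthogonality: the sum of zeta^(i n) over i is 5 if 5 divides n, and 0
  otherwise.\<close>

lemma trace_eq: "(\<Sum>i<5. rot i f) = 5 * (U5_fps f oo fps_X ^ 5)"
proof (rule fps_ext)
  fix n
  have "fps_nth (\<Sum>i<5. rot i f) n = (1 + zeta ^ n + (zeta ^ n) ^ 2 + (zeta ^ n) ^ 3 + (zeta ^ n) ^ 4) * fps_nth f n"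
    by (simp add: fps_sum_nth lessThan_expand algebra_simps flip: power_mult)
  moreover have "zeta ^ n = 1" if "5 dvd n"
    using that zeta_power_mod[of n] by simp
  ultimately show "fps_nth (\<Sum>i<5. rot i f) n = fps_nth (5 * (U5_fps f oo fps_X ^ 5)) n"
    using zeta_power_sum[of n] by (auto simp: numeral_fps_const fps_nth_compose_X_power)
qed

text \<open>Linearity of U5 over the series in q^5. Through it a relation with coefficients in
  y(q^5) turns into a recurrence.\<close>

lemma U5_fps_compose_mult: "U5_fps ((f oo fps_X ^ 5) * g) = f * U5_fps g"
proof (rule compose_X_power_inj)
  have "5 * (U5_fps ((f oo fps_X ^ 5) * g) oo fps_X ^ 5) = (f oo fps_X ^ 5) * (\<Sum>i<5. rot i g)"
    unfolding trace_eq[symmetric] by (simp add: rot_mult sum_distrib_left)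
  also have "\<dots> = 5 * ((f oo fps_X ^ 5) * (U5_fps g oo fps_X ^ 5))"
    unfolding trace_eq by simp
  finally show "U5_fps ((f oo fps_X ^ 5) * g) oo fps_X ^ 5 = f * U5_fps g oo fps_X ^ 5"
    by (simp add: fps_compose_mult_distrib fps_X_power_nth)
qed simp

lemma y_nth_0 [simp]: "fps_nth y_fps 0 = 0"
  by (simp add: y_fps_def)

lemma y_nth_1 [simp]: "fps_nth y_fps (Suc 0) = 1"
proof -
  have "fps_nth (y_fps * (qpoch 1 1 ^ 3 * qpoch 5 5)) 1 = fps_nth (fps_X * (qpoch 2 2 * qpoch 10 10 ^ 3)) 1"
    using y_eq by (simp add: mult.assoc)
  then show ?thesis by (simp add: fps_mult_nth_1 fps_power_zeroth)
qed

text \<open>Power sums of the five roots of \<open>modpoly x\<close>.\<close>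

definition ps1 :: "'a::comm_ring_1 \<Rightarrow> 'a" where
  "ps1 x = 205 * x + 4300 * x ^ 2 + 34000 * x ^ 3 + 120000 * x ^ 4 + 160000 * x ^ 5"

definition ps2 :: "'a::comm_ring_1 \<Rightarrow> 'a" where
  "ps2 x = 430 * x + 50975 * x ^ 2 + 1833000 * x ^ 3 + 32674000 * x ^ 4 + 341920000 * x ^ 5 +
     2253600000 * x ^ 6 + 9536000000 * x ^ 7 + 25280000000 * x ^ 8 + 38400000000 * x ^ 9 +
     25600000000 * x ^ 10"

definition ps3 :: "'a::comm_ring_1 \<Rightarrow> 'a" where
  "ps3 x = 255 * x + 137475 * x ^ 2 + 14181325 * x ^ 3 + 643444500 * x ^ 4 + 16718460000 * x ^ 5 +
     281418400000 * x ^ 6 + 3281028000000 * x ^ 7 + 27510480000000 * x ^ 8 + 169106560000000 *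
     x ^ 9 + 765964800000000 * x ^ 10 + 2534784000000000 * x ^ 11 + 5975040000000000 * x ^ 12 +
     9523200000000000 * x ^ 13 + 9216000000000000 * x ^ 14 + 4096000000000000 * x ^ 15"

definition ps4 :: "'a::comm_ring_1 \<Rightarrow> 'a" where
  "ps4 x = 60 * x + 163370 * x ^ 2 + 42896300 * x ^ 3 + 4157461375 * x ^ 4 + 214792170000 * x ^ 5 +
     6983865900000 * x ^ 6 + 156574748000000 * x ^ 7 + 2559011444000000 * x ^ 8 +
     31599402240000000 * x ^ 9 + 301746822400000000 * x ^ 10 + 2260873728000000000 * x ^ 11 +
     13395192960000000000 * x ^ 12 + 62871347200000000000 * x ^ 13 + 232809676800000000000 * x
     ^ 14 + 672722944000000000000 * x ^ 15 + 1486827520000000000000 * x ^ 16 +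
     2429747200000000000000 * x ^ 17 + 2768896000000000000000 * x ^ 18 + 1966080000000000000000
     * x ^ 19 + 655360000000000000000 * x ^ 20"

text \<open>Newton's identities for the elementary symmetric functions -mc4, mc3, -mc2, mc1; they
  certify the long expressions.\<close>

lemma newton_step:
  fixes x :: "'a::comm_ring_1"
  shows "ps1 x = - mc4 x" "ps2 x = - mc4 x * ps1 x - 2 * mc3 x"
    "ps3 x = - mc4 x * ps2 x - mc3 x * ps1 x - 3 * mc2 x"
    "ps4 x = - mc4 x * ps3 x - mc3 x * ps2 x - mc2 x * ps1 x - 4 * mc1 x"
  unfolding ps1_def ps2_def ps3_def ps4_def mc1_def mc2_def mc3_def mc4_def
  by (simp_all add: algebra_simps power_numeral_reduce)

lemma newton_identities:
  fixes a b c d e :: "'a::comm_ring_1"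
  defines "e1 \<equiv> a + b + c + d + e"
    and "e2 \<equiv> a*b + a*c + a*d + a*e + b*c + b*d + b*e + c*d + c*e + d*e"
    and "e3 \<equiv> a*b*c + a*b*d + a*b*e + a*c*d + a*c*e + a*d*e + b*c*d + b*c*e + b*d*e + c*d*e"
    and "e4 \<equiv> a*b*c*d + a*b*c*e + a*b*d*e + a*c*d*e + b*c*d*e"
  defines "p \<equiv> \<lambda>k. a ^ k + b ^ k + c ^ k + d ^ k + e ^ k"
  shows "p 1 = e1" "p 2 = e1 * p 1 - 2 * e2" "p 3 = e1 * p 2 - e2 * p 1 + 3 * e3"
    "p 4 = e1 * p 3 - e2 * p 2 + e3 * p 1 - 4 * e4"
  unfolding e1_def e2_def e3_def e4_def p_def
  by (simp_all add: algebra_simps power_numeral_reduce)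

lemma mc_compose:
  assumes "fps_nth g 0 = 0"
  shows "mc0 f oo g = mc0 (f oo g)" "mc1 f oo g = mc1 (f oo g)" "mc2 f oo g = mc2 (f oo g)"
    "mc3 f oo g = mc3 (f oo g)" "mc4 f oo g = mc4 (f oo g :: complex fps)"
  unfolding mc0_def mc1_def mc2_def mc3_def mc4_def using assms
  by (simp_all add: fps_compose_add_distrib fps_compose_sub_distrib fps_compose_mult_distrib
      fps_compose_power fps_compose_uminus numeral_fps_const)

lemma ps_compose:
  assumes "fps_nth g 0 = 0"
  shows "ps1 f oo g = ps1 (f oo g)" "ps2 f oo g = ps2 (f oo g)" "ps3 f oo g = ps3 (f oo g)"
    "ps4 f oo g = ps4 (f oo g :: complex fps)"
  unfolding newton_step using assms
  by (simp_all add: newton_step fps_compose_add_distrib fps_compose_sub_distrib fps_compose_mult_distrib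
      fps_compose_uminus numeral_fps_const mc_compose)

lemma rot_mc:
  "rot i (mc0 f) = mc0 (rot i f)" "rot i (mc1 f) = mc1 (rot i f)" "rot i (mc2 f) = mc2 (rot i f)"
  "rot i (mc3 f) = mc3 (rot i f)" "rot i (mc4 f) = mc4 (rot i f)"
  by (simp_all add: rot_def mc_compose)

lemma rot_modpoly: "modpoly (y_fps oo fps_X ^ 5) (rot i y_fps) = 0"
proof -
  have "rot i (modpoly (y_fps oo fps_X ^ 5) y_fps) = modpoly (rot i (y_fps oo fps_X ^ 5)) (rot i y_fps)"
    unfolding modpoly_def by (simp add: rot_add rot_mult rot_power rot_mc)
  moreover have "rot i (0 :: complex fps) = 0" by (simp add: rot_def)
  ultimately show ?thesis by (simp add: modular_equation)
qed

text \<open>The modular equation only says that each conjugate of y is a root. Power sums need the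
  conjugates to be all five roots: they are distinct because their coefficients of q are the
  different powers of zeta, and \<open>modpoly\<close> is monic of degree five.\<close>

lemma U5_fps_y_power:
  "5 * U5_fps y_fps = ps1 y_fps" "5 * U5_fps (y_fps ^ 2) = ps2 y_fps"
  "5 * U5_fps (y_fps ^ 3) = ps3 y_fps" "5 * U5_fps (y_fps ^ 4) = ps4 y_fps"
proof -
  define Y where "Y = y_fps oo fps_X ^ 5"
  define r where "r i = rot i y_fps" for i
  define P where "P = [:mc0 Y, mc1 Y, mc2 Y, mc3 Y, mc4 Y, 1:]"
  define Q where "Q = (\<Prod>i<5. [:- r i, 1:])"
  have zeta_inj: "i = j" if "i < 5" "j < 5" "zeta ^ i = zeta ^ j" for i j :: nat
    using that
  proof (induction i j rule: linorder_wlog)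
    case (le i j)
    have "zeta ^ j = zeta ^ i * zeta ^ (j - i)" using power_add[of zeta i "j - i"] le by simp
    then have "zeta ^ i * zeta ^ (j - i) = zeta ^ i * 1" using le by simp
    moreover have "zeta \<noteq> 0" using zeta_power_5 by auto
    ultimately have "zeta ^ (j - i) = 1" by simp
    then have "5 dvd j - i" using zeta_power_neq_1 by blast
    then show ?case using le dvd_imp_le[of 5 "j - i"] by (cases "j - i = 0") auto
  qed auto
  have inj: "inj_on r {..<5}"
  proof (rule inj_onI)
    fix i j assume "i \<in> {..<5::nat}" "j \<in> {..<5::nat}" "r i = r j"
    then have "fps_nth (r i) 1 = fps_nth (r j) 1" "i < 5" "j < 5" by auto
    then show "i = j" using zeta_inj by (simp add: r_def)
  qed
  have Q: "Q = [:- r 0, 1:] * [:- r 1, 1:] * [:- r 2, 1:] * [:- r 3, 1:] * [:- r 4, 1:]"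
  proof -
    have "(\<Prod>i<5::nat. f i) = f 0 * f 1 * f 2 * f 3 * f 4" for f :: "nat \<Rightarrow> complex fps poly"
      by (simp add: lessThan_expand mult.assoc)
    then show ?thesis unfolding Q_def .
  qed
  have "P = Q"
  proof (rule poly_eqI_degree_lead_coeff[where n = 5 and A = "r ` {..<5}"])
    show "coeff P 5 = coeff Q 5"
      unfolding P_def Q by (simp add: eval_nat_numeral)
    show "degree P \<le> 5" "degree Q \<le> 5"
      by (simp add: P_def) (simp add: Q_def degree_prod_eq_sum_degree)
    show "card (r ` {..<5}) \<ge> 5" using inj by (simp add: card_image)
    fix z assume "z \<in> r ` {..<5}"
    then obtain i where i: "i < 5" "z = r i" by auto
    then have "poly Q z = 0" by (auto simp: Q_def poly_prod)
    moreover have "poly P z = modpoly Y z"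
      unfolding P_def modpoly_def by (simp add: algebra_simps power_numeral_reduce)
    then have "poly P z = 0" using rot_modpoly by (simp add: i r_def Y_def)
    ultimately show "poly P z = poly Q z" by simp
  qed
  then have "P = [:- r 0, 1:] * [:- r 1, 1:] * [:- r 2, 1:] * [:- r 3, 1:] * [:- r 4, 1:]"
    by (simp only: Q)
  then have e: "mc4 Y = - (r 0 + r 1 + r 2 + r 3 + r 4)"
    "mc3 Y = r 0*r 1 + r 0*r 2 + r 0*r 3 + r 0*r 4 + r 1*r 2 + r 1*r 3 + r 1*r 4 + r 2*r 3 + r 2*r 4 + r 3*r 4"
    "mc2 Y = - (r 0*r 1*r 2 + r 0*r 1*r 3 + r 0*r 1*r 4 + r 0*r 2*r 3 + r 0*r 2*r 4 + r 0*r 3*r 4 + r 1*r 2*r 3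
      + r 1*r 2*r 4 + r 1*r 3*r 4 + r 2*r 3*r 4)"
    "mc1 Y = r 0*r 1*r 2*r 3 + r 0*r 1*r 2*r 4 + r 0*r 1*r 3*r 4 + r 0*r 2*r 3*r 4 + r 1*r 2*r 3*r 4"
    unfolding P_def by (simp_all add: algebra_simps)
  define p where "p k = r 0 ^ k + r 1 ^ k + r 2 ^ k + r 3 ^ k + r 4 ^ k" for k
  note N = newton_identities[of "r 0" "r 1" "r 2" "r 3" "r 4", folded p_def]
  have p1: "p 1 = ps1 Y" unfolding newton_step e N(1) by simp
  have p2: "p 2 = ps2 Y" unfolding newton_step(2) p1[symmetric] unfolding e N(2) by simp
  have p3: "p 3 = ps3 Y" unfolding newton_step(3) p1[symmetric] p2[symmetric] unfolding e N(3) by simp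
  have p4: "p 4 = ps4 Y"
    unfolding newton_step(4) p1[symmetric] p2[symmetric] p3[symmetric] unfolding e N(4) by (simp add: algebra_simps)
  have tr: "5 * U5_fps (y_fps ^ k) = g" if "p k = g oo fps_X ^ 5" for k g
  proof (rule compose_X_power_inj)
    have "p k = (\<Sum>i<5. rot i (y_fps ^ k))"
      by (simp add: p_def r_def rot_power lessThan_expand add_ac)
    then show "5 * U5_fps (y_fps ^ k) oo fps_X ^ 5 = g oo fps_X ^ 5"
      using that by (simp add: trace_eq fps_compose_mult_distrib numeral_fps_const fps_X_power_nth)
  qed simp
  have 0: "fps_nth (fps_X ^ 5 :: complex fps) 0 = 0" by (simp add: fps_X_power_nth)
  show "5 * U5_fps y_fps = ps1 y_fps" "5 * U5_fps (y_fps ^ 2) = ps2 y_fps"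
    "5 * U5_fps (y_fps ^ 3) = ps3 y_fps" "5 * U5_fps (y_fps ^ 4) = ps4 y_fps"
    using tr[of 1 "ps1 y_fps"] tr[of 2 "ps2 y_fps"] tr[of 3 "ps3 y_fps"] tr[of 4 "ps4 y_fps"]
    by (simp_all add: ps_compose[OF 0] p1[unfolded One_nat_def] p2 p3 p4 Y_def)
qed

section \<open>Images of F y^m under U5 for m up to 5\<close>

lemma logder_y: "logder y_fps (F_fps * (1 + 4 * y_fps))"
  by (simp add: logder_def theta_op_y mult_ac)

lemma theta_op_y_power: "theta_op (y_fps ^ k) = of_nat k * (y_fps ^ k * (F_fps * (1 + 4 * y_fps)))"
  using logder_power[OF logder_y, of k] by (simp add: logder_def mult_ac)

lemma F_nth_0 [simp]: "fps_nth F_fps 0 = 1"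
proof -
  have "fps_nth (theta_op y_fps) 1 = fps_nth (F_fps * (y_fps * (1 + 4 * y_fps))) 1"
    by (simp only: theta_op_y mult.assoc)
  then show ?thesis by (simp add: fps_mult_nth_1)
qed

lemma F_nonzero [simp]: "F_fps \<noteq> 0"
  using F_nth_0 by (metis fps_zero_nth zero_neq_one)

lemma theta_op_numeral_mult: "theta_op (numeral k * f) = numeral k * theta_op f"
  by (simp add: numeral_fps_const theta_op_const)

lemma U5_fps_numeral_mult: "U5_fps (numeral k * f) = numeral k * U5_fps f"
  by (simp add: numeral_fps_const U5_fps_const_mult)

lemma U5_fps_of_nat_mult: "U5_fps (of_nat k * f) = of_nat k * U5_fps f"
  using U5_fps_const_mult[of "of_nat k" f] by (simp add: fps_of_nat)

lemma logder_prod: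
  assumes "\<And>i. i \<in> I \<Longrightarrow> logder (f i) (g i)"
  shows "logder (\<Prod>i\<in>I. f i) (\<Sum>i\<in>I. g i)"
  using assms
proof (induction I rule: infinite_finite_induct)
  case (insert i I)
  then show ?case using logder_mult[of "f i" "g i"] by simp
qed (simp_all add: logder_def)

lemma logder_unique: "logder f g \<Longrightarrow> logder f h \<Longrightarrow> f \<noteq> 0 \<Longrightarrow> g = h"
  by (simp add: logder_def)

lemma theta_op_rot: "theta_op (rot i f) = rot i (theta_op f)"
  by (rule fps_ext) simp

text \<open>In 1 + 4 y = v^2 / u^2 the numerator is a series in q^5 and has norm v^10, while the
  denominator has norm (v^6 / t)^2. The quotient t^2 / v^2 is 1 + 4 y at q^5.\<close>

lemma norm5_one_plus_4y: "norm5 (1 + 4 * y_fps) = (1 + 4 * y_fps) oo fps_X ^ 5"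
proof -
  define v t where "v = phi_fps oo fps_X ^ 5" and "t = phi_fps oo fps_X ^ 25"
  have Y: "(1 + 4 * y_fps) oo fps_X ^ 5 = 1 + 4 * (y_fps oo fps_X ^ 5)"
    by (simp add: fps_compose_add_distrib fps_compose_mult_distrib fps_X_power_nth numeral_fps_const)
  have vnz: "v \<noteq> 0" unfolding v_def using phi_fps_nonzero compose_X_power_inj[of 5 phi_fps 0] by auto
  have t: "t ^ 2 = ((1 + 4 * y_fps) oo fps_X ^ 5) * v ^ 2"
    using phi_part_0_sq unfolding phi_part_0 Y t_def v_def .
  have "norm5 (v ^ 2) = norm5 (1 + 4 * y_fps) * norm5 phi_fps ^ 2"
    using phi_5_sq by (simp add: v_def norm5_mult norm5_power)
  moreover have "norm5 (v ^ 2) = (v ^ 5) ^ 2" unfolding v_def norm5_power norm5_compose_5 ..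
  ultimately have "(v ^ 5) ^ 2 * t ^ 2 = norm5 (1 + 4 * y_fps) * (norm5 phi_fps * t) ^ 2"
    by (simp add: power_mult_distrib mult_ac)
  also have "norm5 phi_fps * t = v ^ 6" using norm5_phi by (simp add: v_def t_def)
  finally have "v ^ 12 * ((1 + 4 * y_fps) oo fps_X ^ 5) = v ^ 12 * norm5 (1 + 4 * y_fps)"
    unfolding t by (simp add: power_mult[symmetric] power_add[symmetric] mult_ac flip: mult.assoc)
  then show ?thesis using vnz by simp
qed

text \<open>Logarithmic derivative of \<open>norm5_one_plus_4y\<close>: that of 1 + 4 y is 4 F y,
  the norm becomes a trace, and the substitution of q^5 brings a factor 5 that cancels the one in
  \<open>trace_eq\<close>.\<close>

lemma U5_fps_F_y: "U5_fps (F_fps * y_fps) = F_fps * y_fps"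
proof -
  define g where "g = 1 + 4 * y_fps"
  define h where "h = 4 * (F_fps * y_fps)"
  have 0: "fps_nth (fps_X ^ 5 :: complex fps) 0 = 0" by (simp add: fps_X_power_nth)
  have g: "logder g h"
  proof -
    have "theta_op g = 4 * theta_op y_fps" by (simp add: g_def theta_op_add theta_op_numeral_mult)
    then show ?thesis by (simp add: logder_def theta_op_y g_def h_def)
  qed
  then have "logder (rot i g) (rot i h)" for i
    by (simp add: logder_def theta_op_rot rot_mult)
  then have "logder (norm5 g) (\<Sum>i<5. rot i h)" unfolding norm5_def by (intro logder_prod)
  moreover have "norm5 g = g oo fps_X ^ 5" unfolding g_def by (rule norm5_one_plus_4y)
  ultimately have "logder (g oo fps_X ^ 5) (5 * (U5_fps h oo fps_X ^ 5))"
    by (simp add: trace_eq)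
  moreover have "logder (g oo fps_X ^ 5) (5 * (h oo fps_X ^ 5))"
    using g by (simp add: logder_def theta_op_compose_power fps_compose_mult_distrib[OF 0] mult_ac)
  moreover have "fps_nth (g oo fps_X ^ 5) 0 \<noteq> 0" by (simp add: g_def numeral_fps_const)
  then have "g oo fps_X ^ 5 \<noteq> 0" by (metis fps_zero_nth)
  ultimately have "5 * (U5_fps h oo fps_X ^ 5) = 5 * (h oo fps_X ^ 5)" by (rule logder_unique)
  then have "U5_fps h oo fps_X ^ 5 = h oo fps_X ^ 5" by simp
  then have "U5_fps h = h" by (rule compose_X_power_inj[rotated]) simp
  then show ?thesis by (simp add: h_def numeral_fps_const U5_fps_const_mult)
qed

text \<open>\<open>lv\<^sub>m\<close> is determined by \<open>U1 (y ^ m) = lv\<^sub>m y\<close>; see \<open>U5_fps_F_step\<close> for the recursion behind it.\<close>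

definition lv1 :: "'a::comm_ring_1 \<Rightarrow> 'a" where
  "lv1 x = x"

definition lv2 :: "'a::comm_ring_1 \<Rightarrow> 'a" where
  "lv2 x = 51 * x + 2355 * x ^ 2 + 34100 * x ^ 3 + 222000 * x ^ 4 + 680000 * x ^ 5 + 800000 * x ^ 6"

definition lv3 :: "'a::comm_ring_1 \<Rightarrow> 'a" where
  "lv3 x = 41 * x + 12370 * x ^ 2 + 729825 * x ^ 3 + 19031000 * x ^ 4 + 278878000 * x ^ 5 +
     2544800000 * x ^ 6 + 15104800000 * x ^ 7 + 58656000000 * x ^ 8 + 144320000000 * x ^ 9 +
     204800000000 * x ^ 10 + 128000000000 * x ^ 11"

definition lv4 :: "'a::comm_ring_1 \<Rightarrow> 'a" where
  "lv4 x = 11 * x + 19905 * x ^ 2 + 3454525 * x ^ 3 + 223905075 * x ^ 4 + 7754231500 * x ^ 5 +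
     167937100000 * x ^ 6 + 2472993600000 * x ^ 7 + 25981388000000 * x ^ 8 + 200155120000000 *
     x ^ 9 + 1145572480000000 * x ^ 10 + 4876736000000000 * x ^ 11 + 15269248000000000 * x ^ 12
     + 34216960000000000 * x ^ 13 + 52019200000000000 * x ^ 14 + 48128000000000000 * x ^ 15 +
     20480000000000000 * x ^ 16"

definition lv5 :: "'a::comm_ring_1 \<Rightarrow> 'a" where
  "lv5 x = x + 15460 * x ^ 2 + 7261110 * x ^ 3 + 1015561300 * x ^ 4 + 69341456625 * x ^ 5 +
     2845455650000 * x ^ 6 + 78359002700000 * x ^ 7 + 1547016184000000 * x ^ 8 +
     22842647868000000 * x ^ 9 + 259404025920000000 * x ^ 10 + 2307498560000000000 * x ^ 11 +
     16259980160000000000 * x ^ 12 + 91259994240000000000 * x ^ 13 + 408027340800000000000 * x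
     ^ 14 + 1445499596800000000000 * x ^ 15 + 4009533440000000000000 * x ^ 16 +
     8528916480000000000000 * x ^ 17 + 13441433600000000000000 * x ^ 18 +
     14794752000000000000000 * x ^ 19 + 10158080000000000000000 * x ^ 20 +
     3276800000000000000000 * x ^ 21"

text \<open>U5 is applied to Theta (y^m) = m F (y^m + 4 y^(m+1)). By U5 Theta = 5 Theta U5 the
  result is the derivative of the trace p, so the value at m + 1 follows from the value at
  m.\<close>

lemma U5_fps_F_step:
  assumes "5 * U5_fps (y_fps ^ m) = p" "U5_fps (F_fps * y_fps ^ m) = F_fps * l" "m > 0"
    and "theta_op p = of_nat m * (F_fps * (l + 4 * l'))"
  shows "U5_fps (F_fps * y_fps ^ Suc m) = F_fps * l'"
proof -
  have "of_nat m * (F_fps * y_fps ^ m + 4 * (F_fps * y_fps ^ Suc m)) = theta_op (y_fps ^ m)"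
    unfolding theta_op_y_power by (simp add: algebra_simps)
  then have "U5_fps (of_nat m * (F_fps * y_fps ^ m + 4 * (F_fps * y_fps ^ Suc m))) = theta_op p"
    unfolding assms(1)[symmetric] by (simp only: U5_fps_theta_op theta_op_numeral_mult)
  then have "of_nat m * (F_fps * l + 4 * U5_fps (F_fps * y_fps ^ Suc m)) = of_nat m * (F_fps * l + 4 * (F_fps * l'))"
    unfolding assms(4) U5_fps_of_nat_mult U5_fps_add U5_fps_numeral_mult assms(2)
    by (simp add: algebra_simps)
  then show ?thesis using assms(3) by simp
qed

lemma theta_op_ps:
  "theta_op (ps1 y_fps) = of_nat 1 * (F_fps * (lv1 y_fps + 4 * lv2 y_fps))"
  "theta_op (ps2 y_fps) = of_nat 2 * (F_fps * (lv2 y_fps + 4 * lv3 y_fps))"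
  "theta_op (ps3 y_fps) = of_nat 3 * (F_fps * (lv3 y_fps + 4 * lv4 y_fps))"
  "theta_op (ps4 y_fps) = of_nat 4 * (F_fps * (lv4 y_fps + 4 * lv5 y_fps))"
  unfolding ps1_def ps2_def ps3_def ps4_def lv1_def lv2_def lv3_def lv4_def lv5_def
    theta_op_add theta_op_numeral_mult theta_op_y_power theta_op_y
  by (simp_all add: algebra_simps power_numeral_reduce)

lemma U5_fps_F_y_power:
  "U5_fps (F_fps * y_fps) = F_fps * lv1 y_fps" "U5_fps (F_fps * y_fps ^ 2) = F_fps * lv2 y_fps"
  "U5_fps (F_fps * y_fps ^ 3) = F_fps * lv3 y_fps" "U5_fps (F_fps * y_fps ^ 4) = F_fps * lv4 y_fps"
  "U5_fps (F_fps * y_fps ^ 5) = F_fps * lv5 y_fps"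
proof -
  show 1: "U5_fps (F_fps * y_fps) = F_fps * lv1 y_fps" by (simp add: lv1_def U5_fps_F_y)
  show 2: "U5_fps (F_fps * y_fps ^ 2) = F_fps * lv2 y_fps"
    using U5_fps_F_step[OF _ _ _ theta_op_ps(1)] U5_fps_y_power 1 by (simp add: numeral_2_eq_2)
  show 3: "U5_fps (F_fps * y_fps ^ 3) = F_fps * lv3 y_fps"
    using U5_fps_F_step[OF _ _ _ theta_op_ps(2)] U5_fps_y_power 2 by (simp add: numeral_3_eq_3)
  show 4: "U5_fps (F_fps * y_fps ^ 4) = F_fps * lv4 y_fps"
    using U5_fps_F_step[OF _ _ _ theta_op_ps(3)] U5_fps_y_power 3 by (simp flip: power_Suc)
  show 5: "U5_fps (F_fps * y_fps ^ 5) = F_fps * lv5 y_fps"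
    using U5_fps_F_step[OF _ _ _ theta_op_ps(4)] U5_fps_y_power 4 by (simp flip: power_Suc)
qed

section \<open>The operator on expansions in \<open>y\<close>\<close>

text \<open>\<open>UF G\<close> is the expansion in powers of \<open>y\<close> of \<open>U1 (G(y))\<close>.\<close>

definition UF :: "complex fps \<Rightarrow> complex fps" where
  "UF G = (U5_fps (F_fps * (G oo y_fps)) * inverse F_fps) oo fps_inv y_fps"

lemma fps_inv_y_nth_0 [simp]: "fps_nth (fps_inv y_fps) 0 = 0"
  by (simp add: fps_inv_def)

lemma compose_y_inj: "G oo y_fps = H oo y_fps \<Longrightarrow> G = H"
proof -
  assume "G oo y_fps = H oo y_fps"
  then have "G oo y_fps oo fps_inv y_fps = H oo y_fps oo fps_inv y_fps" by simp
  then show ?thesis by (simp add: fps_compose_assoc[symmetric] fps_inv_right)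
qed

lemma UF_compose: "F_fps * (UF G oo y_fps) = U5_fps (F_fps * (G oo y_fps))"
proof -
  have "UF G oo y_fps = U5_fps (F_fps * (G oo y_fps)) * inverse F_fps"
    unfolding UF_def by (simp add: fps_compose_assoc[symmetric] fps_inv)
  moreover have "F_fps * inverse F_fps = 1" by (rule inverse_mult_eq_1') simp
  ultimately show ?thesis by (metis mult.left_commute mult.right_neutral)
qed

lemma UF_unique:
  assumes "U5_fps (F_fps * (G oo y_fps)) = F_fps * (H oo y_fps)"
  shows "UF G = H"
proof (rule compose_y_inj)
  have "F_fps * (UF G oo y_fps) = F_fps * (H oo y_fps)" using assms by (simp add: UF_compose)
  then show "UF G oo y_fps = H oo y_fps" by simp
qed

lemma UF_add: "UF (G + H) = UF G + UF H"
  by (rule UF_unique) (simp add: fps_compose_add_distrib distrib_left U5_fps_add UF_compose)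

lemma UF_const_mult: "UF (fps_const c * G) = fps_const c * UF G"
proof (rule UF_unique)
  have "U5_fps (F_fps * (fps_const c * G oo y_fps)) = U5_fps (fps_const c * (F_fps * (G oo y_fps)))"
    by (simp add: fps_compose_mult_distrib mult_ac)
  also have "\<dots> = fps_const c * (F_fps * (UF G oo y_fps))"
    by (simp only: U5_fps_const_mult UF_compose)
  also have "\<dots> = F_fps * (fps_const c * UF G oo y_fps)"
    by (simp add: fps_compose_mult_distrib mult_ac)
  finally show "U5_fps (F_fps * (fps_const c * G oo y_fps)) = F_fps * (fps_const c * UF G oo y_fps)" .
qed

lemma UF_numeral_mult: "UF (numeral k * G) = numeral k * UF G"
  by (simp add: numeral_fps_const UF_const_mult)

lemma UF_0 [simp]: "UF 0 = 0"
  using UF_const_mult[of 0 0] by simp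

lemma UF_sum: "UF (\<Sum>i\<in>I. f i) = (\<Sum>i\<in>I. UF (f i))"
  by (induction I rule: infinite_finite_induct) (simp_all add: UF_add)

text \<open>The relation is multiplied by F G(y) before U5 is applied; each coefficient then leaves
  U5 with y(q^5) replaced by y. The two uses have powers of X and powers of 1 + 5 X for
  \<open>H\<close>.\<close>

lemma UF_relation:
  assumes "(\<Sum>j\<in>J. (C j oo y_fps oo fps_X ^ 5) * (H j oo y_fps)) = 0"
  shows "(\<Sum>j\<in>J. C j * UF (H j * G)) = 0"
proof -
  have "F_fps * ((\<Sum>j\<in>J. C j * UF (H j * G)) oo y_fps)
      = (\<Sum>j\<in>J. (C j oo y_fps) * (F_fps * (UF (H j * G) oo y_fps)))"
    by (simp add: fps_compose_sum_distrib fps_compose_mult_distrib sum_distrib_left mult_ac)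
  also have "\<dots> = (\<Sum>j\<in>J. U5_fps ((C j oo y_fps oo fps_X ^ 5) * (F_fps * (H j * G oo y_fps))))"
    by (simp add: UF_compose U5_fps_compose_mult)
  also have "\<dots> = U5_fps (F_fps * (G oo y_fps) * (\<Sum>j\<in>J. (C j oo y_fps oo fps_X ^ 5) * (H j oo y_fps)))"
  proof -
    have s: "U5_fps (\<Sum>j\<in>J. f j) = (\<Sum>j\<in>J. U5_fps (f j))" for f :: "_ \<Rightarrow> complex fps"
      by (rule fps_ext) (simp add: fps_sum_nth)
    show ?thesis unfolding sum_distrib_left s
      by (intro sum.cong refl arg_cong[of _ _ U5_fps]) (simp add: fps_compose_mult_distrib mult_ac)
  qed
  also have "\<dots> = F_fps * (0 oo y_fps)"
    unfolding assms by (rule fps_ext) simp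
  finally have "(\<Sum>j\<in>J. C j * UF (H j * G)) oo y_fps = 0 oo y_fps" by simp
  then show ?thesis by (rule compose_y_inj)
qed

lemma UF_recurrence:
  "UF (fps_X ^ 5 * G) = - (mc0 fps_X * UF G + mc1 fps_X * UF (fps_X * G) + mc2 fps_X * UF (fps_X ^ 2 * G)
     + mc3 fps_X * UF (fps_X ^ 3 * G) + mc4 fps_X * UF (fps_X ^ 4 * G))"
proof -
  define C where "C j = [mc0 fps_X, mc1 fps_X, mc2 fps_X, mc3 fps_X, mc4 fps_X, 1 :: complex fps] ! j" for j
  have s: "{..<6::nat} = {0, 1, 2, 3, 4, 5}" by auto
  have X: "fps_X oo y_fps = y_fps" by (rule fps_X_fps_compose_startby0) simp
  have "(\<Sum>j<6. C j * UF (fps_X ^ j * G)) = 0"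
  proof (rule UF_relation)
    have "(\<Sum>j<6. (C j oo y_fps oo fps_X ^ 5) * (fps_X ^ j oo y_fps)) = modpoly (y_fps oo fps_X ^ 5) y_fps"
      by (simp add: s C_def mc_compose X fps_X_power_compose fps_X_power_nth modpoly_def add_ac)
    then show "(\<Sum>j<6. (C j oo y_fps oo fps_X ^ 5) * (fps_X ^ j oo y_fps)) = 0"
      by (simp add: modular_equation)
  qed
  then have "mc0 fps_X * UF G + mc1 fps_X * UF (fps_X * G) + mc2 fps_X * UF (fps_X ^ 2 * G)
     + mc3 fps_X * UF (fps_X ^ 3 * G) + mc4 fps_X * UF (fps_X ^ 4 * G) + UF (fps_X ^ 5 * G) = 0"
    by (simp add: s C_def add_ac)
  then show ?thesis by (metis eq_neg_iff_add_eq_0 add.commute)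
qed

lemma lv_compose:
  "lv1 fps_X oo y_fps = lv1 y_fps" "lv2 fps_X oo y_fps = lv2 y_fps" "lv3 fps_X oo y_fps = lv3 y_fps"
  "lv4 fps_X oo y_fps = lv4 y_fps" "lv5 fps_X oo y_fps = lv5 y_fps"
  unfolding lv1_def lv2_def lv3_def lv4_def lv5_def
  by (simp_all add: fps_compose_add_distrib fps_compose_mult_distrib fps_X_power_compose
      fps_X_fps_compose_startby0 numeral_fps_const)

lemma UF_X_power:
  "UF fps_X = lv1 fps_X" "UF (fps_X ^ 2) = lv2 fps_X" "UF (fps_X ^ 3) = lv3 fps_X"
  "UF (fps_X ^ 4) = lv4 fps_X" "UF (fps_X ^ 5) = lv5 fps_X"
  by (rule UF_unique; simp add: lv_compose fps_X_power_compose fps_X_fps_compose_startby0 U5_fps_F_y_power)+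

lemma fps_X_power_dvd_compose:
  assumes "fps_X ^ k dvd G" "fps_nth g 0 = 0"
  shows "fps_X ^ k dvd (G oo g :: complex fps)"
proof -
  from assms(1) obtain H where "G = fps_X ^ k * H" by (elim dvdE)
  then have "G oo g = g ^ k * (H oo g)"
    by (simp add: assms(2) fps_compose_mult_distrib fps_X_power_compose)
  moreover have "fps_X dvd g"
    using fps_X_power_dvd_iff[of 1 g] assms(2) by simp
  ultimately show ?thesis by (simp add: dvd_power_same)
qed

lemma UF_dvd:
  assumes "fps_X ^ (5 * r + 1) dvd G"
  shows "fps_X ^ (r + 1) dvd UF G"
  unfolding UF_def
proof (intro fps_X_power_dvd_compose fps_inv_y_nth_0 dvd_mult2)
  have "fps_X ^ (5 * r + 1) dvd F_fps * (G oo y_fps)"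
    using assms by (intro dvd_mult fps_X_power_dvd_compose) simp_all
  then show "fps_X ^ (r + 1) dvd U5_fps (F_fps * (G oo y_fps))"
    unfolding fps_X_power_dvd_iff by simp
qed

text \<open>By \<open>UF_dvd\<close> the coefficient of X^r depends only on G modulo X^(5 r + 1).
  Bounds for monomials thus carry over to power series such as those with a denominator (1 + 5
  X)^n.\<close>

lemma UF_nth:
  "fps_nth (UF G) r = (\<Sum>m\<le>5 * r. fps_nth G m * fps_nth (UF (fps_X ^ m)) r)"
proof -
  define H where "H = (\<Sum>m\<le>5 * r. fps_const (fps_nth G m) * fps_X ^ m)"
  have H: "fps_nth H i = (if i \<le> 5 * r then fps_nth G i else 0)" for i
    by (simp add: H_def fps_sum_nth fps_X_power_nth if_distrib cong: if_cong)
  have "fps_X ^ (5 * r + 1) dvd G - H"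
    unfolding fps_X_power_dvd_iff by (simp add: H)
  then have "fps_nth (UF (G - H)) r = 0"
    using UF_dvd[of r "G - H"] unfolding fps_X_power_dvd_iff by simp
  moreover have "UF G = UF (G - H) + UF H" unfolding UF_add[symmetric] by simp
  moreover have "fps_nth (UF H) r = (\<Sum>m\<le>5 * r. fps_nth G m * fps_nth (UF (fps_X ^ m)) r)"
    by (simp add: H_def UF_sum UF_const_mult fps_sum_nth)
  ultimately show ?thesis by simp
qed

section \<open>Divisibility of the coefficients by powers of five\<close>

definition fivadic :: "(nat \<Rightarrow> nat) \<Rightarrow> complex fps \<Rightarrow> bool" where
  "fivadic e G \<longleftrightarrow> (\<forall>n. \<exists>k. fps_nth G n = of_int (5 ^ e n * k))"

lemma fivadic_add: "fivadic e G \<Longrightarrow> fivadic e H \<Longrightarrow> fivadic e (G + H)"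
  unfolding fivadic_def by (metis fps_add_nth of_int_add distrib_left)

lemma fivadic_uminus: "fivadic e G \<Longrightarrow> fivadic e (- G)"
  unfolding fivadic_def by (metis fps_neg_nth of_int_minus mult_minus_right)

lemma fivadic_diff: "fivadic e G \<Longrightarrow> fivadic e H \<Longrightarrow> fivadic e (G - H)"
  using fivadic_add[of e G "- H"] fivadic_uminus by simp

lemma of_int_pow5_sum:
  assumes "\<And>i. i \<in> I \<Longrightarrow> \<exists>k. (f i :: complex) = of_int (5 ^ e * k)"
  shows "\<exists>k. (\<Sum>i\<in>I. f i) = of_int (5 ^ e * k)"
proof -
  obtain k where "\<And>i. i \<in> I \<Longrightarrow> f i = of_int (5 ^ e * k i)" using assms by metis
  then have "(\<Sum>i\<in>I. f i) = of_int (5 ^ e * (\<Sum>i\<in>I. k i))"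
    by (simp add: sum_distrib_left)
  then show ?thesis by blast
qed

lemma of_int_pow5_mult:
  assumes "\<exists>k. (a :: complex) = of_int (5 ^ e * k)" "\<exists>k. b = of_int (5 ^ f * k)" "h \<le> e + f"
  shows "\<exists>k. a * b = of_int (5 ^ h * k)"
proof -
  obtain k l where "a = of_int (5 ^ e * k)" "b = of_int (5 ^ f * l)" using assms(1,2) by auto
  then have "a * b = of_int (5 ^ (h + (e + f - h)) * (k * l))"
    using assms(3) by (simp add: power_add)
  then have "a * b = of_int (5 ^ h * (5 ^ (e + f - h) * (k * l)))" by (simp only: power_add mult.assoc)
  then show ?thesis by blast
qed

lemma fivadic_mult:
  assumes "fivadic e G" "fivadic f H" "\<And>i j. h (i + j) \<le> e i + f j"
  shows "fivadic h (G * H)"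
  unfolding fivadic_def fps_mult_nth
proof (intro allI of_int_pow5_sum)
  fix n i :: nat assume "i \<in> {0..n}"
  then have "h n \<le> e i + f (n - i)" using assms(3)[of i "n - i"] by simp
  then show "\<exists>k. fps_nth G i * fps_nth H (n - i) = of_int (5 ^ h n * k)"
    using assms(1,2) unfolding fivadic_def by (intro of_int_pow5_mult) auto
qed

lemma fivadic_monom:
  assumes "(5::nat) ^ e l dvd numeral c"
  shows "fivadic e (numeral c * fps_X ^ l)"
  unfolding fivadic_def
proof
  fix n
  from assms obtain k where k: "(numeral c :: nat) = 5 ^ e l * k" by (elim dvdE)
  have "numeral c = (of_nat (numeral c) :: complex)" by simp
  also have "\<dots> = of_int (5 ^ e l * int k)" unfolding k by simp
  finally have "fps_nth (numeral c * fps_X ^ l :: complex fps) n = of_int (5 ^ e n * (if n = l then int k else 0))"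
    by (simp add: numeral_fps_const fps_X_power_nth)
  then show "\<exists>k. fps_nth (numeral c * fps_X ^ l :: complex fps) n = of_int (5 ^ e n * k)" by blast
qed

lemma fivadic_X: "e 1 = 0 \<Longrightarrow> fivadic e fps_X"
  unfolding fivadic_def by (auto simp: fps_X_nth intro: exI[of _ 1] exI[of _ 0])

lemma fivadic_X_mult: "(5::nat) ^ e 1 dvd numeral c \<Longrightarrow> fivadic e (numeral c * fps_X)"
  using fivadic_monom[of e 1 c] by simp

text \<open>For m > 5 r the floor is negative, and \<open>nat\<close> turns it into an empty
  condition.\<close>

definition mexp :: "nat \<Rightarrow> nat \<Rightarrow> nat" where
  "mexp m r = nat ((5 * int r - int m) div 6)"

text \<open>The offset j in 5 l + j is the power of z that the coefficient accompanies, so that in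
  the recurrence it cancels against the j in 5 i - (k + j).\<close>

lemma fivadic_mc:
  "fivadic (\<lambda>l. (5 * l + 0) div 6) (mc0 fps_X)" "fivadic (\<lambda>l. (5 * l + 1) div 6) (mc1 fps_X)"
  "fivadic (\<lambda>l. (5 * l + 2) div 6) (mc2 fps_X)" "fivadic (\<lambda>l. (5 * l + 3) div 6) (mc3 fps_X)"
  "fivadic (\<lambda>l. (5 * l + 4) div 6) (mc4 fps_X)"
  unfolding mc0_def mc1_def mc2_def mc3_def mc4_def
  by (intro fivadic_diff fivadic_uminus fivadic_X fivadic_X_mult fivadic_monom; simp)+

lemma fivadic_lv:
  "fivadic (mexp 1) (lv1 fps_X)" "fivadic (mexp 2) (lv2 fps_X)" "fivadic (mexp 3) (lv3 fps_X)"
  "fivadic (mexp 4) (lv4 fps_X)" "fivadic (mexp 5) (lv5 fps_X)"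
  unfolding lv1_def lv2_def lv3_def lv4_def lv5_def
  by (intro fivadic_add fivadic_X fivadic_X_mult fivadic_monom; simp add: mexp_def)+

lemma fivadic_UF_X_power: "m \<ge> 1 \<Longrightarrow> fivadic (mexp m) (UF (fps_X ^ m))"
proof (induction m rule: less_induct)
  case (less m)
  show ?case
  proof (cases "m \<le> 5")
    case True
    then have "m = 1 \<or> m = 2 \<or> m = 3 \<or> m = 4 \<or> m = 5" using less.prems by auto
    then show ?thesis using fivadic_lv UF_X_power by auto
  next
    case False
    define k where "k = m - 5"
    have k: "m = k + 5" "k \<ge> 1" using False by (auto simp: k_def)
    have IH: "fivadic (mexp (k + j)) (UF (fps_X ^ j * fps_X ^ k))" if "j < 5" for j
      using less.IH[of "k + j"] that k by (simp add: add.commute flip: power_add)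
    \<comment> \<open>In general floor(A/6) + floor(B/6) >= floor((A + B - 5)/6). Here A + B = 5 (l
      + i) - k, so the increase from k to k + 5 pays exactly for the rounding.\<close>
    have step: "mexp (k + 5) (l + i) \<le> (5 * l + j) div 6 + mexp (k + j) i" for l i j
      unfolding mexp_def by (simp add: zdiv_int)
    have "fivadic (mexp (k + 5)) (UF (fps_X ^ 5 * fps_X ^ k))"
      unfolding UF_recurrence
      using IH[of 0] IH[of 1] IH[of 2] IH[of 3] IH[of 4]
      by (intro fivadic_uminus fivadic_add fivadic_mult[OF fivadic_mc(1) _ step] fivadic_mult[OF fivadic_mc(2) _ step]
          fivadic_mult[OF fivadic_mc(3) _ step] fivadic_mult[OF fivadic_mc(4) _ step] fivadic_mult[OF fivadic_mc(5) _ step])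
        simp_all
    then show ?thesis by (simp add: k add.commute flip: power_add)
  qed
qed

definition texp :: "nat \<Rightarrow> nat" where
  "texp m = nat (theta (int m))"

text \<open>The factor 5 that the theorem divides by is included here, and the coefficient of \<open>y\<close> is exempt.\<close>

definition pexp :: "nat \<Rightarrow> nat" where
  "pexp r = (if r \<le> 1 then 0 else nat (phi (int r)) + 1)"

text \<open>The powers of 5 built into \<open>V1\<close> and those gained from \<open>UF\<close> add
  up to one more than \<open>V0\<close> asks for. The cases separate the exceptional small arguments
  of theta and phi. At r = 1 the extra 5 is missing: for m = 1 both summands are 0.\<close>

lemma texp_mexp:
  assumes "m \<ge> 1"
  shows "pexp r \<le> texp m + mexp m r"
proof (cases "r \<le> 1")
  case False
  have *: "phi r' + 1 \<le> theta m' + b'"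
    if "m' \<ge> 1" "r' \<ge> 2" "b' \<ge> 0" "b' \<ge> (5 * r' - m') div 6" for m' r' b' :: int
  proof -
    consider "m' = 1 \<or> m' = 2" "r' = 2 \<or> r' = 3" | "m' = 1 \<or> m' = 2" "r' \<ge> 4"
      | "m' = 3 \<or> m' = 4" "r' = 2 \<or> r' = 3" | "m' \<ge> 5" "r' = 2 \<or> r' = 3" | "m' \<ge> 3" "r' \<ge> 4"
      using \<open>m' \<ge> 1\<close> \<open>r' \<ge> 2\<close> by linarith
    then show ?thesis
    proof cases
      case 2
      then have "(5 * r' - 5) div 6 \<le> (5 * r' - m') div 6" by (intro zdiv_mono1) auto
      then show ?thesis using 2 that(4) by (auto simp: phi_def theta_def)
    next
      case 4
      then have "(5 * 5 - 5) div 6 \<le> (5 * m' - 5) div 6" by (intro zdiv_mono1) auto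
      then show ?thesis using 4 that(3) by (auto simp: phi_def theta_def)
    next
      case 5
      define A B C where "A = (5 * m' - 5) div 6" and "B = (5 * r' - m') div 6" and "C = (5 * r' - 5) div 6"
      \<comment> \<open>Together these give 6 (A + B - C) >= 4 m' - 10, which is positive from m' =
        3 on.\<close>
      have "5 * m' - 10 \<le> 6 * A" "5 * r' - m' - 5 \<le> 6 * B" "6 * C \<le> 5 * r' - 5"
        unfolding A_def B_def C_def by linarith+
      then have "C \<le> A - 1 + B" using 5 by linarith
      then show ?thesis using 5 that(4) by (simp add: phi_def theta_def A_def B_def C_def)
    qed (use that(4) in \<open>auto simp: phi_def theta_def\<close>)
  qed
  have "phi (int r) + 1 \<le> theta (int m) + int (mexp m r)"
    using assms False by (intro *) (auto simp: mexp_def)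
  then show ?thesis
    using False assms phi_nonneg[of "int r"] theta_nonneg[of "int m"] by (simp add: pexp_def texp_def)
qed (simp add: pexp_def)

lemma UF_nth_0: "fps_nth G 0 = 0 \<Longrightarrow> fps_nth (UF G) 0 = 0"
  using UF_nth[of G 0] by simp

lemma fivadic_UF:
  assumes "fivadic texp G" "fps_nth G 0 = 0"
  shows "fivadic pexp (UF G)"
  unfolding fivadic_def
proof
  fix r
  show "\<exists>k. fps_nth (UF G) r = of_int (5 ^ pexp r * k)"
    unfolding UF_nth[of G r]
  proof (rule of_int_pow5_sum)
    fix m
    show "\<exists>k. fps_nth G m * fps_nth (UF (fps_X ^ m)) r = of_int (5 ^ pexp r * k)"
    \<comment> \<open>The bound for \<open>UF (fps_X ^ m)\<close> starts at m = 1; the term m = 0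
      drops out because G has no constant term.\<close>
    proof (cases "m = 0")
      case False
      then show ?thesis
        using assms(1) fivadic_UF_X_power[of m] texp_mexp[of m r] unfolding fivadic_def
        by (intro of_int_pow5_mult) auto
    qed (auto simp: assms(2) intro: exI[of _ 0])
  qed
qed

section \<open>Poles along \<open>1 + 5 y = 0\<close>\<close>

definition polyn :: "complex fps \<Rightarrow> bool" where
  "polyn G \<longleftrightarrow> G \<in> range fps_of_poly"

lemma polyn_add: "polyn G \<Longrightarrow> polyn H \<Longrightarrow> polyn (G + H)"
  and polyn_mult: "polyn G \<Longrightarrow> polyn H \<Longrightarrow> polyn (G * H)"
  and polyn_uminus: "polyn G \<Longrightarrow> polyn (- G)"
  and polyn_diff: "polyn G \<Longrightarrow> polyn H \<Longrightarrow> polyn (G - H)"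
  unfolding polyn_def image_iff Bex_def
  by (metis UNIV_I fps_of_poly_add, metis UNIV_I fps_of_poly_mult, metis UNIV_I fps_of_poly_uminus,
      metis UNIV_I fps_of_poly_diff)

lemma polyn_const: "polyn (fps_const c)" "polyn (numeral k)" "polyn 1" and polyn_X: "polyn fps_X"
  unfolding polyn_def image_iff Bex_def numeral_fps_const
  by (metis UNIV_I fps_of_poly_const, metis UNIV_I fps_of_poly_const, metis UNIV_I fps_of_poly_1,
      metis UNIV_I fps_of_poly_fps_X)

lemma polyn_power: "polyn G \<Longrightarrow> polyn (G ^ n)"
  by (induction n) (auto intro: polyn_mult polyn_const)

lemmas polyn_intros = polyn_add polyn_mult polyn_uminus polyn_diff polyn_const polyn_X polyn_power

lemma polyn_mc:
  "polyn (mc0 fps_X)" "polyn (mc1 fps_X)" "polyn (mc2 fps_X)" "polyn (mc3 fps_X)" "polyn (mc4 fps_X)"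
  unfolding mc0_def mc1_def mc2_def mc3_def mc4_def by (intro polyn_intros)+

lemma polyn_lv:
  "polyn (lv1 fps_X)" "polyn (lv2 fps_X)" "polyn (lv3 fps_X)" "polyn (lv4 fps_X)" "polyn (lv5 fps_X)"
  unfolding lv1_def lv2_def lv3_def lv4_def lv5_def by (intro polyn_intros)+

lemma polyn_UF_X_power: "m \<ge> 1 \<Longrightarrow> polyn (UF (fps_X ^ m))"
proof (induction m rule: less_induct)
  case (less m)
  show ?case
  proof (cases "m \<le> 5")
    case True
    then have "m = 1 \<or> m = 2 \<or> m = 3 \<or> m = 4 \<or> m = 5" using less.prems by auto
    then show ?thesis using polyn_lv UF_X_power by auto
  next
    case False
    define k where "k = m - 5"
    have k: "m = k + 5" "k \<ge> 1" using False by (auto simp: k_def)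
    have IH: "polyn (UF (fps_X ^ j * fps_X ^ k))" if "j < 5" for j
      using less.IH[of "k + j"] that k by (simp add: add.commute flip: power_add)
    have "polyn (UF (fps_X ^ 5 * fps_X ^ k))"
      unfolding UF_recurrence
      using IH[of 0] IH[of 1] IH[of 2] IH[of 3] IH[of 4]
      by (intro polyn_intros polyn_mc) simp_all
    then show ?thesis by (simp add: k add.commute flip: power_add)
  qed
qed

text \<open>The power of X in front keeps \<open>UF 1\<close> out of the expansion, for which
  \<open>polyn_UF_X_power\<close> makes no claim.\<close>

lemma polyn_UF_X_power_mult:
  assumes "polyn G" "m \<ge> 1"
  shows "polyn (UF (fps_X ^ m * G))"
proof -
  obtain p where "G = fps_of_poly p" using assms(1) by (auto simp: polyn_def)
  moreover have "polyn (UF (fps_X ^ m * fps_of_poly p))" using assms(2)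
  proof (induction p arbitrary: m)
    case (pCons c p)
    have "fps_X ^ m * fps_of_poly (pCons c p) = fps_const c * fps_X ^ m + fps_X ^ Suc m * fps_of_poly p"
      by (simp add: fps_of_poly_pCons algebra_simps)
    then show ?case
      using pCons.IH[of "Suc m"] pCons.prems
      by (simp only: UF_add UF_const_mult) (intro polyn_intros polyn_UF_X_power; simp)
  next
    case 0
    show ?case using polyn_const(1)[of 0] by simp
  qed
  ultimately show ?thesis by simp
qed

lemma polyn_UF_X_mult: "polyn G \<Longrightarrow> polyn (UF (fps_X * G))"
  using polyn_UF_X_power_mult[of G 1] by simp

text \<open>The modular equation rewritten for \<open>1 + 5 y\<close>, whose norm is \<open>(1 + 5 Y)\<^sup>5\<close>.\<close>

definition ec1 :: "'a::comm_ring_1 \<Rightarrow> 'a" where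
  "ec1 x = 5 - 150 * x - 2750 * x ^ 2 - 16875 * x ^ 3 - 46875 * x ^ 4 - 50000 * x ^ 5"

definition ec2 :: "'a::comm_ring_1 \<Rightarrow> 'a" where
  "ec2 x = - 10 - 650 * x - 12125 * x ^ 2 - 85625 * x ^ 3 - 262500 * x ^ 4 - 300000 * x ^ 5"

definition ec3 :: "'a::comm_ring_1 \<Rightarrow> 'a" where
  "ec3 x = 10 - 1275 * x - 25875 * x ^ 2 - 195000 * x ^ 3 - 650000 * x ^ 4 - 800000 * x ^ 5"

definition ec4 :: "'a::comm_ring_1 \<Rightarrow> 'a" where
  "ec4 x = - 5 - 1025 * x - 21500 * x ^ 2 - 170000 * x ^ 3 - 600000 * x ^ 4 - 800000 * x ^ 5"

text \<open>The factor 3125 = 5^5 clears the denominators of z = ((1 + 5 z) - 1) / 5. Since the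
  constant term is a pure power of 1 + 5 Y, solving for it creates no poles away from 1 + 5 y =
  0.\<close>

lemma modpoly_shift:
  fixes Y z :: "'a::comm_ring_1"
  shows "3125 * modpoly Y z = - ((1 + 5 * Y) ^ 5) + ec1 Y * (1 + 5 * z) + ec2 Y * (1 + 5 * z) ^ 2
     + ec3 Y * (1 + 5 * z) ^ 3 + ec4 Y * (1 + 5 * z) ^ 4 + (1 + 5 * z) ^ 5"
  unfolding modpoly_def mc0_def mc1_def mc2_def mc3_def mc4_def ec1_def ec2_def ec3_def ec4_def
  by (simp add: algebra_simps power_numeral_reduce)

lemma ec_compose:
  assumes "fps_nth g 0 = 0"
  shows "ec1 f oo g = ec1 (f oo g)" "ec2 f oo g = ec2 (f oo g)" "ec3 f oo g = ec3 (f oo g)"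
    "ec4 f oo g = ec4 (f oo g :: complex fps)"
  unfolding ec1_def ec2_def ec3_def ec4_def using assms
  by (simp_all add: fps_compose_add_distrib fps_compose_sub_distrib fps_compose_mult_distrib
      fps_compose_power fps_compose_uminus numeral_fps_const)

abbreviation e5 :: "complex fps" where "e5 \<equiv> 1 + 5 * fps_X"
abbreviation d5 :: "complex fps" where "d5 \<equiv> inverse e5"

lemma e5_nth_0: "fps_nth e5 0 = 1"
  by (simp add: numeral_fps_const)

lemma e5_d5: "e5 * d5 = 1"
  by (rule inverse_mult_eq_1') (simp add: e5_nth_0)

lemma e5_compose: "e5 oo g = 1 + 5 * g" if "fps_nth g 0 = 0" for g
  using that by (simp add: fps_compose_add_distrib fps_compose_mult_distrib numeral_fps_const
      fps_X_fps_compose_startby0)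

lemma UF_e5_relation:
  "e5 ^ 5 * UF G = ec1 fps_X * UF (e5 * G) + ec2 fps_X * UF (e5 ^ 2 * G) + ec3 fps_X * UF (e5 ^ 3 * G)
     + ec4 fps_X * UF (e5 ^ 4 * G) + UF (e5 ^ 5 * G)"
proof -
  define C where "C j = [- (e5 ^ 5), ec1 fps_X, ec2 fps_X, ec3 fps_X, ec4 fps_X, 1 :: complex fps] ! j" for j
  have s: "{..<6::nat} = {0, 1, 2, 3, 4, 5}" by auto
  have X: "fps_X oo y_fps = y_fps" by (rule fps_X_fps_compose_startby0) simp
  have 0: "fps_nth (fps_X ^ 5 :: complex fps) 0 = 0" by (simp add: fps_X_power_nth)
  have "(1 + 5 * y_fps) oo fps_X ^ 5 = 1 + 5 * (y_fps oo fps_X ^ 5)"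
    by (simp add: fps_compose_add_distrib fps_compose_mult_distrib 0 numeral_fps_const)
  then have Y: "e5 ^ n oo y_fps oo fps_X ^ 5 = (1 + 5 * (y_fps oo fps_X ^ 5)) ^ n" for n
    by (simp add: e5_compose 0 flip: fps_compose_power)
  have Z: "e5 ^ n oo y_fps = (1 + 5 * y_fps) ^ n" for n
    by (simp add: e5_compose flip: fps_compose_power)
  have "(\<Sum>j<6. C j * UF (e5 ^ j * G)) = 0"
  proof (rule UF_relation)
    have "(\<Sum>j<6. (C j oo y_fps oo fps_X ^ 5) * (e5 ^ j oo y_fps)) = 3125 * modpoly (y_fps oo fps_X ^ 5) y_fps"
      unfolding s C_def modpoly_shift Z
      by (simp add: ec_compose X 0 Y fps_compose_uminus add_ac)
    then show "(\<Sum>j<6. (C j oo y_fps oo fps_X ^ 5) * (e5 ^ j oo y_fps)) = 0"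
      by (simp add: modular_equation)
  qed
  moreover define U E where "U j = UF (e5 ^ j * G)" and "E = e5 ^ 5" for j
  moreover have "(\<Sum>j<6. C j * U j) = C 0 * U 0 + C 1 * U 1 + C 2 * U 2 + C 3 * U 3 + C 4 * U 4 + C 5 * U 5"
    by (simp add: s add_ac)
  moreover have "C 0 = - E" "C 1 = ec1 fps_X" "C 2 = ec2 fps_X" "C 3 = ec3 fps_X" "C 4 = ec4 fps_X" "C 5 = 1"
    by (simp_all add: C_def E_def)
  ultimately have "- E * U 0 + ec1 fps_X * U 1 + ec2 fps_X * U 2 + ec3 fps_X * U 3 + ec4 fps_X * U 4 + 1 * U 5 = 0"
    by (simp only:)
  then have "E * U 0 = ec1 fps_X * U 1 + ec2 fps_X * U 2 + ec3 fps_X * U 3 + ec4 fps_X * U 4 + U 5"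
    by (simp add: algebra_simps)
  then show ?thesis by (simp only: U_def E_def power_0 mult_1 power_one_right)
qed

lemma polyn_ec: "polyn (ec1 fps_X)" "polyn (ec2 fps_X)" "polyn (ec3 fps_X)" "polyn (ec4 fps_X)"
  unfolding ec1_def ec2_def ec3_def ec4_def by (intro polyn_intros)+

text \<open>The left side is the right side of \<open>UF_e5_relation\<close> for X / (1 + 5 X), with
  the powers of 1 + 5 X expanded. The relation alone would allow a pole of order five; the factor (1
  + 5 x)^4 found here reduces it to a simple one and is the source of the -4 in 5 n - 4.\<close>

lemma UF_X_d5_identity:
  fixes x :: "'a::comm_ring_1"
  shows "ec1 x * lv1 x + ec2 x * (lv1 x + 5 * lv2 x) + ec3 x * (lv1 x + 10 * lv2 x + 25 * lv3 x)
     + ec4 x * (lv1 x + 15 * lv2 x + 75 * lv3 x + 125 * lv4 x)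
     + (lv1 x + 20 * lv2 x + 150 * lv3 x + 500 * lv4 x + 625 * lv5 x)
   = (1 + 5 * x) ^ 4 * (21 * x + 80 * x ^ 2)"
  unfolding ec1_def ec2_def ec3_def ec4_def lv1_def lv2_def lv3_def lv4_def lv5_def
  by (simp add: algebra_simps power_numeral_reduce)

lemma UF_X_d5: "e5 * UF (fps_X * d5) = 21 * fps_X + 80 * fps_X ^ 2"
proof -
  have 1: "e5 * (fps_X * d5) = fps_X" using e5_d5 by (simp add: mult.left_commute)
  have c: "e5 ^ Suc n * (fps_X * d5) = fps_X * e5 ^ n" for n
    unfolding power_Suc2 mult.assoc 1 by (simp add: mult.commute)
  have "e5 ^ 2 * (fps_X * d5) = fps_X + 5 * fps_X ^ 2"
    "e5 ^ 3 * (fps_X * d5) = fps_X + 10 * fps_X ^ 2 + 25 * fps_X ^ 3"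
    "e5 ^ 4 * (fps_X * d5) = fps_X + 15 * fps_X ^ 2 + 75 * fps_X ^ 3 + 125 * fps_X ^ 4"
    "e5 ^ 5 * (fps_X * d5) = fps_X + 20 * fps_X ^ 2 + 150 * fps_X ^ 3 + 500 * fps_X ^ 4 + 625 * fps_X ^ 5"
    using c[of 1] c[of 2] c[of 3] c[of 4]
    by (simp_all add: algebra_simps power_numeral_reduce)
  then have "e5 ^ 5 * UF (fps_X * d5) = e5 ^ 4 * (21 * fps_X + 80 * fps_X ^ 2)"
    unfolding UF_e5_relation 1 by (simp only: UF_add UF_numeral_mult UF_X_power UF_X_d5_identity)
  then have "e5 ^ 4 * (e5 * UF (fps_X * d5)) = e5 ^ 4 * (21 * fps_X + 80 * fps_X ^ 2)"
    by (simp only: mult.assoc[symmetric] power_Suc2[symmetric]) simp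
  moreover have "e5 \<noteq> 0" using e5_nth_0 by (metis fps_zero_nth zero_neq_one)
  ultimately show ?thesis by simp
qed

lemma polyn_divide_e5:
  assumes "polyn G"
  obtains c H where "G = fps_const c + e5 * H" "polyn H"
proof -
  obtain p where p: "G = fps_of_poly p" using assms by (auto simp: polyn_def)
  have "p = [:1, 5:] * (p div [:1, 5:]) + p mod [:1, 5:]"
    by (rule mult_div_mod_eq[symmetric])
  moreover have "degree (p mod [:1, 5:]) = 0"
    using degree_mod_less[of "[:1, 5 :: complex:]" p] by auto
  then obtain c where "p mod [:1, 5:] = [:c:]" by (elim degree_eq_zeroE)
  ultimately have "G = fps_of_poly ([:1, 5:] * (p div [:1, 5:]) + [:c:])" unfolding p by metis
  also have "\<dots> = fps_const c + e5 * fps_of_poly (p div [:1, 5:])"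
    unfolding fps_of_poly_add fps_of_poly_mult by (simp add: fps_of_poly_pCons numeral_fps_const)
  finally show ?thesis using that by (auto simp: polyn_def)
qed

text \<open>A simple pole at \<open>1 + 5 y = 0\<close> stays simple; every further order of the pole contributes
  five orders, by \<open>UF_e5_relation\<close>.\<close>

lemma polyn_UF_pole:
  assumes "polyn G" "n \<ge> 1"
  shows "polyn (e5 ^ (5 * n - 4) * UF (fps_X * (G * d5 ^ n)))"
  using assms
proof (induction n arbitrary: G rule: less_induct)
  case (less n)
  show ?case
  proof (cases "n = 1")
    case True
    \<comment> \<open>Division by 1 + 5 X isolates a multiple of X / (1 + 5 X), whose image is known
      from \<open>UF_X_d5\<close>; the rest has no pole.\<close>
    obtain c H where G: "G = fps_const c + e5 * H" "polyn H" using polyn_divide_e5[OF less.prems(1)] .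
    have "fps_X * (G * d5) = fps_const c * (fps_X * d5) + fps_X * (H * (e5 * d5))"
      unfolding G by (simp add: algebra_simps)
    then have "fps_X * (G * d5) = fps_const c * (fps_X * d5) + fps_X * H"
      unfolding e5_d5 by simp
    then have "UF (fps_X * (G * d5)) = fps_const c * UF (fps_X * d5) + UF (fps_X * H)"
      by (simp only: UF_add UF_const_mult)
    then have "e5 * UF (fps_X * (G * d5)) = fps_const c * (e5 * UF (fps_X * d5)) + e5 * UF (fps_X * H)"
      by (simp only: distrib_left mult.left_commute)
    moreover have "polyn \<dots>"
      unfolding UF_X_d5 by (intro polyn_intros polyn_UF_X_mult G(2))
    ultimately show ?thesis by (simp add: True)
  next
    case False
    then have n: "n \<ge> 2" using less.prems by simp
    \<comment> \<open>The exponent is 5 (n - 1) - 4, the bound for poles of order n - 1: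
      multiplication by at least one factor 1 + 5 X has lowered the order to at most that.\<close>
    have step: "polyn (e5 ^ (5 * n - 9) * UF (e5 ^ j * (fps_X * (G * d5 ^ n))))" if "j \<ge> 1" for j
    proof (cases "j < n")
      case True
      have "e5 ^ j * d5 ^ n = d5 ^ (n - j)"
      proof -
        have "d5 ^ n = d5 ^ j * d5 ^ (n - j)" using True by (simp flip: power_add)
        then have "e5 ^ j * d5 ^ n = (e5 * d5) ^ j * d5 ^ (n - j)"
          by (simp only: power_mult_distrib mult.assoc)
        then show ?thesis by (simp only: e5_d5 power_one mult_1)
      qed
      then have "e5 ^ j * (fps_X * (G * d5 ^ n)) = fps_X * (G * d5 ^ (n - j))"
        by (metis mult.left_commute)
      moreover have "5 * n - 9 = (5 * j - 5) + (5 * (n - j) - 4)" using True n that by simp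
      moreover have "polyn (e5 ^ (5 * (n - j) - 4) * UF (fps_X * (G * d5 ^ (n - j))))"
        using True that less.prems by (intro less.IH) auto
      then have "polyn (e5 ^ (5 * j - 5) * (e5 ^ (5 * (n - j) - 4) * UF (fps_X * (G * d5 ^ (n - j)))))"
        by (rule polyn_mult[rotated]) (intro polyn_intros)
      ultimately show ?thesis by (simp only: power_add mult.assoc)
    next
      case False
      have "e5 ^ j * d5 ^ n = e5 ^ (j - n)"
      proof -
        have "e5 ^ j = e5 ^ (j - n) * e5 ^ n" using False by (simp flip: power_add)
        then have "e5 ^ j * d5 ^ n = e5 ^ (j - n) * (e5 * d5) ^ n"
          by (simp only: power_mult_distrib mult.assoc)
        then show ?thesis by (simp only: e5_d5 power_one mult_1_right)
      qed
      then have "e5 ^ j * (fps_X * (G * d5 ^ n)) = fps_X * (G * e5 ^ (j - n))"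
        by (metis mult.left_commute)
      then show ?thesis
        using less.prems(1) by (simp only:) (intro polyn_UF_X_mult polyn_intros)
    qed
    have "5 * n - 4 = (5 * n - 9) + 5" using n by simp
    then have "e5 ^ (5 * n - 4) * UF (fps_X * (G * d5 ^ n))
        = e5 ^ (5 * n - 9) * (e5 ^ 5 * UF (fps_X * (G * d5 ^ n)))"
      by (simp only: power_add mult.assoc)
    also have "\<dots> = ec1 fps_X * (e5 ^ (5 * n - 9) * UF (e5 ^ 1 * (fps_X * (G * d5 ^ n))))
        + ec2 fps_X * (e5 ^ (5 * n - 9) * UF (e5 ^ 2 * (fps_X * (G * d5 ^ n))))
        + ec3 fps_X * (e5 ^ (5 * n - 9) * UF (e5 ^ 3 * (fps_X * (G * d5 ^ n))))
        + ec4 fps_X * (e5 ^ (5 * n - 9) * UF (e5 ^ 4 * (fps_X * (G * d5 ^ n))))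
        + e5 ^ (5 * n - 9) * UF (e5 ^ 5 * (fps_X * (G * d5 ^ n)))"
      unfolding UF_e5_relation[of "fps_X * (G * d5 ^ n)"] power_one_right
      by (simp only: distrib_left mult.left_commute)
    also have "polyn \<dots>" by (intro polyn_add polyn_mult[OF polyn_ec(1)] polyn_mult[OF polyn_ec(2)]
        polyn_mult[OF polyn_ec(3)] polyn_mult[OF polyn_ec(4)] step) simp_all
    finally show ?thesis .
  qed
qed

text \<open>Each degree contributed by H brings its own factor 5, and this is the most by which e
  can grow per degree. It applies to 1 + 5 X and to its inverse alike.\<close>

lemma fivadic_id_mult:
  assumes "fivadic e G" "fivadic (\<lambda>n. n) H" "\<And>i. e (Suc i) \<le> Suc (e i)"
  shows "fivadic e (G * H)"
proof (rule fivadic_mult[OF assms(1,2)])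
  fix i j
  show "e (i + j) \<le> e i + j"
    by (induction j) (auto intro: order_trans[OF assms(3)])
qed

lemma fivadic_e5: "fivadic (\<lambda>n. n) e5"
proof -
  have "fivadic (\<lambda>n. n) 1"
    unfolding fivadic_def by (auto simp: fps_one_def intro: exI[of _ 1] exI[of _ 0])
  then show ?thesis by (intro fivadic_add fivadic_X_mult) simp_all
qed

lemma fivadic_d5: "fivadic (\<lambda>n. n) d5"
proof -
  let ?D = "Abs_fps (\<lambda>n. (- 5) ^ n) :: complex fps"
  have "e5 * ?D = 1"
  proof (rule fps_ext)
    fix n
    show "fps_nth (e5 * ?D) n = fps_nth 1 n"
      by (cases n) (simp_all add: distrib_right mult.assoc numeral_fps_const)
  qed
  then have "d5 = ?D" by (rule fps_inverse_unique)
  moreover have "(- 5) ^ n = (of_int (5 ^ n * (- 1) ^ n) :: complex)" for n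
    by (simp add: power_minus[of 5])
  then have "fivadic (\<lambda>n. n) ?D" unfolding fivadic_def fps_nth_Abs_fps by blast
  ultimately show ?thesis by simp
qed

lemma fivadic_mult_power:
  assumes "fivadic e G" "fivadic (\<lambda>n. n) H" "\<And>i. e (Suc i) \<le> Suc (e i)"
  shows "fivadic e (G * H ^ n)"
proof (induction n)
  case (Suc n)
  have "G * H ^ Suc n = (G * H ^ n) * H" by (simp add: mult_ac)
  show ?case unfolding \<open>G * H ^ Suc n = _\<close> by (rule fivadic_id_mult[OF Suc.IH assms(2)]) (rule assms(3))
qed (simp add: assms(1))

lemma texp_Suc: "texp (Suc i) \<le> Suc (texp i)"
  unfolding texp_def theta_def by (auto simp: nat_le_iff)

lemma pexp_Suc: "pexp (Suc i) \<le> Suc (pexp i)"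
  unfolding pexp_def phi_def by (auto simp: nat_le_iff)

section \<open>Integral expansions in \<open>y\<close>\<close>

text \<open>A bridge from \<open>ysum\<close> to composition with y. The coefficient at 0 is set to
  0 because \<open>ysum\<close> starts at m = 1.\<close>

definition coeff_fps :: "(int \<Rightarrow> int) \<Rightarrow> complex fps" where
  "coeff_fps c = Abs_fps (\<lambda>m. if m = 0 then 0 else of_int (c (int m)))"

lemma coeff_fps_nth [simp]: "fps_nth (coeff_fps c) m = (if m = 0 then 0 else of_int (c (int m)))"
  by (simp add: coeff_fps_def)

lemma finite_discrete: "discrete_fun c \<Longrightarrow> finite {m. m \<ge> 1 \<and> c m \<noteq> 0}"
  using finite_ysum_support[of c "\<lambda>_. 1"] by simp

lemma fps_to_fls_sum: "fps_to_fls (\<Sum>i\<in>I. f i) = (\<Sum>i\<in>I. fps_to_fls (f i))"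
  by (induction I rule: infinite_finite_induct) simp_all

lemma ysum_eq:
  assumes "discrete_fun c"
  shows "ysum c = fps_to_fls (coeff_fps c oo y_fps)"
proof -
  let ?S = "{m. m \<ge> 1 \<and> c m \<noteq> 0}"
  have fin: "finite ?S" using assms by (rule finite_discrete)
  have "coeff_fps c = (\<Sum>m\<in>?S. fps_const (of_int (c m)) * fps_X ^ nat m)"
  proof (rule fps_ext)
    fix n
    have "fps_nth (\<Sum>m\<in>?S. fps_const (of_int (c m)) * fps_X ^ nat m) n
        = (\<Sum>m\<in>?S. if m = int n then of_int (c m) else 0 :: complex)"
      unfolding fps_sum_nth by (rule sum.cong) (auto simp: fps_X_power_nth)
    also have "\<dots> = fps_nth (coeff_fps c) n" using fin by auto
    finally show "fps_nth (coeff_fps c) n = fps_nth (\<Sum>m\<in>?S. fps_const (of_int (c m)) * fps_X ^ nat m) n" ..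
  qed
  then have "coeff_fps c oo y_fps = (\<Sum>m\<in>?S. fps_const (of_int (c m)) * y_fps ^ nat m)"
    by (simp add: fps_compose_sum_distrib fps_compose_mult_distrib fps_X_power_compose)
  then have "fps_to_fls (coeff_fps c oo y_fps) = (\<Sum>m\<in>?S. of_int (c m) * y ^ nat m)"
    by (simp add: fps_to_fls_sum fls_times_fps_to_fls fps_to_fls_power fps_of_int fps_to_fls_of_int)
  also have "\<dots> = ysum c"
    unfolding ysum_def by (intro sum.cong refl) (auto simp: power_int_def)
  finally show ?thesis ..
qed

lemma polyn_coeff_fps: "discrete_fun c \<Longrightarrow> polyn (coeff_fps c)"
proof -
  assume "discrete_fun c"
  then obtain N where N: "\<forall>m\<ge>N. c m = 0" by (auto simp: discrete_fun_def)
  have "coeff_fps c = fps_of_poly (Poly (map (fps_nth (coeff_fps c)) [0..<nat N]))"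
    using N by (intro fps_ext) (auto simp: nth_default_def)
  then show ?thesis by (auto simp: polyn_def)
qed

lemma polyn_nth_eventually_0:
  assumes "polyn G"
  obtains N where "\<And>n. n \<ge> N \<Longrightarrow> fps_nth G n = 0"
proof -
  obtain p where "G = fps_of_poly p" using assms by (auto simp: polyn_def)
  then show ?thesis by (intro that[of "Suc (degree p)"]) (simp add: coeff_eq_0)
qed

lemma U5_fps_to_fls: "U5 (fps_to_fls f) = fps_to_fls (U5_fps f)"
  by (rule fls_eqI) (simp add: U5_nth nat_mult_distrib)

lemma U1_eq: "U1 (fps_to_fls (G oo y_fps)) = fps_to_fls (UF G oo y_fps)"
proof -
  have "U5 (F * fps_to_fls (G oo y_fps)) = F * fps_to_fls (UF G oo y_fps)"
    by (simp only: U5_fps_to_fls UF_compose flip: fls_times_fps_to_fls)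
  moreover have "F \<noteq> 0" by (simp add: fps_to_fls_eq_0_iff)
  ultimately show ?thesis by (simp add: U1_def)
qed

lemma divide_e5: "fps_to_fls (G oo y_fps) / (1 + 5 * y) ^ n = fps_to_fls (G * d5 ^ n oo y_fps)"
proof -
  have e: "(1 + 5 * y) ^ n = fps_to_fls (e5 ^ n oo y_fps)"
    by (simp add: fps_to_fls_power fls_times_fps_to_fls e5_compose flip: fps_compose_power)
  have "(G * d5 ^ n) * e5 ^ n = G * (e5 * d5) ^ n" by (simp only: power_mult_distrib mult_ac)
  then have "(G * d5 ^ n) * e5 ^ n = G" by (simp only: e5_d5 power_one mult_1_right)
  then have "fps_to_fls (G oo y_fps) = fps_to_fls (G * d5 ^ n oo y_fps) * (1 + 5 * y) ^ n"
    unfolding e by (metis fls_times_fps_to_fls fps_compose_mult_distrib y_nth_0)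
  moreover have "(1 + 5 * y) ^ n \<noteq> 0"
  proof -
    have "fps_nth (e5 ^ n oo y_fps) 0 = 1" by (simp add: fps_power_zeroth numeral_fps_const)
    then have "e5 ^ n oo y_fps \<noteq> 0" by (metis fps_zero_nth zero_neq_one)
    then show ?thesis unfolding e by (simp add: fps_to_fls_eq_0_iff)
  qed
  ultimately show ?thesis by simp
qed

text \<open>The numerator is the polynomial H. For the second half it has to be unique: composition
  with y is injective, so every s representing \<open>U1 f\<close> agrees with the coefficients of H
  at all m >= 1, whatever its values at m <= 0.\<close>

theorem theorem4p2:
  fixes n :: nat and f :: "complex fls"
  assumes "n \<ge> 1" and "f \<in> V1 n"
  shows "(\<exists>s. discrete_fun s \<and> U1 f = ysum s / (1 + 5 * y) ^ (5 * n - 4)) \<and>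
    (\<forall>s. discrete_fun s \<and> U1 f = ysum s / (1 + 5 * y) ^ (5 * n - 4) \<longrightarrow>
      (1 / 5) * (U1 f - of_int (s 1) * (y / (1 + 5 * y) ^ (5 * n - 4))) \<in> V0 (5 * n - 4))"
proof -
  let ?N = "5 * n - 4"
  obtain s0 where s0: "discrete_fun s0" and f: "f = ysum (\<lambda>m. s0 m * 5 ^ nat (theta m)) / (1 + 5 * y) ^ n"
    using assms(2) by (auto simp: V1_def)
  define c0 where "c0 m = s0 m * 5 ^ nat (theta m)" for m
  define G where "G = coeff_fps c0"
  have c0: "discrete_fun c0" using s0 unfolding discrete_fun_def c0_def by fastforce
  have Gf: "f = fps_to_fls (G * d5 ^ n oo y_fps)"
    unfolding f c0_def[symmetric] G_def ysum_eq[OF c0] divide_e5 ..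
  have G0: "fps_nth (G * d5 ^ n) 0 = 0" by (simp add: G_def)
  have "fivadic texp G"
    unfolding fivadic_def
  proof
    fix m
    have "fps_nth G m = of_int (5 ^ texp m * (if m = 0 then 0 else s0 (int m)))"
      by (simp add: G_def c0_def texp_def)
    then show "\<exists>k. fps_nth G m = of_int (5 ^ texp m * k)" ..
  qed
  then have "fivadic texp (G * d5 ^ n)"
    using fivadic_mult_power[where e = texp] fivadic_d5 texp_Suc by blast
  then have "fivadic pexp (UF (G * d5 ^ n))" by (rule fivadic_UF[OF _ G0])
  moreover define H where "H = UF (G * d5 ^ n) * e5 ^ ?N"
  ultimately have H: "fivadic pexp H"
    using fivadic_mult_power[where e = pexp] fivadic_e5 pexp_Suc by blast
  have H0: "fps_nth H 0 = 0" using UF_nth_0[OF G0] by (simp add: H_def)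
  \<comment> \<open>\<open>polyn_UF_pole\<close> expects a factor X in front, which the vanishing
    constant term of G provides.\<close>
  obtain g where g: "polyn g" "G = fps_X * g"
  proof -
    obtain p where p: "G = fps_of_poly p" using polyn_coeff_fps[OF c0] by (auto simp: polyn_def G_def)
    then have "coeff p 0 = 0" using G0 by (simp add: G_def flip: fps_of_poly_nth)
    then have "p = pCons 0 (poly_shift 1 p)"
      by (intro poly_eqI) (auto simp: coeff_pCons coeff_poly_shift split: nat.split)
    then have "G = fps_X * fps_of_poly (poly_shift 1 p)"
      unfolding p by (metis add_0 fps_const_0_eq_0 fps_of_poly_pCons mult.commute)
    then show ?thesis by (rule that[rotated]) (unfold polyn_def, rule rangeI)
  qed
  have pH: "polyn H"
    using polyn_UF_pole[OF g(1) assms(1)] by (simp add: H_def g(2) mult_ac)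
  have Uf: "U1 f = fps_to_fls (H oo y_fps) / (1 + 5 * y) ^ ?N"
  proof -
    have "H * d5 ^ ?N = UF (G * d5 ^ n) * (e5 * d5) ^ ?N"
      unfolding H_def by (simp only: power_mult_distrib mult.assoc)
    then have "H * d5 ^ ?N = UF (G * d5 ^ n)" by (simp only: e5_d5 power_one mult_1_right)
    then show ?thesis unfolding Gf U1_eq divide_e5 by simp
  qed
  have den: "(1 + 5 * y) ^ ?N \<noteq> 0"
  proof
    assume "(1 + 5 * y) ^ ?N = 0"
    then have "fps_to_fls (1 oo y_fps) / (1 + 5 * y) ^ ?N = 0" by simp
    then have "(1 * d5 ^ ?N oo y_fps) = 0" unfolding divide_e5 by (simp add: fps_to_fls_eq_0_iff)
    then have "fps_nth (1 * d5 ^ ?N oo y_fps) 0 = 0" by simp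
    then show False by (simp add: fps_power_zeroth numeral_fps_const)
  qed
  obtain k where k: "\<And>r. fps_nth H r = of_int (5 ^ pexp r * k r)"
    using H unfolding fivadic_def by metis
  show ?thesis
  proof (intro conjI allI impI)
    define s where "s m = (if m \<ge> 0 then 5 ^ pexp (nat m) * k (nat m) else 0)" for m
    obtain M where M: "\<And>r. r \<ge> M \<Longrightarrow> fps_nth H r = 0"
      using polyn_nth_eventually_0[OF pH] by blast
    have "k r = 0" if "r \<ge> M" for r using M[OF that] by (simp add: k)
    then have s: "discrete_fun s"
      unfolding discrete_fun_def by (intro exI[of _ "int M"]) (auto simp: s_def)
    have "H = coeff_fps s" using H0 by (intro fps_ext) (auto simp: k s_def)
    then show "\<exists>s. discrete_fun s \<and> U1 f = ysum s / (1 + 5 * y) ^ ?N"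
      using s Uf ysum_eq[OF s] by auto
  next
    fix s assume s: "discrete_fun s \<and> U1 f = ysum s / (1 + 5 * y) ^ ?N"
    then have "ysum s / (1 + 5 * y) ^ ?N = fps_to_fls (H oo y_fps) / (1 + 5 * y) ^ ?N"
      using Uf by (metis (no_types))
    then have "ysum s = fps_to_fls (H oo y_fps)"
      using den unfolding divide_cancel_right by blast
    then have "coeff_fps s oo y_fps = H oo y_fps" using s by (simp add: ysum_eq)
    then have sH: "coeff_fps s = H" by (rule compose_y_inj)
    have sk: "s (int r) = 5 ^ pexp r * k r" if "r \<ge> 1" for r
    proof -
      have "fps_nth (coeff_fps s) r = of_int (5 ^ pexp r * k r)" by (simp only: sH k)
      then show ?thesis using that by (simp only: coeff_fps_nth of_int_eq_iff split: if_splits)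
    qed
    \<comment> \<open>For m >= 2 the exponent \<open>pexp\<close> is phi + 1, and its extra 5 is the
      one divided off. At m = 1 stands the subtracted term, so s' is 0 there.\<close>
    define s' where "s' m = (if m \<ge> 2 then k (nat m) else 0)" for m :: int
    define c where "c m = s' m * 5 ^ nat (phi m)" for m
    have sc: "s m = 5 * c m" if "m \<ge> 2" for m
      using sk[of "nat m"] that by (simp add: c_def s'_def pexp_def)
    have s': "discrete_fun s'"
    proof -
      obtain M where M: "\<And>m. m \<ge> M \<Longrightarrow> s m = 0" using s by (auto simp: discrete_fun_def)
      have "s' m = 0" if "m \<ge> M" for m
        using M[OF that] sc[of m] by (cases "m \<ge> 2") (auto simp: c_def s'_def)
      then show ?thesis unfolding discrete_fun_def by blast
    qed
    then have c: "discrete_fun c" unfolding discrete_fun_def c_def by fastforce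
    have "coeff_fps s = fps_const (of_int (s 1)) * fps_X + 5 * coeff_fps c"
    proof (rule fps_ext)
      fix m :: nat
      consider "m = 0" | "m = 1" | "m \<ge> 2" by linarith
      then show "fps_nth (coeff_fps s) m = fps_nth (fps_const (of_int (s 1)) * fps_X + 5 * coeff_fps c) m"
        using sc[of "int m"] by cases (auto simp: numeral_fps_const c_def s'_def)
    qed
    then have "fps_to_fls (coeff_fps s oo y_fps) = of_int (s 1) * y + 5 * fps_to_fls (coeff_fps c oo y_fps)"
      by (simp add: fps_compose_add_distrib fps_compose_mult_distrib fps_X_fps_compose_startby0
          fls_times_fps_to_fls fps_of_int fps_to_fls_of_int)
    then have "ysum s = of_int (s 1) * y + 5 * ysum c" using s c by (simp add: ysum_eq)
    then have "(1 / 5) * (U1 f - of_int (s 1) * (y / (1 + 5 * y) ^ ?N)) = ysum c / (1 + 5 * y) ^ ?N"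
      using s by (simp add: add_divide_distrib)
    then show "(1 / 5) * (U1 f - of_int (s 1) * (y / (1 + 5 * y) ^ ?N)) \<in> V0 ?N"
      using s' unfolding V0_def c_def by blast
  qed
qed

end
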